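(* Let $k$ be a field of characteristic zero and let $(R,\Delta)$ be a commutative differential $k$-algebra. Suppose that $R$ is noetherian, $\dim_k R<|k|$ and $|\Delta|<|k|$. For a $\Delta$-prime ideal $P$ of $R$, the following are equivalent: (i) $P$ is $\Delta$-primitive; (ii) $P$ is $\Delta$-rational; (iii) $P$ is $|k|$-separable in $\Delta\text{-}{\rm spec}\,R$.
   Context: A commutative differential $k$-algebra is a pair $(R,\Delta)$ with $R$ a commutative $k$-algebra and $\Delta\subseteq{\rm Der}_k R$ a subset of $k$-linear derivations. A $\Delta$-ideal is an ideal $I$ with $\delta(I)\subseteq I$ for all $\delta\in\Delta$. A $\Delta$-prime ideal is a proper $\Delta$-ideal that is prime among $\Delta$-ideals; for noetherian $R$ these are exactly the prime ideals that are $\Delta$-ideals. $\Delta\text{-}{\rm spec}\,R$ is the set of $\Delta$-prime ideals with the subspace topology from ${\rm spec}\,R$. The $\Delta$-core $(J:\Delta)$ of an ideal $J$ is the largest $\Delta$-ideal contained in $J$. A $\Delta$-primitive ideal is the $\Delta$-core of a maximal ideal. For a $\Delta$-prime ideal $P$, derivations in $\Delta$ induce derivations on $R/P$ and extend uniquely to ${\rm Frac}(R/P)$; $Z_\Delta({\rm Frac}\,R/P)$ is the subfield of elements killed by all $\delta\in\Delta$, and $P$ is $\Delta$-rational if this field is algebraic over $k$. For a cardinal $\kappa$, a point $p$ of a topological space $X$ is $\kappa$-separable if there is a subset $\Lambda\subseteq\overline{\{p\}}\setminus\{p\}$ of cardinality strictly less than $\kappa$ with $\overline{\{p\}}\setminus\{p\}=\bigcup_{q\in\Lambda}\overline{\{q\}}$.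 *)

theory Defs
  imports
    "HOL-Algebra.Algebra"
    "HOL-Analysis.Abstract_Topology"
    "Jordan_Normal_Form.Missing_VectorSpace"
begin

unbundle cardinal_syntax


section \<open>Commutative differential algebras\<close>

text \<open>Derivations are taken to be extensional functions, so that two derivations are equal iff
  they agree on the carrier. Otherwise the cardinality of a set of derivations would be affected
  by values outside the carrier.\<close>

definition Der :: "('a, 'c) ring_scheme \<Rightarrow> ('a, 'b, 'd) module_scheme \<Rightarrow> ('b \<Rightarrow> 'b) set" where
  "Der K R = {d \<in> carrier R \<rightarrow>\<^sub>E carrier R.
     (\<forall>x\<in>carrier R. \<forall>y\<in>carrier R. d (x \<oplus>\<^bsub>R\<^esub> y) = d x \<oplus>\<^bsub>R\<^esub> d y) \<and>
     (\<forall>c\<in>carrier K. \<forall>x\<in>carrier R. d (c \<odot>\<^bsub>R\<^esub> x) = c \<odot>\<^bsub>R\<^esub> d x) \<and>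
     (\<forall>x\<in>carrier R. \<forall>y\<in>carrier R.
        d (x \<otimes>\<^bsub>R\<^esub> y) = (d x \<otimes>\<^bsub>R\<^esub> y) \<oplus>\<^bsub>R\<^esub> (x \<otimes>\<^bsub>R\<^esub> d y))}"

locale differential_algebra = K?: field K + R?: algebra K R
  for K :: "('a, 'c) ring_scheme" (structure) and R :: "('a, 'b, 'd) module_scheme" (structure) +
  fixes \<Delta> :: "('b \<Rightarrow> 'b) set"
  assumes derivations: "\<Delta> \<subseteq> Der K R"

definition delta_ideal :: "('b, 'm) ring_scheme \<Rightarrow> ('b \<Rightarrow> 'b) set \<Rightarrow> 'b set \<Rightarrow> bool" where
  "delta_ideal R \<Delta> I \<longleftrightarrow> ideal I R \<and> (\<forall>d\<in>\<Delta>. d ` I \<subseteq> I)"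

definition delta_prime :: "('b, 'm) ring_scheme \<Rightarrow> ('b \<Rightarrow> 'b) set \<Rightarrow> 'b set \<Rightarrow> bool" where
  "delta_prime R \<Delta> P \<longleftrightarrow> delta_ideal R \<Delta> P \<and> P \<noteq> carrier R \<and>
     (\<forall>I J. delta_ideal R \<Delta> I \<longrightarrow> delta_ideal R \<Delta> J \<longrightarrow>
        ideal_prod R I J \<subseteq> P \<longrightarrow> I \<subseteq> P \<or> J \<subseteq> P)"

definition delta_core :: "('b, 'm) ring_scheme \<Rightarrow> ('b \<Rightarrow> 'b) set \<Rightarrow> 'b set \<Rightarrow> 'b set" where
  "delta_core R \<Delta> J = (GREATEST I. delta_ideal R \<Delta> I \<and> I \<subseteq> J)"

definition delta_primitive :: "('b, 'm) ring_scheme \<Rightarrow> ('b \<Rightarrow> 'b) set \<Rightarrow> 'b set \<Rightarrow> bool" where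
  "delta_primitive R \<Delta> P \<longleftrightarrow> (\<exists>M. maximalideal M R \<and> P = delta_core R \<Delta> M)"


section \<open>Fraction fields and rationality\<close>

definition fraction_rel :: "('a, 'm) ring_scheme \<Rightarrow> (('a \<times> 'a) \<times> ('a \<times> 'a)) set" where
  "fraction_rel D = {((a, b), (c, e)).
     a \<in> carrier D \<and> b \<in> carrier D - {\<zero>\<^bsub>D\<^esub>} \<and> c \<in> carrier D \<and> e \<in> carrier D - {\<zero>\<^bsub>D\<^esub>} \<and>
     a \<otimes>\<^bsub>D\<^esub> e = c \<otimes>\<^bsub>D\<^esub> b}"

definition fraction :: "('a, 'm) ring_scheme \<Rightarrow> 'a \<Rightarrow> 'a \<Rightarrow> ('a \<times> 'a) set" where
  "fraction D a b = fraction_rel D `` {(a, b)}"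

text \<open>Operations on equivalence classes are written as unions over all representatives; on a domain
  every representative yields the same class, so the union is that class.\<close>

definition Frac :: "('a, 'm) ring_scheme \<Rightarrow> ('a \<times> 'a) set ring" where
  "Frac D = \<lparr>
     carrier = (carrier D \<times> (carrier D - {\<zero>\<^bsub>D\<^esub>})) // fraction_rel D,
     monoid.mult = (\<lambda>x y. \<Union>(a, b)\<in>x. \<Union>(c, e)\<in>y. fraction D (a \<otimes>\<^bsub>D\<^esub> c) (b \<otimes>\<^bsub>D\<^esub> e)),
     monoid.one = fraction D \<one>\<^bsub>D\<^esub> \<one>\<^bsub>D\<^esub>,
     ring.zero = fraction D \<zero>\<^bsub>D\<^esub> \<one>\<^bsub>D\<^esub>,
     ring.add = (\<lambda>x y. \<Union>(a, b)\<in>x. \<Union>(c, e)\<in>y.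
              fraction D ((a \<otimes>\<^bsub>D\<^esub> e) \<oplus>\<^bsub>D\<^esub> (c \<otimes>\<^bsub>D\<^esub> b)) (b \<otimes>\<^bsub>D\<^esub> e))\<rparr>"

text \<open>The derivation \<open>a + P \<mapsto> d a + P\<close> of \<open>R/P\<close>, for a derivation \<open>d\<close> preserving \<open>P\<close>.\<close>

definition quotient_derivation ::
    "('b, 'm) ring_scheme \<Rightarrow> 'b set \<Rightarrow> ('b \<Rightarrow> 'b) \<Rightarrow> 'b set \<Rightarrow> 'b set" where
  "quotient_derivation R P d C = (\<Union>a\<in>C. P +>\<^bsub>R\<^esub> d a)"

text \<open>The unique extension of a derivation of \<open>D\<close> to \<open>Frac D\<close> is given by the quotient rule.\<close>

definition fraction_derivation ::
    "('a, 'm) ring_scheme \<Rightarrow> ('a \<Rightarrow> 'a) \<Rightarrow> ('a \<times> 'a) set \<Rightarrow> ('a \<times> 'a) set" where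
  "fraction_derivation D d x =
     (\<Union>(a, b)\<in>x. fraction D ((d a \<otimes>\<^bsub>D\<^esub> b) \<ominus>\<^bsub>D\<^esub> (a \<otimes>\<^bsub>D\<^esub> d b)) (b \<otimes>\<^bsub>D\<^esub> b))"

definition Frac_constants ::
    "('b, 'm) ring_scheme \<Rightarrow> ('b \<Rightarrow> 'b) set \<Rightarrow> 'b set \<Rightarrow> ('b set \<times> 'b set) set set" where
  "Frac_constants R \<Delta> P = {x \<in> carrier (Frac (R Quot P)).
     \<forall>d\<in>\<Delta>. fraction_derivation (R Quot P) (quotient_derivation R P d) x = \<zero>\<^bsub>Frac (R Quot P)\<^esub>}"

definition scalar_in_Frac ::
    "('b, 'a, 'd) module_scheme \<Rightarrow> 'a set \<Rightarrow> 'b \<Rightarrow> ('a set \<times> 'a set) set"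
  where "scalar_in_Frac R P c =
     fraction (R Quot P) (P +>\<^bsub>R\<^esub> (c \<odot>\<^bsub>R\<^esub> \<one>\<^bsub>R\<^esub>)) \<one>\<^bsub>R Quot P\<^esub>"

definition delta_rational ::
    "('a, 'c) ring_scheme \<Rightarrow> ('a, 'b, 'd) module_scheme \<Rightarrow> ('b \<Rightarrow> 'b) set \<Rightarrow> 'b set \<Rightarrow> bool" where
  "delta_rational K R \<Delta> P \<longleftrightarrow>
     (\<forall>x \<in> Frac_constants R \<Delta> P.
        (ring.algebraic (Frac (R Quot P)) over (scalar_in_Frac R P ` carrier K)) x)"


section \<open>The differential spectrum and separable points\<close>

definition zariski :: "('b, 'm) ring_scheme \<Rightarrow> 'b set topology" where
  "zariski R = topology (\<lambda>U. \<exists>A\<subseteq>carrier R. U = {Q. primeideal Q R \<and> \<not> A \<subseteq> Q})"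

lemma (in primeideal) mult_set_subset_iff:
  assumes "A \<subseteq> carrier R" "B \<subseteq> carrier R"
  shows "{a \<otimes> b | a b. a \<in> A \<and> b \<in> B} \<subseteq> I \<longleftrightarrow> A \<subseteq> I \<or> B \<subseteq> I"
proof
  assume *: "{a \<otimes> b | a b. a \<in> A \<and> b \<in> B} \<subseteq> I"
  show "A \<subseteq> I \<or> B \<subseteq> I"
  proof (rule ccontr)
    assume "\<not> (A \<subseteq> I \<or> B \<subseteq> I)"
    then obtain a b where ab: "a \<in> A" "a \<notin> I" "b \<in> B" "b \<notin> I" by blast
    then have "a \<otimes> b \<in> I" using * by blast
    then show False using I_prime[of a b] ab assms by blast
  qed
next
  assume "A \<subseteq> I \<or> B \<subseteq> I"
  then show "{a \<otimes> b | a b. a \<in> A \<and> b \<in> B} \<subseteq> I"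
    using I_l_closed I_r_closed assms by blast
qed

lemma istopology_zariski:
  "istopology (\<lambda>U. \<exists>A\<subseteq>carrier R. U = {Q. primeideal Q R \<and> \<not> A \<subseteq> Q})"
  unfolding istopology_def
proof (intro conjI allI impI)
  fix S T
  assume "\<exists>A\<subseteq>carrier R. S = {Q. primeideal Q R \<and> \<not> A \<subseteq> Q}"
    and "\<exists>A\<subseteq>carrier R. T = {Q. primeideal Q R \<and> \<not> A \<subseteq> Q}"
  then obtain A B where A: "A \<subseteq> carrier R" "S = {Q. primeideal Q R \<and> \<not> A \<subseteq> Q}"
    and B: "B \<subseteq> carrier R" "T = {Q. primeideal Q R \<and> \<not> B \<subseteq> Q}" by blast
  let ?AB = "{a \<otimes>\<^bsub>R\<^esub> b | a b. a \<in> A \<and> b \<in> B}"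
  show "\<exists>A\<subseteq>carrier R. S \<inter> T = {Q. primeideal Q R \<and> \<not> A \<subseteq> Q}"
  proof (cases "\<exists>Q. primeideal Q R")
    case False
    then show ?thesis using A by auto
  next
    case True
    then obtain Q where "primeideal Q R" ..
    then interpret primeideal Q R .
    have "?AB \<subseteq> carrier R" using A(1) B(1) by blast
    moreover have "S \<inter> T = {Q. primeideal Q R \<and> \<not> ?AB \<subseteq> Q}"
      unfolding A(2) B(2) using primeideal.mult_set_subset_iff[OF _ A(1) B(1)] by blast
    ultimately show ?thesis by blast
  qed
next
  fix \<U>
  assume "\<forall>U\<in>\<U>. \<exists>A\<subseteq>carrier R. U = {Q. primeideal Q R \<and> \<not> A \<subseteq> Q}"
  then obtain f where f: "\<And>U. U \<in> \<U> \<Longrightarrow> f U \<subseteq> carrier R"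
    "\<And>U. U \<in> \<U> \<Longrightarrow> U = {Q. primeideal Q R \<and> \<not> f U \<subseteq> Q}" by metis
  have "\<Union>\<U> = (\<Union>U\<in>\<U>. {Q. primeideal Q R \<and> \<not> f U \<subseteq> Q})"
    using f(2) by auto
  also have "\<dots> = {Q. primeideal Q R \<and> \<not> (\<Union>U\<in>\<U>. f U) \<subseteq> Q}"
    by blast
  finally show "\<exists>A\<subseteq>carrier R. \<Union>\<U> = {Q. primeideal Q R \<and> \<not> A \<subseteq> Q}"
    using f(1) by (intro exI[of _ "\<Union>U\<in>\<U>. f U"]) auto
qed

definition delta_spec :: "('b, 'm) ring_scheme \<Rightarrow> ('b \<Rightarrow> 'b) set \<Rightarrow> 'b set topology" where
  "delta_spec R \<Delta> = subtopology (zariski R) {P. delta_prime R \<Delta> P}"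

definition separable_point :: "'c rel \<Rightarrow> 'x topology \<Rightarrow> 'x \<Rightarrow> bool" where
  "separable_point \<kappa> T p \<longleftrightarrow> p \<in> topspace T \<and>
     (\<exists>\<Lambda> \<subseteq> (T closure_of {p}) - {p}. |\<Lambda>| <o \<kappa> \<and>
        (T closure_of {p}) - {p} = (\<Union>q\<in>\<Lambda>. T closure_of {q}))"

end

theory Submission
  imports Defs
begin

text \<open>Primitive implies rational: if \<open>P\<close> is the core of a maximal ideal \<open>M\<close>, the denominators of a
  constant of \<open>Frac (R/P)\<close> form a differential ideal not contained in \<open>M\<close>, so the constants embed into
  \<open>R/M\<close>, which is algebraic over \<open>K\<close> because the elements \<open>1/(e - c)\<close>, \<open>c \<in> K\<close>, would otherwise be more than
  \<open>dim R\<close> independent elements.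

  Rational implies separable: let \<open>f = \<Sum> c\<^sub>i v\<^sub>i\<close> lie in a larger \<open>\<Delta>\<close>-prime ideal \<open>Q\<close> but not in \<open>P\<close>, with basis
  elements \<open>v\<^sub>i\<close>. If all Wronskians \<open>v\<^sub>1 d f - d v\<^sub>1 f\<close> lie in \<open>P\<close>, then \<open>f/v\<^sub>1\<close> is a constant, hence algebraic,
  and \<open>v\<^sub>1 \<in> Q\<close>. Otherwise such a Wronskian is a shorter combination. Thus every such \<open>Q\<close> contains one of
  fewer than \<open>|K|\<close> elements outside \<open>P\<close>, and there are finitely many minimal \<open>\<Delta>\<close>-primes over each of them.

  Separable implies primitive: choose an element of each \<open>q \<in> \<Lambda>\<close> outside \<open>P\<close>, and an ideal maximal among
  those containing \<open>P\<close> and avoiding all products of these elements. By the same counting argument it is a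
  maximal ideal of \<open>R\<close>, and its core is \<open>P\<close>.

  If \<open>R\<close> has finite dimension, which includes the case of countable \<open>K\<close>, then \<open>P\<close> is itself maximal.\<close>

section \<open>Cardinality\<close>

text \<open>The elimination has to keep scalars out of its result. For fixed v and d the Wronskian u
  |-> v d u - d v u is K-linear and kills v, so applied to f it gives a combination of the
  Wronskians of the other vectors with the same coefficients. The element finally found depends only
  on a word of derivations and a list of basis vectors, of which there are fewer than |K|; the
  coefficients, ranging over all of K, do not enter.

  Finite dimension is treated apart because lists over a finite set can be countably many, which is
  not fewer than |K| when K is countable. An infinite basis smaller than K forces K to be
  uncountable.

  Fractions are handled through representatives. An equation in the fraction field of R/P, or in a
  localisation of R/M, is a congruence in R modulo P or M with explicit numerators and denominators;
  a typical step is a polynomial identity followed by a cancellation modulo a prime ideal.\<close>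

lemma lists_ordLess:
  assumes "infinite B" "|B| <o |C|" "|A| <o |C|"
  shows "|lists A| <o |C|"
proof (cases "finite A")
  case True
  then have "countable (lists A)" by (intro countable_lists countable_finite)
  then obtain f :: "_ \<Rightarrow> nat" where "inj_on f (lists A)" by (rule countableE)
  then have "|lists A| \<le>o |UNIV :: nat set|" by (rule card_of_ordLeqI) simp
  \<comment> \<open>Here \<open>B\<close> serves as an uncountability certificate: an infinite set
    smaller than \<open>C\<close> puts the countably many lists over a finite alphabet strictly
    below |C|.\<close>
  also have "|UNIV :: nat set| \<le>o |B|" using assms(1) infinite_iff_card_of_nat by blast
  also have "|B| <o |C|" by fact
  finally show ?thesis .
next
  case False
  then have "|lists A| =o |A|" by (rule card_of_lists_infinite)
  then show ?thesis using assms(3) by (rule ordIso_ordLess_trans)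
qed

lemma Fpow_ordLess:
  assumes "infinite C" "|A| <o |C|"
  shows "|Fpow A| <o |C|"
proof (cases "finite A")
  case True
  then have "finite (Fpow A)" using finite_subset[OF Fpow_subset_Pow] by simp
  then show ?thesis using assms(1) by (rule finite_ordLess_infinite2)
next
  case False
  then have "|Fpow A| =o |A|" by (rule card_of_Fpow_infinite)
  then show ?thesis using assms(2) by (rule ordIso_ordLess_trans)
qed

lemma UNION_finite_ordLess:
  assumes "infinite C" "|I| <o |C|" "\<And>i. i \<in> I \<Longrightarrow> finite (F i)"
  shows "|\<Union>i\<in>I. F i| <o |C|"
proof (cases "finite I")
  case True
  then show ?thesis using assms by (intro finite_ordLess_infinite2) auto
next
  case False
  have "|\<Union>i\<in>I. F i| \<le>o |I|"
    using False assms(3)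
    by (intro card_of_UNION_ordLeq_infinite) (auto intro!: ordLess_imp_ordLeq)
  then show ?thesis using assms(2) by (rule ordLeq_ordLess_trans)
qed

text \<open>Were all fibres finite, \<open>C\<close> would be a union of fewer than |C| finite sets.
  Asking for an infinite fibre rather than one of size |C| keeps the pigeonhole valid for singular
  |C|.\<close>

lemma infinite_fibre:
  assumes "infinite C" "|Y| <o |C|" "f ` C \<subseteq> Y"
  shows "\<exists>y\<in>Y. infinite {c \<in> C. f c = y}"
proof (rule ccontr)
  assume "\<not> ?thesis"
  then have "|\<Union>y\<in>Y. {c \<in> C. f c = y}| <o |C|"
    using assms by (intro UNION_finite_ordLess) auto
  moreover have "(\<Union>y\<in>Y. {c \<in> C. f c = y}) = C" using assms(3) by auto
  ultimately show False using ordLess_irreflexive by metis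
qed


section \<open>Ideals\<close>

context cring
begin

lemma set_add_memI: "\<lbrakk>x \<in> A; y \<in> B\<rbrakk> \<Longrightarrow> x \<oplus> y \<in> A <+> B"
  unfolding set_add_defs by (auto simp: set_mult_def)

lemma subset_set_add:
  assumes "ideal I R" "ideal J R"
  shows "I \<subseteq> I <+> J" "J \<subseteq> I <+> J"
proof -
  have c: "I \<subseteq> carrier R" "J \<subseteq> carrier R" using ideal.Icarr[OF assms(1)] ideal.Icarr[OF assms(2)] by auto
  have z: "\<zero> \<in> I" "\<zero> \<in> J"
    using assms by (simp_all add: additive_subgroup.zero_closed ideal.axioms)
  show "I \<subseteq> I <+> J"
  proof
    fix x assume "x \<in> I"
    moreover from this have "x = x \<oplus> \<zero>" using c by auto
    ultimately show "x \<in> I <+> J" using z set_add_memI by metis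
  qed
  show "J \<subseteq> I <+> J"
  proof
    fix x assume "x \<in> J"
    moreover from this have "x = \<zero> \<oplus> x" using c by auto
    ultimately show "x \<in> I <+> J" using z set_add_memI by metis
  qed
qed

lemma set_add_least:
  fixes I J L :: "'a set"
  assumes "ideal L R" "I \<subseteq> L" "J \<subseteq> L"
  shows "I <+> J \<subseteq> L"
  unfolding set_add_defs
proof (auto simp: set_mult_def)
  interpret L: ideal L R by fact
  show "x \<oplus> y \<in> L" if "x \<in> I" "y \<in> J" for x y
    using that assms by blast
qed

lemma ideal_colon:
  assumes "ideal I R" "A \<subseteq> carrier R"
  shows "ideal {r \<in> carrier R. \<forall>a\<in>A. r \<otimes> a \<in> I} R"
proof -
  interpret I: ideal I R by fact
  show ?thesis
  proof (rule idealI[OF ring_axioms])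
    show "subgroup {r \<in> carrier R. \<forall>a\<in>A. r \<otimes> a \<in> I} (add_monoid R)"
    proof (rule add.subgroupI)
      show "{r \<in> carrier R. \<forall>a\<in>A. r \<otimes> a \<in> I} \<noteq> {}"
        using assms(2) I.zero_closed by (auto intro!: exI[of _ \<zero>] simp: subset_iff)
    qed (use assms(2) in \<open>auto simp: l_minus l_distr subset_iff simp flip: a_inv_def\<close>)
  next
    fix r x assume r: "r \<in> {r \<in> carrier R. \<forall>a\<in>A. r \<otimes> a \<in> I}" and x: "x \<in> carrier R"
    have "x \<otimes> r \<otimes> a \<in> I" if "a \<in> A" for a
    proof -
      have "a \<in> carrier R" "r \<in> carrier R" using that r assms(2) by auto
      then have "x \<otimes> r \<otimes> a = x \<otimes> (r \<otimes> a)" using x by (simp add: m_assoc)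
      also have "\<dots> \<in> I" using r that by (intro I.I_l_closed[OF _ x]) simp
      finally show ?thesis .
    qed
    then show "x \<otimes> r \<in> {r \<in> carrier R. \<forall>a\<in>A. r \<otimes> a \<in> I}" using r x by auto
    then show "r \<otimes> x \<in> {r \<in> carrier R. \<forall>a\<in>A. r \<otimes> a \<in> I}" using r x by (simp add: m_comm)
  qed
qed

lemma prime_pow_mem:
  assumes "primeideal P R" "b \<in> carrier R" "b [^] (n::nat) \<in> P"
  shows "b \<in> P"
  using assms(3)
proof (induction n)
  case 0
  then show ?case using primeideal.I_notcarr[OF assms(1)] ideal.one_imp_carrier[of P R] assms(1)
    by (simp add: primeideal_def)
next
  case (Suc n)
  then show ?case using primeideal.I_prime[OF assms(1), of "b [^] n" b] assms(2) by auto
qed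

lemma maximalideal_if_inverses:
  assumes P: "primeideal P R"
    and inv: "\<And>e. \<lbrakk>e \<in> carrier R; e \<notin> P\<rbrakk> \<Longrightarrow> \<exists>t\<in>carrier R. \<one> \<ominus> e \<otimes> t \<in> P"
  shows "maximalideal P R"
proof -
  interpret P: primeideal P R by fact
  show ?thesis
  proof (rule maximalidealI[OF P.is_ideal P.I_notcarr])
    fix J assume J: "ideal J R" "P \<subseteq> J" "J \<subseteq> carrier R"
    interpret J: ideal J R by fact
    show "J = P \<or> J = carrier R"
    proof (cases "J = P")
      case False
      then obtain e where e: "e \<in> J" "e \<notin> P" using J by blast
      then have eR: "e \<in> carrier R" using J by blast
      then obtain t where t: "t \<in> carrier R" "\<one> \<ominus> e \<otimes> t \<in> P" using inv e by blast
      then have "(\<one> \<ominus> e \<otimes> t) \<oplus> e \<otimes> t \<in> J" using J(2) e J.I_r_closed[OF e(1) t(1)] by auto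
      also have "(\<one> \<ominus> e \<otimes> t) \<oplus> e \<otimes> t = \<one>" using eR t(1) by (simp add: minus_eq a_assoc l_neg)
      finally show ?thesis using J.one_imp_carrier by blast
    qed simp
  qed
qed

text \<open>The additional factor \<open>x\<close> replaces the binomial theorem: one factor a + b
  is split off and absorbed as a x or b x, which lowers n or m by one.\<close>

lemma pow_add_mem_ideal:
  fixes n m :: nat
  assumes "ideal I R" "a \<in> carrier R" "b \<in> carrier R"
  shows "\<lbrakk>x \<in> carrier R; a [^] n \<otimes> x \<in> I; b [^] m \<otimes> x \<in> I\<rbrakk> \<Longrightarrow> (a \<oplus> b) [^] (n + m) \<otimes> x \<in> I"
proof (induction "n + m" arbitrary: n m x)
  case 0
  then show ?case by simp
next
  case (Suc k)
  interpret I: ideal I R by fact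
  show ?case
  proof (cases "n = 0 \<or> m = 0")
    case True
    then have "x \<in> I" using Suc.prems by auto
    then show ?thesis using assms by (simp add: I.I_l_closed)
  next
    case False
    then obtain n' m' where nm: "n = Suc n'" "m = Suc m'" by (metis not0_implies_Suc)
    have "(a \<oplus> b) [^] (n' + m) \<otimes> (a \<otimes> x) \<in> I"
    proof (rule Suc.hyps(1))
      show "a [^] n' \<otimes> (a \<otimes> x) \<in> I" using Suc.prems assms nm by (simp add: m_assoc)
      have "a \<otimes> (b [^] m \<otimes> x) \<in> I" using Suc.prems assms by (simp only: I.I_l_closed)
      then show "b [^] m \<otimes> (a \<otimes> x) \<in> I" using Suc.prems assms by (simp add: m_lcomm)
    qed (use Suc nm assms in auto)
    moreover have "(a \<oplus> b) [^] (n + m') \<otimes> (b \<otimes> x) \<in> I"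
    proof (rule Suc.hyps(1))
      show "b [^] m' \<otimes> (b \<otimes> x) \<in> I" using Suc.prems assms nm by (simp add: m_assoc)
      have "b \<otimes> (a [^] n \<otimes> x) \<in> I" using Suc.prems assms by (simp only: I.I_l_closed)
      then show "a [^] n \<otimes> (b \<otimes> x) \<in> I" using Suc.prems assms by (simp add: m_lcomm)
    qed (use Suc nm assms in auto)
    ultimately have "(a \<oplus> b) [^] (n' + m) \<otimes> (a \<otimes> x) \<oplus> (a \<oplus> b) [^] (n + m') \<otimes> (b \<otimes> x) \<in> I"
      by simp
    also have "n + m' = n' + m" using nm by simp
    also have "(a \<oplus> b) [^] (n' + m) \<otimes> (a \<otimes> x) \<oplus> (a \<oplus> b) [^] (n' + m) \<otimes> (b \<otimes> x) =
        (a \<oplus> b) [^] (n' + m) \<otimes> ((a \<oplus> b) \<otimes> x)"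
      using Suc.prems(1) assms by (simp add: l_distr r_distr)
    also have "\<dots> = (a \<oplus> b) [^] (n + m) \<otimes> x"
      using Suc.prems(1) assms nm by (simp add: m_assoc)
    finally show ?thesis .
  qed
qed

lemma ideal_radical:
  assumes "ideal I R"
  shows "ideal {a \<in> carrier R. \<exists>n::nat. a [^] n \<in> I} R" (is "ideal ?N R")
proof (rule idealI[OF ring_axioms])
  interpret I: ideal I R by fact
  have mult: "a \<otimes> x \<in> ?N" if ax: "a \<in> ?N" "x \<in> carrier R" for a x
  proof -
    obtain n :: nat where n: "a \<in> carrier R" "a [^] n \<in> I" using ax by auto
    then have "(a \<otimes> x) [^] n \<in> I" using ax by (simp add: nat_pow_distrib I.I_r_closed)
    then show ?thesis using n ax by auto
  qed
  then show "a \<otimes> x \<in> ?N" "x \<otimes> a \<in> ?N" if "a \<in> ?N" "x \<in> carrier R" for a x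
    using that by (auto simp: m_comm[of x a])
  show "subgroup ?N (add_monoid R)"
  proof (rule add.subgroupI)
    show "?N \<subseteq> carrier R" by blast
    have "\<zero> [^] (1::nat) \<in> I" by simp
    then show "?N \<noteq> {}" by blast
    show "\<ominus> a \<in> ?N" if "a \<in> ?N" for a
    proof -
      have "a \<otimes> (\<ominus> \<one>) \<in> ?N" using that mult by blast
      moreover have "a \<otimes> (\<ominus> \<one>) = \<ominus> a" using that by (simp add: r_minus)
      ultimately show ?thesis by simp
    qed
    fix a b assume ab: "a \<in> ?N" "b \<in> ?N"
    then obtain n m :: nat where "a [^] n \<in> I" "b [^] m \<in> I" by auto
    then have "(a \<oplus> b) [^] (n + m) \<otimes> \<one> \<in> I"
      using ab assms by (intro pow_add_mem_ideal) auto
    then show "a \<oplus> b \<in> ?N" using ab by auto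
  qed
qed

end

section \<open>Differential ideals\<close>

locale differential_ring = cring R for R (structure) +
  fixes \<Delta> :: "('a \<Rightarrow> 'a) set"
  assumes d_closed [simp]: "\<lbrakk>d \<in> \<Delta>; x \<in> carrier R\<rbrakk> \<Longrightarrow> d x \<in> carrier R"
    and d_add: "\<lbrakk>d \<in> \<Delta>; x \<in> carrier R; y \<in> carrier R\<rbrakk> \<Longrightarrow> d (x \<oplus> y) = d x \<oplus> d y"
    and d_mult: "\<lbrakk>d \<in> \<Delta>; x \<in> carrier R; y \<in> carrier R\<rbrakk> \<Longrightarrow>
      d (x \<otimes> y) = d x \<otimes> y \<oplus> x \<otimes> d y"
begin

lemma d_zero: "d \<in> \<Delta> \<Longrightarrow> d \<zero> = \<zero>"
  using d_add[of d \<zero> \<zero>] by simp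

lemma d_minus: "\<lbrakk>d \<in> \<Delta>; x \<in> carrier R\<rbrakk> \<Longrightarrow> d (\<ominus> x) = \<ominus> d x"
  using d_add[of d "\<ominus> x" x] d_zero[of d]
  by (intro minus_equality[symmetric]) (simp_all add: l_neg)

lemma d_diff: "\<lbrakk>d \<in> \<Delta>; x \<in> carrier R; y \<in> carrier R\<rbrakk> \<Longrightarrow> d (x \<ominus> y) = d x \<ominus> d y"
  by (simp add: minus_eq d_add d_minus)

lemma d_one: "d \<in> \<Delta> \<Longrightarrow> d \<one> = \<zero>"
  using d_mult[of d \<one> \<one>] by simp

text \<open>Multiplying by \<open>x\<close> avoids the exponent n - 1, so n = 0 is covered. This
  case occurs in \<open>delta_ideal_nilpotent_d\<close>, where the exponent is 2 k with k starting
  at 0.\<close>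

lemma d_pow:
  assumes "d \<in> \<Delta>" "x \<in> carrier R"
  shows "d (x [^] (n::nat)) \<otimes> x = add_pow R n \<one> \<otimes> (x [^] n \<otimes> d x)"
proof (induction n)
  case 0
  show ?case using assms by (simp add: d_one)
next
  case (Suc n)
  have "d (x [^] Suc n) \<otimes> x = (d (x [^] n) \<otimes> x) \<otimes> x \<oplus> x [^] n \<otimes> d x \<otimes> x"
    using assms by (simp add: d_mult l_distr)
  also have "\<dots> = (add_pow R n \<one> \<otimes> (x [^] n \<otimes> d x)) \<otimes> x \<oplus> x [^] n \<otimes> d x \<otimes> x"
    by (simp only: Suc)
  also have "\<dots> = (add_pow R n \<one> \<oplus> \<one>) \<otimes> (x [^] n \<otimes> x \<otimes> d x)"
    using assms by (simp add: l_distr r_distr m_ac)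
  finally show ?case by simp
qed

lemma d_pow_Suc:
  assumes "d \<in> \<Delta>" "x \<in> carrier R"
  shows "d (x [^] Suc n) = add_pow R (Suc n) \<one> \<otimes> (x [^] n \<otimes> d x)"
proof -
  have "d (x [^] Suc n) = d (x [^] n) \<otimes> x \<oplus> x [^] n \<otimes> d x"
    using assms by (simp add: d_mult)
  also have "\<dots> = add_pow R (Suc n) \<one> \<otimes> (x [^] n \<otimes> d x)"
    using assms by (simp add: d_pow l_distr)
  finally show ?thesis .
qed

lemma delta_ideal_ideal: "delta_ideal R \<Delta> I \<Longrightarrow> ideal I R"
  by (simp add: delta_ideal_def)

lemma delta_ideal_d: "\<lbrakk>delta_ideal R \<Delta> I; d \<in> \<Delta>; x \<in> I\<rbrakk> \<Longrightarrow> d x \<in> I"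
  by (auto simp: delta_ideal_def)

lemma delta_ideal_add:
  assumes "delta_ideal R \<Delta> I" "delta_ideal R \<Delta> J"
  shows "delta_ideal R \<Delta> (I <+> J)"
  unfolding delta_ideal_def
proof (intro conjI ballI image_subsetI)
  have IJ: "ideal I R" "ideal J R" using assms by (auto simp: delta_ideal_def)
  show "ideal (I <+> J) R" using IJ by (rule add_ideals)
  fix d and x :: 'a assume d: "d \<in> \<Delta>" and "x \<in> I <+> J"
  then obtain i j where ij: "i \<in> I" "j \<in> J" "x = i \<oplus> j"
    by (auto simp: set_add_defs)
  moreover have "i \<in> carrier R" "j \<in> carrier R"
    using ideal.Icarr[OF IJ(1)] ideal.Icarr[OF IJ(2)] ij by auto
  ultimately have "d x = d i \<oplus> d j" using d by (simp add: d_add)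
  also have "d i \<oplus> d j \<in> I <+> J"
    using delta_ideal_d[OF assms(1) d ij(1)] delta_ideal_d[OF assms(2) d ij(2)] by (rule set_add_memI)
  finally show "d x \<in> I <+> J" .
qed

text \<open>Since d r a = d (r a) - r d a, everything depends on r d a. The last hypothesis isolates
  this, because it is met in two different ways: \<open>A\<close> is stable under the derivations,
  or \<open>I\<close> is radical.\<close>

lemma delta_ideal_colon:
  assumes "delta_ideal R \<Delta> I" "A \<subseteq> carrier R"
    and "\<And>d r a. \<lbrakk>d \<in> \<Delta>; r \<in> carrier R; a \<in> A; \<forall>a\<in>A. r \<otimes> a \<in> I\<rbrakk> \<Longrightarrow> r \<otimes> d a \<in> I"
  shows "delta_ideal R \<Delta> {r \<in> carrier R. \<forall>a\<in>A. r \<otimes> a \<in> I}"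
  unfolding delta_ideal_def
proof (intro conjI ballI image_subsetI)
  have I: "ideal I R" using assms by (auto simp: delta_ideal_def)
  then show "ideal {r \<in> carrier R. \<forall>a\<in>A. r \<otimes> a \<in> I} R" using assms(2) by (rule ideal_colon)
  interpret I: ideal I R by fact
  fix d r assume d: "d \<in> \<Delta>" and r: "r \<in> {r \<in> carrier R. \<forall>a\<in>A. r \<otimes> a \<in> I}"
  have "d r \<otimes> a \<in> I" if a: "a \<in> A" for a
  proof -
    have c: "r \<in> carrier R" "a \<in> carrier R" using r a assms(2) by auto
    have "d (r \<otimes> a) \<in> I" using r a delta_ideal_d[OF assms(1) d] by auto
    moreover have "r \<otimes> d a \<in> I" using assms(3) d r a by blast
    ultimately have "d (r \<otimes> a) \<ominus> r \<otimes> d a \<in> I"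
      by (simp add: minus_eq)
    also have "d (r \<otimes> a) \<ominus> r \<otimes> d a = d r \<otimes> a"
      using c d by (simp add: d_mult minus_eq a_assoc r_neg)
    finally show ?thesis .
  qed
  then show "d r \<in> {r \<in> carrier R. \<forall>a\<in>A. r \<otimes> a \<in> I}" using r d by auto
qed

text \<open>The sum of two differential ideals inside \<open>J\<close> is again one, so the family
  of all of them is directed and its union is its largest member. Thus the \<open>GREATEST\<close>
  in \<open>delta_core\<close> is attained.\<close>

lemma delta_core_greatest:
  assumes "ideal J R"
  shows "delta_ideal R \<Delta> (delta_core R \<Delta> J)" "delta_core R \<Delta> J \<subseteq> J"
    and "\<lbrakk>delta_ideal R \<Delta> I; I \<subseteq> J\<rbrakk> \<Longrightarrow> I \<subseteq> delta_core R \<Delta> J"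
proof -
  interpret J: ideal J R by fact
  define \<F> where "\<F> = {I. delta_ideal R \<Delta> I \<and> I \<subseteq> J}"
  have zero: "delta_ideal R \<Delta> {\<zero>}"
    by (simp add: delta_ideal_def zeroideal d_zero)
  then have F0: "{\<zero>} \<in> \<F>" by (simp add: \<F>_def)
  have F_ideal: "ideal I R" if "I \<in> \<F>" for I
    using that by (simp add: \<F>_def delta_ideal_def)
  have sum: "I <+> L \<in> \<F>" if "I \<in> \<F>" "L \<in> \<F>" for I L
    using that set_add_least[OF assms, of I L] by (simp add: \<F>_def delta_ideal_add)
  have carr: "x \<in> carrier R" if "x \<in> \<Union>\<F>" for x
  proof -
    from that obtain I where "I \<in> \<F>" "x \<in> I" by blast
    then show ?thesis using ideal.Icarr[OF F_ideal] by blast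
  qed
  have "delta_ideal R \<Delta> (\<Union>\<F>)"
    unfolding delta_ideal_def
  proof (intro conjI ballI image_subsetI)
    show "ideal (\<Union>\<F>) R"
    proof (rule idealI[OF ring_axioms])
      show "subgroup (\<Union>\<F>) (add_monoid R)"
      proof (rule add.subgroupI)
        show "\<Union>\<F> \<subseteq> carrier R" using carr by blast
        show "\<Union>\<F> \<noteq> {}" using F0 by blast
        show "\<ominus> x \<in> \<Union>\<F>" if "x \<in> \<Union>\<F>" for x
          using that additive_subgroup.a_inv_closed[OF ideal.axioms(1)[OF F_ideal]] by blast
        fix x y assume "x \<in> \<Union>\<F>" "y \<in> \<Union>\<F>"
        then obtain I L where IL: "I \<in> \<F>" "L \<in> \<F>" "x \<in> I" "y \<in> L" by blast
        then have "x \<oplus> y \<in> I <+> L" by (intro set_add_memI)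
        then show "x \<oplus> y \<in> \<Union>\<F>" using sum IL by blast
      qed
    next
      fix a x assume "a \<in> \<Union>\<F>" "x \<in> carrier R"
      then show "x \<otimes> a \<in> \<Union>\<F>" "a \<otimes> x \<in> \<Union>\<F>"
        using ideal.I_l_closed[OF F_ideal] ideal.I_r_closed[OF F_ideal] by blast+
    qed
  next
    fix d x assume "d \<in> \<Delta>" "x \<in> \<Union>\<F>"
    then obtain I where "I \<in> \<F>" "x \<in> I" by blast
    then have "d x \<in> I"
      using delta_ideal_d[of I d x] \<open>d \<in> \<Delta>\<close> by (simp add: \<F>_def)
    then show "d x \<in> \<Union>\<F>" using \<open>I \<in> \<F>\<close> by blast
  qed
  moreover have "\<Union>\<F> \<subseteq> J" by (auto simp: \<F>_def)
  moreover have "delta_core R \<Delta> J = \<Union>\<F>"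
    unfolding delta_core_def
  proof (rule Greatest_equality)
    show "delta_ideal R \<Delta> (\<Union>\<F>) \<and> \<Union>\<F> \<subseteq> J" using calculation by simp
  qed (auto simp: \<F>_def)
  ultimately show "delta_ideal R \<Delta> (delta_core R \<Delta> J)" "delta_core R \<Delta> J \<subseteq> J"
    "\<lbrakk>delta_ideal R \<Delta> I; I \<subseteq> J\<rbrakk> \<Longrightarrow> I \<subseteq> delta_core R \<Delta> J"
    by (auto simp: \<F>_def)
qed

lemma delta_prime_core:
  assumes "primeideal M R"
  shows "delta_prime R \<Delta> (delta_core R \<Delta> M)"
proof -
  interpret M: primeideal M R by fact
  note core = delta_core_greatest[OF M.is_ideal]
  show ?thesis
    unfolding delta_prime_def
  proof (intro conjI allI impI)
    show "delta_core R \<Delta> M \<noteq> carrier R"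
      using core(2) M.I_notcarr M.a_subset by auto
    fix I J
    assume I: "delta_ideal R \<Delta> I" and J: "delta_ideal R \<Delta> J"
      and IJ: "ideal_prod R I J \<subseteq> delta_core R \<Delta> M"
    have "I \<subseteq> M \<or> J \<subseteq> M"
    proof (rule ccontr)
      assume "\<not> (I \<subseteq> M \<or> J \<subseteq> M)"
      then obtain i j where ij: "i \<in> I" "i \<notin> M" "j \<in> J" "j \<notin> M" by (auto simp: subset_iff)
      moreover from this have "i \<otimes> j \<in> M"
        using IJ core(2) ideal_prod.prod[of i I j J R] by auto
      moreover have "i \<in> carrier R" "j \<in> carrier R"
        using ij(1,3) ideal.Icarr[OF delta_ideal_ideal[OF I]] ideal.Icarr[OF delta_ideal_ideal[OF J]] by auto
      ultimately show False using M.I_prime[of i j] by blast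
    qed
    then show "I \<subseteq> delta_core R \<Delta> M \<or> J \<subseteq> delta_core R \<Delta> M"
      using core(3) I J by blast
  qed (rule core(1))
qed

text \<open>With b = d a, factors a are traded one by one for factors b^2. Differentiating a^(m+1)
  b^(2k) and multiplying by b gives (m+1) a^m b^(2k+2) plus a multiple of a^(m+1) b^(2k), which lies
  in \<open>Q\<close> already; then m + 1 is divided out. After n trades only b^(2n) is
  left.\<close>

lemma delta_ideal_nilpotent_d:
  fixes n :: nat
  assumes Q: "delta_ideal R \<Delta> Q"
    and units: "\<And>n::nat. n > 0 \<Longrightarrow> add_pow R n \<one> \<in> Units R"
    and d: "d \<in> \<Delta>" and a: "a \<in> carrier R" "a [^] n \<in> Q"
  shows "d a [^] (2 * n) \<in> Q"
proof -
  interpret Q: ideal Q R using Q by (simp add: delta_ideal_def)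
  have "a [^] (n - k) \<otimes> d a [^] (2 * k) \<in> Q" if "k \<le> n" for k
    using that
  proof (induction k)
    case 0
    then show ?case using a by simp
  next
    case (Suc k)
    define m b where "m = n - Suc k" and "b = d a"
    have nk: "n - k = Suc m" using Suc.prems by (simp add: m_def)
    have b [simp]: "b \<in> carrier R" using a d by (simp add: b_def)
    let ?\<nu> = "add_pow R (Suc m) \<one>" and ?\<mu> = "add_pow R (2 * k) \<one>"
    have \<nu>: "?\<nu> \<in> Units R" by (rule units) simp
    have mem: "a [^] Suc m \<otimes> b [^] (2 * k) \<in> Q" using Suc nk by (simp add: b_def)
    have "d (a [^] Suc m \<otimes> b [^] (2 * k)) \<otimes> b \<in> Q"
      by (rule Q.I_r_closed[OF delta_ideal_d[OF Q d mem] b])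
    moreover have "a [^] Suc m \<otimes> b [^] (2 * k) \<otimes> (?\<mu> \<otimes> d b) \<in> Q"
      using d by (intro Q.I_r_closed[OF mem]) simp_all
    ultimately have "d (a [^] Suc m \<otimes> b [^] (2 * k)) \<otimes> b \<ominus>
        a [^] Suc m \<otimes> b [^] (2 * k) \<otimes> (?\<mu> \<otimes> d b) \<in> Q"
      by (simp add: minus_eq)
    also have "d (a [^] Suc m \<otimes> b [^] (2 * k)) \<otimes> b =
        d (a [^] Suc m) \<otimes> b [^] (2 * k) \<otimes> b \<oplus> a [^] Suc m \<otimes> (d (b [^] (2 * k)) \<otimes> b)"
      using a d by (subst d_mult) (simp_all add: l_distr m_assoc)
    also have "\<dots> = ?\<nu> \<otimes> (a [^] m \<otimes> b) \<otimes> b [^] (2 * k) \<otimes> b \<oplus>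
        a [^] Suc m \<otimes> (?\<mu> \<otimes> (b [^] (2 * k) \<otimes> d b))"
      using a d by (simp only: d_pow_Suc d_pow b b_def[symmetric])
    also have "a [^] Suc m \<otimes> (?\<mu> \<otimes> (b [^] (2 * k) \<otimes> d b)) =
        a [^] Suc m \<otimes> b [^] (2 * k) \<otimes> (?\<mu> \<otimes> d b)"
      using a d by (simp add: m_ac del: nat_pow_Suc)
    also have "?\<nu> \<otimes> (a [^] m \<otimes> b) \<otimes> b [^] (2 * k) \<otimes> b \<oplus>
          a [^] Suc m \<otimes> b [^] (2 * k) \<otimes> (?\<mu> \<otimes> d b) \<ominus>
          a [^] Suc m \<otimes> b [^] (2 * k) \<otimes> (?\<mu> \<otimes> d b) =
        ?\<nu> \<otimes> (a [^] m \<otimes> b) \<otimes> b [^] (2 * k) \<otimes> b"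
      using a d by (simp add: minus_eq a_assoc r_neg del: nat_pow_Suc)
    finally have "inv ?\<nu> \<otimes> (?\<nu> \<otimes> (a [^] m \<otimes> b) \<otimes> b [^] (2 * k) \<otimes> b) \<in> Q"
      by (rule Q.I_l_closed[OF _ Units_inv_closed[OF \<nu>]])
    also have "inv ?\<nu> \<otimes> (?\<nu> \<otimes> (a [^] m \<otimes> b) \<otimes> b [^] (2 * k) \<otimes> b) =
        (inv ?\<nu> \<otimes> ?\<nu>) \<otimes> (a [^] m \<otimes> (b [^] (2 * k) \<otimes> b \<otimes> b))"
      using a Units_inv_closed[OF \<nu>] by (simp only: m_ac m_closed nat_pow_closed b Units_closed[OF \<nu>])
    also have "\<dots> = a [^] (n - Suc k) \<otimes> d a [^] (2 * Suc k)"
      using a \<nu> by (simp add: m_def b_def[symmetric])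
    finally show ?case .
  qed
  from this[of n] show ?thesis using a d by simp
qed

text \<open>In characteristic zero the radical of a differential ideal is differential, and colon ideals
  of a radical differential ideal are differential. Noetherianity makes a power of the radical of a
  \<open>\<Delta>\<close>-prime ideal fall into that ideal.\<close>

lemma delta_prime_imp_primeideal:
  assumes noeth: "noetherian_ring R"
    and units: "\<And>n::nat. n > 0 \<Longrightarrow> add_pow R n \<one> \<in> Units R"
    and Q: "delta_prime R \<Delta> Q"
  shows "primeideal Q R"
proof -
  have Qd: "delta_ideal R \<Delta> Q" and Qc: "carrier R \<noteq> Q"
    using Q by (auto simp: delta_prime_def)
  interpret Q: ideal Q R using Qd by (simp add: delta_ideal_def)
  have prod: "I \<subseteq> Q \<or> J \<subseteq> Q"
    if "delta_ideal R \<Delta> I" "delta_ideal R \<Delta> J" "\<And>i j. \<lbrakk>i \<in> I; j \<in> J\<rbrakk> \<Longrightarrow> i \<otimes> j \<in> Q" for I J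
  proof -
    have "x \<in> Q" if "x \<in> ideal_prod R I J" for x
      using that
    proof (induction rule: ideal_prod.induct)
      case (prod i j)
      then show ?case by (rule \<open>\<And>i j. \<lbrakk>i \<in> I; j \<in> J\<rbrakk> \<Longrightarrow> i \<otimes> j \<in> Q\<close>)
    qed simp
    then have "ideal_prod R I J \<subseteq> Q" by (rule subsetI)
    then show ?thesis using Q that(1,2) by (simp add: delta_prime_def)
  qed
  define N where "N = {a \<in> carrier R. \<exists>n::nat. a [^] n \<in> Q}"
  have Nid: "ideal N R" unfolding N_def by (rule ideal_radical[OF Q.is_ideal])
  then have Nd: "delta_ideal R \<Delta> N"
    unfolding delta_ideal_def
  proof (intro conjI ballI image_subsetI)
    fix d a assume d: "d \<in> \<Delta>" and "a \<in> N"
    then obtain n :: nat where "a \<in> carrier R" "a [^] n \<in> Q" by (auto simp: N_def)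
    then show "d a \<in> N" using d delta_ideal_nilpotent_d[OF Qd units d] by (auto simp: N_def)
  qed
  \<comment> \<open>Noetherianity enters through finitely many generators of \<open>N\<close>: for
    each generator a, the current r is multiplied by the highest power of a that keeps the product
    outside \<open>Q\<close>. The result lies outside \<open>Q\<close> and multiplies every
    generator into \<open>Q\<close>.\<close>
  have ann: "\<exists>r\<in>carrier R - Q. \<forall>a\<in>A. r \<otimes> a \<in> Q" if "finite A" "A \<subseteq> N" for A
    using that
  proof (induction A rule: finite_induct)
    case empty
    show ?case using Q.one_imp_carrier Qc by auto
  next
    case (insert a A)
    then obtain r where r: "r \<in> carrier R" "r \<notin> Q" "\<forall>a\<in>A. r \<otimes> a \<in> Q" by auto
    have a: "a \<in> carrier R" "\<exists>n::nat. a [^] n \<in> Q" using insert.prems by (auto simp: N_def)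
    then have ex: "\<exists>n::nat. r \<otimes> a [^] n \<in> Q" using r Q.I_l_closed by blast
    define k where "k = (LEAST n::nat. r \<otimes> a [^] n \<in> Q)"
    have k: "r \<otimes> a [^] k \<in> Q" unfolding k_def using ex by (rule LeastI_ex)
    then have "k \<noteq> 0" using r by (intro notI) simp
    then obtain j where j: "k = Suc j" by (metis not0_implies_Suc)
    then have "r \<otimes> a [^] j \<notin> Q" using not_less_Least[of j "\<lambda>n. r \<otimes> a [^] n \<in> Q"] by (simp add: k_def)
    moreover have "r \<otimes> a [^] j \<otimes> a \<in> Q" using k j r a by (simp add: m_assoc)
    moreover have "r \<otimes> a [^] j \<otimes> c \<in> Q" if "c \<in> A" for c
    proof -
      have c: "c \<in> carrier R" using that insert.prems by (auto simp: N_def)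
      have "(r \<otimes> c) \<otimes> a [^] j \<in> Q" using r that a by (intro Q.I_r_closed[of "r \<otimes> c"]) auto
      also have "(r \<otimes> c) \<otimes> a [^] j = r \<otimes> a [^] j \<otimes> c" using r a c by (simp add: m_ac)
      finally show ?thesis .
    qed
    ultimately show ?case using r(1) a(1) by (intro bexI[of _ "r \<otimes> a [^] j"]) auto
  qed
  have NQ: "N \<subseteq> Q"
  proof -
    obtain A where A: "A \<subseteq> carrier R" "finite A" "N = Idl A"
      using noetherian_ring.finetely_gen[OF noeth Nid] by blast
    then have "A \<subseteq> N" using genideal_self by blast
    then obtain r where r: "r \<in> carrier R" "r \<notin> Q" "\<forall>a\<in>A. r \<otimes> a \<in> Q" using ann A by blast
    have "N \<subseteq> {x \<in> carrier R. \<forall>a\<in>{r}. x \<otimes> a \<in> Q}"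
      unfolding A(3)
    proof (rule genideal_minimal)
      show "ideal {x \<in> carrier R. \<forall>a\<in>{r}. x \<otimes> a \<in> Q} R"
        using r by (intro ideal_colon[OF Q.is_ideal]) simp
      show "A \<subseteq> {x \<in> carrier R. \<forall>a\<in>{r}. x \<otimes> a \<in> Q}"
      proof
        fix x assume "x \<in> A"
        moreover from this have "x \<in> carrier R" using A(1) by blast
        ultimately show "x \<in> {x \<in> carrier R. \<forall>a\<in>{r}. x \<otimes> a \<in> Q}"
          using r m_comm[OF r(1), of x] by auto
      qed
    qed
    then have rN: "r \<otimes> x \<in> Q" if "x \<in> N" for x
      using that r(1) by (auto simp: m_comm)
    \<comment> \<open>This is the colon ideal (Q : N), differential because \<open>N\<close> is. It
      contains r, which is outside \<open>Q\<close>, so primeness among differential ideals puts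
      \<open>N\<close> inside \<open>Q\<close>.\<close>
    let ?J = "{r \<in> carrier R. \<forall>a\<in>N. r \<otimes> a \<in> Q}"
    have "?J \<subseteq> Q \<or> N \<subseteq> Q"
    proof (rule prod)
      show "delta_ideal R \<Delta> ?J"
        using delta_ideal_d[OF Nd] by (intro delta_ideal_colon[OF Qd]) (auto simp: N_def)
    qed (use Nd in auto)
    then show ?thesis using r rN by blast
  qed
  have radical: "a \<in> Q" if "a \<in> carrier R" "a \<otimes> a \<in> Q" for a
  proof -
    have "a [^] (2::nat) \<in> Q" using that by (simp add: numeral_2_eq_2)
    then show ?thesis using NQ that by (auto simp: N_def)
  qed
  \<comment> \<open>The square of a d b equals d(ab) (a d b) - ab (d a)(d b), which lies in
    \<open>Q\<close> as soon as ab does; and \<open>Q\<close> is radical by now.\<close>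
  have colon: "a \<otimes> d b \<in> Q" if "a \<in> carrier R" "b \<in> carrier R" "a \<otimes> b \<in> Q" "d \<in> \<Delta>" for a b d
  proof (rule radical)
    let ?c = "a \<otimes> d b"
    have "d (a \<otimes> b) \<otimes> ?c \<in> Q" "(a \<otimes> b) \<otimes> (d a \<otimes> d b) \<in> Q"
      using that delta_ideal_d[OF Qd, of d "a \<otimes> b"] by (auto intro!: Q.I_r_closed)
    then have "d (a \<otimes> b) \<otimes> ?c \<ominus> (a \<otimes> b) \<otimes> (d a \<otimes> d b) \<in> Q"
      by (simp add: minus_eq)
    also have "d (a \<otimes> b) \<otimes> ?c = ?c \<otimes> ?c \<oplus> (a \<otimes> b) \<otimes> (d a \<otimes> d b)"
      using that by (simp add: d_mult l_distr r_distr m_ac a_comm)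
    also have "\<dots> \<ominus> (a \<otimes> b) \<otimes> (d a \<otimes> d b) = ?c \<otimes> ?c"
      using that by (simp add: minus_eq a_assoc r_neg)
    finally show "?c \<otimes> ?c \<in> Q" .
  qed (use that in auto)
  show ?thesis
  proof (rule primeidealI[OF Q.is_ideal is_cring Qc])
    fix a b assume ab: "a \<in> carrier R" "b \<in> carrier R" "a \<otimes> b \<in> Q"
    \<comment> \<open>The double colon turns primeness for differential ideals into primeness for
      elements: b lies in I = (Q : a), a lies in J = (Q : I), the product JI is in \<open>Q\<close>,
      and by \<open>colon\<close> both are differential.\<close>
    let ?I = "{r \<in> carrier R. \<forall>x\<in>{a}. r \<otimes> x \<in> Q}"
    let ?J = "{r \<in> carrier R. \<forall>x\<in>?I. r \<otimes> x \<in> Q}"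
    have I: "delta_ideal R \<Delta> ?I"
      using ab colon by (intro delta_ideal_colon[OF Qd]) auto
    have J: "delta_ideal R \<Delta> ?J"
      using colon by (intro delta_ideal_colon[OF Qd]) auto
    have "?J \<subseteq> Q \<or> ?I \<subseteq> Q"
      using I J by (intro prod) auto
    moreover have "a \<in> ?J" "b \<in> ?I" using ab by (auto simp: m_comm)
    ultimately show "a \<in> Q \<or> b \<in> Q" by blast
  qed
qed

text \<open>Noetherian induction: a differential ideal that is not \<open>\<Delta>\<close>-prime is enlarged in two ways such
  that every \<open>\<Delta>\<close>-prime ideal above it lies above one of the two enlargements.\<close>

lemma finite_minimal_delta_primes:
  assumes noeth: "noetherian_ring R" and I: "delta_ideal R \<Delta> I"
  shows "\<exists>\<F>. finite \<F> \<and> (\<forall>Q\<in>\<F>. delta_prime R \<Delta> Q \<and> I \<subseteq> Q) \<and>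
    (\<forall>Q. delta_prime R \<Delta> Q \<longrightarrow> I \<subseteq> Q \<longrightarrow> (\<exists>L\<in>\<F>. L \<subseteq> Q))" (is "?good I")
proof (rule ccontr)
  assume "\<not> ?good I"
  define \<B> where "\<B> = {I. delta_ideal R \<Delta> I \<and> \<not> ?good I}"
  have "I \<in> \<B>" using I \<open>\<not> ?good I\<close> by (simp add: \<B>_def)
  have "\<exists>M\<in>\<B>. \<forall>J\<in>\<B>. M \<subseteq> J \<longrightarrow> J = M"
  proof (rule subset_Zorn)
    fix C assume C: "subset.chain \<B> C"
    show "\<exists>U\<in>\<B>. \<forall>J\<in>C. J \<subseteq> U"
    proof (cases "C = {}")
      case False
      have "subset.chain {I. ideal I R} C"
        using C by (auto simp: subset_chain_def \<B>_def delta_ideal_def)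
      \<comment> \<open>A nonempty chain of ideals in a noetherian ring contains its union, so the
        upper bound is itself one of the bad ideals.\<close>
      then have "\<Union>C \<in> C" using noetherian_ring.ideal_chain_is_trivial[OF noeth False] by blast
      then show ?thesis using C by (intro bexI[of _ "\<Union>C"]) (auto simp: subset_chain_def)
    qed (use \<open>I \<in> \<B>\<close> in blast)
  qed
  then obtain M where M: "M \<in> \<B>" and max: "\<And>J. \<lbrakk>J \<in> \<B>; M \<subseteq> J\<rbrakk> \<Longrightarrow> J = M" by blast
  have Md: "delta_ideal R \<Delta> M" and bad: "\<not> ?good M" using M by (auto simp: \<B>_def)
  have "\<not> delta_prime R \<Delta> M"
  proof
    assume "delta_prime R \<Delta> M"
    then have "?good M" by (intro exI[of _ "{M}"]) auto
    then show False using bad by blast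
  qed
  moreover have "M \<noteq> carrier R"
  proof
    assume eq: "M = carrier R"
    have "\<not> M \<subseteq> Q" if "delta_prime R \<Delta> Q" for Q
    proof
      assume "M \<subseteq> Q"
      moreover have "Q \<subseteq> carrier R" "Q \<noteq> carrier R"
        using that ideal.Icarr[of Q R] by (auto simp: delta_prime_def delta_ideal_def)
      ultimately show False using eq by auto
    qed
    then have "?good M" by (intro exI[of _ "{}"]) auto
    then show False using bad by blast
  qed
  ultimately obtain A B where A: "delta_ideal R \<Delta> A" "\<not> A \<subseteq> M" and B: "delta_ideal R \<Delta> B" "\<not> B \<subseteq> M"
    and AB: "ideal_prod R A B \<subseteq> M"
    using Md by (auto simp: delta_prime_def)
  have good: "?good (M <+> J)" if J: "delta_ideal R \<Delta> J" "\<not> J \<subseteq> M" for J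
  proof (rule ccontr)
    assume "\<not> ?good (M <+> J)"
    then have "M <+> J \<in> \<B>" using delta_ideal_add Md J by (simp add: \<B>_def)
    moreover have "M \<subseteq> M <+> J" "J \<subseteq> M <+> J"
      using Md J by (simp_all add: subset_set_add delta_ideal_def)
    ultimately show False using max J by blast
  qed
  obtain F where F: "finite F" "\<forall>Q\<in>F. delta_prime R \<Delta> Q \<and> M <+> A \<subseteq> Q"
    "\<forall>Q. delta_prime R \<Delta> Q \<longrightarrow> M <+> A \<subseteq> Q \<longrightarrow> (\<exists>L\<in>F. L \<subseteq> Q)" using good[OF A] by auto
  obtain G where G: "finite G" "\<forall>Q\<in>G. delta_prime R \<Delta> Q \<and> M <+> B \<subseteq> Q"
    "\<forall>Q. delta_prime R \<Delta> Q \<longrightarrow> M <+> B \<subseteq> Q \<longrightarrow> (\<exists>L\<in>G. L \<subseteq> Q)" using good[OF B] by auto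
  have "\<exists>L\<in>F \<union> G. L \<subseteq> Q" if Q: "delta_prime R \<Delta> Q" "M \<subseteq> Q" for Q
  proof -
    have Qi: "ideal Q R" using Q by (simp add: delta_prime_def delta_ideal_def)
    have "A \<subseteq> Q \<or> B \<subseteq> Q" using Q A B subset_trans[OF AB Q(2)] by (simp add: delta_prime_def)
    then show ?thesis
    proof
      assume "A \<subseteq> Q"
      then have "M <+> A \<subseteq> Q" by (rule set_add_least[OF Qi Q(2)])
      then have "\<exists>L\<in>F. L \<subseteq> Q" using F(3) Q(1) by simp
      then show ?thesis by blast
    next
      assume "B \<subseteq> Q"
      then have "M <+> B \<subseteq> Q" by (rule set_add_least[OF Qi Q(2)])
      then have "\<exists>L\<in>G. L \<subseteq> Q" using G(3) Q(1) by simp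
      then show ?thesis by blast
    qed
  qed
  moreover have "M \<subseteq> M <+> A" "M \<subseteq> M <+> B"
    using Md A B by (simp_all add: subset_set_add delta_ideal_def)
  ultimately have "?good M"
    using F(1,2) G(1,2) by (intro exI[of _ "F \<union> G"] conjI) (simp, blast, blast)
  then show False using bad by blast
qed

end


section \<open>Fraction fields\<close>

context "domain"
begin

lemma mem_fraction_iff:
  "(c, e) \<in> fraction R a b \<longleftrightarrow> a \<in> carrier R \<and> b \<in> carrier R - {\<zero>} \<and> c \<in> carrier R \<and>
    e \<in> carrier R - {\<zero>} \<and> a \<otimes> e = c \<otimes> b"
  by (auto simp: fraction_def fraction_rel_def)

lemma equiv_fraction_rel: "equiv (carrier R \<times> (carrier R - {\<zero>})) (fraction_rel R)"
proof (rule equivI)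
  show "fraction_rel R \<subseteq> (carrier R \<times> (carrier R - {\<zero>})) \<times> (carrier R \<times> (carrier R - {\<zero>}))"
    by (auto simp: fraction_rel_def)
  show "refl_on (carrier R \<times> (carrier R - {\<zero>})) (fraction_rel R)"
    by (auto simp: refl_on_def fraction_rel_def)
  show "sym (fraction_rel R)"
    by (auto simp: sym_def fraction_rel_def)
  show "trans (fraction_rel R)"
  proof (rule transI)
    fix x y z assume xy: "(x, y) \<in> fraction_rel R" and yz: "(y, z) \<in> fraction_rel R"
    obtain a b c e p q where [simp]: "x = (a, b)" "y = (c, e)" "z = (p, q)"
      by (metis surj_pair)
    have 1: "a \<in> carrier R" "b \<in> carrier R" "b \<noteq> \<zero>" "c \<in> carrier R" "e \<in> carrier R" "e \<noteq> \<zero>"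
      "p \<in> carrier R" "q \<in> carrier R" "q \<noteq> \<zero>" "a \<otimes> e = c \<otimes> b" "c \<otimes> q = p \<otimes> e"
      using xy yz by (auto simp: fraction_rel_def)
    have "e \<otimes> (a \<otimes> q) = (a \<otimes> e) \<otimes> q" using 1(1-9) by (simp add: m_ac)
    also have "\<dots> = (c \<otimes> q) \<otimes> b" using 1(1-9) by (simp only: 1(10)) (simp add: m_ac)
    also have "\<dots> = e \<otimes> (p \<otimes> b)" using 1(1-9) by (simp only: 1(11)) (simp add: m_ac)
    finally have "a \<otimes> q = p \<otimes> b" using 1(1-9) by (simp add: m_lcancel)
    then show "(x, z) \<in> fraction_rel R" using 1 by (simp add: fraction_rel_def)
  qed
qed

lemma fraction_eq_iff:
  assumes "a \<in> carrier R" "b \<in> carrier R - {\<zero>}" "c \<in> carrier R" "e \<in> carrier R - {\<zero>}"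
  shows "fraction R a b = fraction R c e \<longleftrightarrow> a \<otimes> e = c \<otimes> b"
  unfolding fraction_def using assms
  by (subst eq_equiv_class_iff[OF equiv_fraction_rel]) (auto simp: fraction_rel_def)

lemma Frac_carrier: "carrier (Frac R) = {fraction R a b | a b. a \<in> carrier R \<and> b \<in> carrier R - {\<zero>}}"
  by (auto simp: Frac_def quotient_def fraction_def)

lemma FracE:
  assumes "x \<in> carrier (Frac R)"
  obtains a b where "a \<in> carrier R" "b \<in> carrier R - {\<zero>}" "x = fraction R a b"
  using assms by (auto simp: Frac_carrier)

lemma fraction_closed:
  "\<lbrakk>a \<in> carrier R; b \<in> carrier R - {\<zero>}\<rbrakk> \<Longrightarrow> fraction R a b \<in> carrier (Frac R)"
  by (auto simp: Frac_carrier)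

lemma UN_fraction:
  assumes "a \<in> carrier R" "b \<in> carrier R - {\<zero>}"
    and "\<And>p q. \<lbrakk>p \<in> carrier R; q \<in> carrier R - {\<zero>}; a \<otimes> q = p \<otimes> b\<rbrakk> \<Longrightarrow> f p q = z"
  shows "(\<Union>(p, q)\<in>fraction R a b. f p q) = z"
proof -
  have "(a, b) \<in> fraction R a b" using assms by (simp add: mem_fraction_iff)
  moreover have "(case x of (p, q) \<Rightarrow> f p q) = z" if "x \<in> fraction R a b" for x
    using that assms(3) by (cases x) (auto simp: mem_fraction_iff)
  ultimately show ?thesis by blast
qed

lemma fraction_mult:
  assumes "a \<in> carrier R" "b \<in> carrier R - {\<zero>}" "c \<in> carrier R" "e \<in> carrier R - {\<zero>}"
  shows "fraction R a b \<otimes>\<^bsub>Frac R\<^esub> fraction R c e = fraction R (a \<otimes> c) (b \<otimes> e)"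
proof -
  have "(\<Union>(p, q)\<in>fraction R a b. \<Union>(r, s)\<in>fraction R c e. fraction R (p \<otimes> r) (q \<otimes> s)) =
      fraction R (a \<otimes> c) (b \<otimes> e)"
  proof (intro UN_fraction)
    fix p q r s
    assume pq: "p \<in> carrier R" "q \<in> carrier R - {\<zero>}" "a \<otimes> q = p \<otimes> b"
      and rs: "r \<in> carrier R" "s \<in> carrier R - {\<zero>}" "c \<otimes> s = r \<otimes> e"
    have "(p \<otimes> r) \<otimes> (b \<otimes> e) = (p \<otimes> b) \<otimes> (r \<otimes> e)"
      using assms pq(1,2) rs(1,2) by (simp add: m_ac)
    also have "\<dots> = (a \<otimes> q) \<otimes> (c \<otimes> s)" by (simp only: pq(3) rs(3))
    also have "\<dots> = (a \<otimes> c) \<otimes> (q \<otimes> s)"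
      using assms pq(1,2) rs(1,2) by (simp add: m_ac)
    finally show "fraction R (p \<otimes> r) (q \<otimes> s) = fraction R (a \<otimes> c) (b \<otimes> e)"
      using assms pq(1,2) rs(1,2) by (subst fraction_eq_iff) (auto simp: integral_iff)
  qed (use assms in auto)
  then show ?thesis by (simp add: Frac_def)
qed

lemma fraction_add:
  assumes "a \<in> carrier R" "b \<in> carrier R - {\<zero>}" "c \<in> carrier R" "e \<in> carrier R - {\<zero>}"
  shows "fraction R a b \<oplus>\<^bsub>Frac R\<^esub> fraction R c e = fraction R (a \<otimes> e \<oplus> c \<otimes> b) (b \<otimes> e)"
proof -
  have "(\<Union>(p, q)\<in>fraction R a b. \<Union>(r, s)\<in>fraction R c e. fraction R (p \<otimes> s \<oplus> r \<otimes> q) (q \<otimes> s)) =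
      fraction R (a \<otimes> e \<oplus> c \<otimes> b) (b \<otimes> e)"
  proof (intro UN_fraction)
    fix p q r s
    assume pq: "p \<in> carrier R" "q \<in> carrier R - {\<zero>}" "a \<otimes> q = p \<otimes> b"
      and rs: "r \<in> carrier R" "s \<in> carrier R - {\<zero>}" "c \<otimes> s = r \<otimes> e"
    have "(p \<otimes> s \<oplus> r \<otimes> q) \<otimes> (b \<otimes> e) = (p \<otimes> b) \<otimes> (s \<otimes> e) \<oplus> (r \<otimes> e) \<otimes> (q \<otimes> b)"
      using assms pq(1,2) rs(1,2) by (simp add: m_ac l_distr r_distr)
    also have "\<dots> = (a \<otimes> q) \<otimes> (s \<otimes> e) \<oplus> (c \<otimes> s) \<otimes> (q \<otimes> b)" by (simp only: pq(3) rs(3))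
    also have "\<dots> = (a \<otimes> e \<oplus> c \<otimes> b) \<otimes> (q \<otimes> s)"
      using assms pq(1,2) rs(1,2) by (simp add: m_ac l_distr r_distr)
    finally show "fraction R (p \<otimes> s \<oplus> r \<otimes> q) (q \<otimes> s) = fraction R (a \<otimes> e \<oplus> c \<otimes> b) (b \<otimes> e)"
      using assms pq(1,2) rs(1,2) by (subst fraction_eq_iff) (auto simp: integral_iff)
  qed (use assms in auto)
  then show ?thesis by (simp add: Frac_def)
qed

lemma Frac_zero: "\<zero>\<^bsub>Frac R\<^esub> = fraction R \<zero> \<one>"
  by (simp add: Frac_def)

lemma Frac_one: "\<one>\<^bsub>Frac R\<^esub> = fraction R \<one> \<one>"
  by (simp add: Frac_def)

lemma fraction_eq_zero_iff:
  "\<lbrakk>a \<in> carrier R; b \<in> carrier R - {\<zero>}\<rbrakk> \<Longrightarrow> fraction R a b = \<zero>\<^bsub>Frac R\<^esub> \<longleftrightarrow> a = \<zero>"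
  by (simp add: Frac_zero fraction_eq_iff)

lemma field_Frac: "field (Frac R)"
proof -
  have ab: "abelian_group (Frac R)"
  proof (rule abelian_groupI)
    show "x \<oplus>\<^bsub>Frac R\<^esub> y \<in> carrier (Frac R)"
      if "x \<in> carrier (Frac R)" "y \<in> carrier (Frac R)" for x y
      using that by (elim FracE) (simp add: fraction_add integral_iff fraction_closed)
    show "\<zero>\<^bsub>Frac R\<^esub> \<in> carrier (Frac R)"
      by (auto simp: Frac_zero intro!: fraction_closed)
    show "x \<oplus>\<^bsub>Frac R\<^esub> y \<oplus>\<^bsub>Frac R\<^esub> z = x \<oplus>\<^bsub>Frac R\<^esub> (y \<oplus>\<^bsub>Frac R\<^esub> z)"
      if "x \<in> carrier (Frac R)" "y \<in> carrier (Frac R)" "z \<in> carrier (Frac R)" for x y z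
      using that
      by (elim FracE) (simp add: fraction_add integral_iff fraction_eq_iff l_distr r_distr a_ac m_ac)
    show "x \<oplus>\<^bsub>Frac R\<^esub> y = y \<oplus>\<^bsub>Frac R\<^esub> x"
      if "x \<in> carrier (Frac R)" "y \<in> carrier (Frac R)" for x y
      using that by (elim FracE) (simp add: fraction_add integral_iff a_comm m_comm)
    show "\<zero>\<^bsub>Frac R\<^esub> \<oplus>\<^bsub>Frac R\<^esub> x = x" if "x \<in> carrier (Frac R)" for x
      using that by (elim FracE) (simp add: fraction_add Frac_zero)
    show "\<exists>y\<in>carrier (Frac R). y \<oplus>\<^bsub>Frac R\<^esub> x = \<zero>\<^bsub>Frac R\<^esub>" if x: "x \<in> carrier (Frac R)" for x
    proof -
      obtain a b where ab: "a \<in> carrier R" "b \<in> carrier R - {\<zero>}" "x = fraction R a b"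
        using x by (rule FracE)
      then have "fraction R (\<ominus> a) b \<oplus>\<^bsub>Frac R\<^esub> x = \<zero>\<^bsub>Frac R\<^esub>"
        by (simp add: fraction_add fraction_eq_zero_iff integral_iff l_minus l_neg)
      then show ?thesis using ab by (intro bexI[of _ "fraction R (\<ominus> a) b"] fraction_closed) auto
    qed
  qed
  have cm: "comm_monoid (Frac R)"
  proof (rule comm_monoidI)
    show "x \<otimes>\<^bsub>Frac R\<^esub> y \<in> carrier (Frac R)"
      if "x \<in> carrier (Frac R)" "y \<in> carrier (Frac R)" for x y
      using that by (elim FracE) (simp add: fraction_mult integral_iff fraction_closed)
    show "\<one>\<^bsub>Frac R\<^esub> \<in> carrier (Frac R)"
      by (auto simp: Frac_one intro!: fraction_closed)
    show "x \<otimes>\<^bsub>Frac R\<^esub> y \<otimes>\<^bsub>Frac R\<^esub> z = x \<otimes>\<^bsub>Frac R\<^esub> (y \<otimes>\<^bsub>Frac R\<^esub> z)"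
      if "x \<in> carrier (Frac R)" "y \<in> carrier (Frac R)" "z \<in> carrier (Frac R)" for x y z
      using that by (elim FracE) (simp add: fraction_mult integral_iff m_assoc)
    show "\<one>\<^bsub>Frac R\<^esub> \<otimes>\<^bsub>Frac R\<^esub> x = x" if "x \<in> carrier (Frac R)" for x
      using that by (elim FracE) (simp add: fraction_mult Frac_one)
    show "x \<otimes>\<^bsub>Frac R\<^esub> y = y \<otimes>\<^bsub>Frac R\<^esub> x"
      if "x \<in> carrier (Frac R)" "y \<in> carrier (Frac R)" for x y
      using that by (elim FracE) (simp add: fraction_mult integral_iff m_comm)
  qed
  have "cring (Frac R)"
  proof (rule cringI[OF ab cm])
    fix x y z assume "x \<in> carrier (Frac R)" "y \<in> carrier (Frac R)" "z \<in> carrier (Frac R)"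
    then show "(x \<oplus>\<^bsub>Frac R\<^esub> y) \<otimes>\<^bsub>Frac R\<^esub> z = x \<otimes>\<^bsub>Frac R\<^esub> z \<oplus>\<^bsub>Frac R\<^esub> y \<otimes>\<^bsub>Frac R\<^esub> z"
      by (elim FracE) (simp add: fraction_add fraction_mult integral_iff fraction_eq_iff
          l_distr r_distr a_ac m_ac)
  qed
  then interpret F: cring "Frac R" .
  have one: "\<one>\<^bsub>Frac R\<^esub> \<noteq> \<zero>\<^bsub>Frac R\<^esub>"
    by (simp add: Frac_one fraction_eq_zero_iff)
  have "Units (Frac R) = carrier (Frac R) - {\<zero>\<^bsub>Frac R\<^esub>}"
  proof (intro equalityI subsetI)
    fix x assume "x \<in> Units (Frac R)"
    moreover have "\<zero>\<^bsub>Frac R\<^esub> \<notin> Units (Frac R)"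
    proof
      assume "\<zero>\<^bsub>Frac R\<^esub> \<in> Units (Frac R)"
      then show False using one F.Units_l_inv F.Units_inv_closed F.r_null by metis
    qed
    ultimately show "x \<in> carrier (Frac R) - {\<zero>\<^bsub>Frac R\<^esub>}" using F.Units_closed by auto
  next
    fix x assume "x \<in> carrier (Frac R) - {\<zero>\<^bsub>Frac R\<^esub>}"
    then have x: "x \<in> carrier (Frac R)" "x \<noteq> \<zero>\<^bsub>Frac R\<^esub>" by auto
    from x(1) obtain a b where ab: "a \<in> carrier R" "b \<in> carrier R - {\<zero>}" "x = fraction R a b"
      by (rule FracE)
    then have "a \<noteq> \<zero>" using x(2) by (simp add: fraction_eq_zero_iff)
    with ab have "x \<otimes>\<^bsub>Frac R\<^esub> fraction R b a = \<one>\<^bsub>Frac R\<^esub>"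
      by (simp add: fraction_mult Frac_one fraction_eq_iff integral_iff m_comm)
    moreover have "x \<in> carrier (Frac R)" "fraction R b a \<in> carrier (Frac R)"
      using ab \<open>a \<noteq> \<zero>\<close> by (auto intro!: fraction_closed)
    moreover from this have "fraction R b a \<otimes>\<^bsub>Frac R\<^esub> x = \<one>\<^bsub>Frac R\<^esub>"
      using calculation(1) F.m_comm by metis
    ultimately have "\<exists>y\<in>carrier (Frac R). y \<otimes>\<^bsub>Frac R\<^esub> x = \<one>\<^bsub>Frac R\<^esub> \<and> x \<otimes>\<^bsub>Frac R\<^esub> y = \<one>\<^bsub>Frac R\<^esub>"
      by (intro bexI[of _ "fraction R b a"] conjI)
    then show "x \<in> Units (Frac R)" using \<open>x \<in> carrier (Frac R)\<close> by (simp add: Units_def)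
  qed
  then show ?thesis by (rule F.cring_fieldI)
qed

end


section \<open>Algebraic elements modulo an ideal\<close>

text \<open>Polynomials are coefficient lists, the constant coefficient first, without normalization.\<close>

primrec horner :: "('b, 'm) ring_scheme \<Rightarrow> ('a \<Rightarrow> 'b) \<Rightarrow> 'a list \<Rightarrow> 'b \<Rightarrow> 'b" where
  "horner S h [] x = \<zero>\<^bsub>S\<^esub>"
| "horner S h (c # cs) x = h c \<oplus>\<^bsub>S\<^esub> x \<otimes>\<^bsub>S\<^esub> horner S h cs x"

fun list_add :: "('a, 'm) ring_scheme \<Rightarrow> 'a list \<Rightarrow> 'a list \<Rightarrow> 'a list" where
  "list_add K [] q = q"
| "list_add K p [] = p"
| "list_add K (a # p) (b # q) = (a \<oplus>\<^bsub>K\<^esub> b) # list_add K p q"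

text \<open>The coefficients of \<open>(X - c) * p\<close>.\<close>

definition mult_linear :: "('a, 'm) ring_scheme \<Rightarrow> 'a \<Rightarrow> 'a list \<Rightarrow> 'a list" where
  "mult_linear K c p = list_add K (\<zero>\<^bsub>K\<^esub> # p) (map (\<lambda>a. \<ominus>\<^bsub>K\<^esub> c \<otimes>\<^bsub>K\<^esub> a) p)"

lemma (in ring) list_add_closed:
  "\<lbrakk>set p \<subseteq> carrier R; set q \<subseteq> carrier R\<rbrakk> \<Longrightarrow> set (list_add R p q) \<subseteq> carrier R"
proof (induction p arbitrary: q)
  case (Cons a p)
  then show ?case by (cases q) auto
qed simp

lemma (in ring) mult_linear_closed:
  "\<lbrakk>c \<in> carrier R; set p \<subseteq> carrier R\<rbrakk> \<Longrightarrow> set (mult_linear R c p) \<subseteq> carrier R"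
  unfolding mult_linear_def by (intro list_add_closed) auto

context ring_hom_cring
begin

lemma horner_closed:
  "\<lbrakk>set p \<subseteq> carrier R; x \<in> carrier S\<rbrakk> \<Longrightarrow> horner S h p x \<in> carrier S"
  by (induction p) auto

lemma horner_list_add:
  "\<lbrakk>set p \<subseteq> carrier R; set q \<subseteq> carrier R; x \<in> carrier S\<rbrakk> \<Longrightarrow>
    horner S h (list_add R p q) x = horner S h p x \<oplus>\<^bsub>S\<^esub> horner S h q x"
proof (induction p arbitrary: q)
  case (Cons a p)
  then show ?case by (cases q) (auto simp: horner_closed S.r_distr S.a_ac)
qed (auto simp: horner_closed)

lemma horner_scale:
  "\<lbrakk>set p \<subseteq> carrier R; c \<in> carrier R; x \<in> carrier S\<rbrakk> \<Longrightarrow>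
    horner S h (map (\<lambda>a. c \<otimes> a) p) x = h c \<otimes>\<^bsub>S\<^esub> horner S h p x"
  by (induction p) (auto simp: horner_closed S.r_distr S.m_ac)

lemma horner_mult_linear:
  assumes "set p \<subseteq> carrier R" "c \<in> carrier R" "x \<in> carrier S"
  shows "horner S h (mult_linear R c p) x = (x \<ominus>\<^bsub>S\<^esub> h c) \<otimes>\<^bsub>S\<^esub> horner S h p x"
proof -
  have "set (map (\<lambda>a. \<ominus> c \<otimes> a) p) \<subseteq> carrier R" using assms by auto
  then show ?thesis
    using assms unfolding mult_linear_def
    by (subst horner_list_add)
       (auto simp: horner_scale horner_closed S.l_distr S.l_minus S.minus_eq)
qed

lemma horner_zero:
  "\<lbrakk>\<forall>a\<in>set p. a = \<zero>; x \<in> carrier S\<rbrakk> \<Longrightarrow> horner S h p x = \<zero>\<^bsub>S\<^esub>"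
  by (induction p) auto

end

text \<open>One summation step: if g stands for s p/Q and r for s/L, then g + A r stands for s (L p
  + A Q)/(L Q). The right-hand side shows that the error of the new congruence is a combination of
  the two old errors.\<close>

lemma (in cring) partial_fraction_identity:
  assumes "L \<in> carrier R" "Q \<in> carrier R" "A \<in> carrier R" "r \<in> carrier R" "g \<in> carrier R"
    "s \<in> carrier R" "p \<in> carrier R"
  shows "(L \<otimes> Q) \<otimes> (A \<otimes> r \<oplus> g) \<ominus> s \<otimes> (L \<otimes> p \<oplus> A \<otimes> Q) =
    L \<otimes> (Q \<otimes> g \<ominus> s \<otimes> p) \<oplus> (A \<otimes> Q) \<otimes> (L \<otimes> r \<ominus> s)"
  using assms by algebra

section \<open>Algebras over a field: linear dependence, algebraicity and homogenised
  polynomials\<close>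

locale field_algebra = cring R + K: field K + alg: algebra K R
  for R :: "('a, 'b, 'd) module_scheme" (structure) and K :: "('a, 'c) ring_scheme"
begin

lemma scalar_hom: "ring_hom_cring K R (\<lambda>c. c \<odot> \<one>)"
proof (intro ring_hom_cring.intro ring_hom_cring_axioms.intro)
  show "cring K" by (rule K.is_cring)
  show "cring R" by (rule is_cring)
  show "(\<lambda>c. c \<odot> \<one>) \<in> ring_hom K R"
    by (rule ring_hom_memI)
      (auto simp: alg.smult_l_distr alg.smult_assoc1 alg.smult_assoc2)
qed

sublocale sc: ring_hom_cring K R "\<lambda>c. c \<odot> \<one>"
  by (rule scalar_hom)

lemma smult_eq: "\<lbrakk>c \<in> carrier K; x \<in> carrier R\<rbrakk> \<Longrightarrow> c \<odot> x = c \<odot> \<one> \<otimes> x"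
  by (simp add: alg.smult_assoc2)

lemma vectorspace: "vectorspace K R"
  by (intro vectorspace.intro alg.module_axioms K.field_axioms)

text \<open>For a family rather than a set: repetitions in \<open>f\<close> also yield a relation.\<close>

lemma linear_dependence:
  assumes C: "infinite C" and F: "finite F" "F \<subseteq> carrier R" and f: "f ` C \<subseteq> alg.span F"
  shows "\<exists>I \<alpha>. finite I \<and> I \<noteq> {} \<and> I \<subseteq> C \<and> \<alpha> \<in> I \<rightarrow> carrier K - {\<zero>\<^bsub>K\<^esub>} \<and>
    (\<Oplus>i\<in>I. \<alpha> i \<odot> f i) = \<zero>"
proof -
  interpret V: vectorspace K R by (rule vectorspace)
  have fR: "f i \<in> carrier R" if "i \<in> C" for i
    using f that alg.span_is_subset2[OF F(2)] by blast
  show ?thesis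
  proof (cases "inj_on f C")
    case True
    then have "infinite (f ` C)" using C by (simp add: finite_image_iff)
    then obtain A where A: "A \<subseteq> f ` C" "finite A" "card A = Suc (card F)"
      by (meson infinite_arbitrarily_large)
    have "alg.lin_dep A"
    proof (rule ccontr)
      assume "alg.lin_indpt A"
      \<comment> \<open>\<open>A\<close> has one element more than \<open>F\<close>, so the exchange
        lemma would produce a set of size at most -1.\<close>
      then have "\<exists>D. finite D \<and> D \<subseteq> carrier R \<and> D \<subseteq> alg.span F \<and> D \<inter> A = {} \<and>
          int (card D) \<le> int (card F) - int (card A) \<and> alg.span (A \<union> D) = alg.span F"
        using A(1) f by (intro V.replacement[OF A(2) F]) auto
      then obtain D :: "'b set" where "int (card D) \<le> int (card F) - int (card A)" by auto
      then show False using A(3) by simp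
    qed
    then obtain A' a v where A': "finite A'" "A' \<subseteq> A" "a \<in> A' \<rightarrow> carrier K"
      "alg.lincomb a A' = \<zero>" "v \<in> A'" "a v \<noteq> \<zero>\<^bsub>K\<^esub>"
      unfolding alg.lin_dep_def by (elim exE conjE)
    \<comment> \<open>Indices with coefficient zero are left out: the numerator built from the
      relation is nonzero at a pole c only if the coefficient at c is nonzero.\<close>
    define I where "I = {i \<in> C. f i \<in> A' \<and> a (f i) \<noteq> \<zero>\<^bsub>K\<^esub>}"
    have inj: "inj_on f I" using True by (rule inj_on_subset) (auto simp: I_def)
    have fI: "f ` I = {w \<in> A'. a w \<noteq> \<zero>\<^bsub>K\<^esub>}" using A'(2) A(1) by (auto simp: I_def)
    then have "finite (f ` I)" using A'(1) by simp
    then have "finite I" using inj by (simp add: finite_image_iff)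
    moreover have "I \<noteq> {}" using A'(5,6) fI by blast
    moreover have "I \<subseteq> C" by (auto simp: I_def)
    moreover have "(\<lambda>i. a (f i)) \<in> I \<rightarrow> carrier K - {\<zero>\<^bsub>K\<^esub>}" using A'(3) by (auto simp: I_def)
    moreover have "(\<Oplus>i\<in>I. a (f i) \<odot> f i) = \<zero>"
    proof -
      have A'R: "w \<in> carrier R" if "w \<in> A'" for w using that A'(2) A(1) fR by auto
      have "(\<Oplus>i\<in>I. a (f i) \<odot> f i) = (\<Oplus>w\<in>f ` I. a w \<odot> w)"
        using inj A'(3) A'R by (subst add.finprod_reindex) (auto simp: I_def)
      also have "\<dots> = (\<Oplus>w\<in>A'. a w \<odot> w)"
        unfolding fI using A'(1,3) A'R
        by (intro add.finprod_mono_neutral_cong_left) auto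
      finally show ?thesis using A'(4) by (simp add: alg.lincomb_def)
    qed
    ultimately show ?thesis by blast
  next
    case False
    then obtain i j where ij: "i \<in> C" "j \<in> C" "i \<noteq> j" "f i = f j" by (auto simp: inj_on_def)
    define \<alpha> where "\<alpha> = (\<lambda>k. if k = i then \<one>\<^bsub>K\<^esub> else \<ominus>\<^bsub>K\<^esub> \<one>\<^bsub>K\<^esub>)"
    have "\<alpha> i \<odot> f i \<oplus> \<alpha> j \<odot> f j = \<zero>"
      using ij fR[of j] by (simp add: \<alpha>_def alg.smult_l_minus r_neg)
    then have "(\<Oplus>k\<in>{i, j}. \<alpha> k \<odot> f k) = \<zero>"
      using ij(3) fR[OF ij(1)] fR[OF ij(2)] by (subst finsum_insert) (auto simp: \<alpha>_def)
    moreover have "\<alpha> \<in> {i, j} \<rightarrow> carrier K - {\<zero>\<^bsub>K\<^esub>}" by (auto simp: \<alpha>_def)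
    ultimately show ?thesis using ij(1,2) by (intro exI[of _ "{i, j}"] exI[of _ \<alpha>]) auto
  qed
qed

definition algebraic_mod :: "'b set \<Rightarrow> 'b \<Rightarrow> bool" where
  "algebraic_mod M e \<longleftrightarrow> (\<exists>p. set p \<subseteq> carrier K \<and> (\<exists>c\<in>set p. c \<noteq> \<zero>\<^bsub>K\<^esub>) \<and>
    horner R (\<lambda>c. c \<odot> \<one>) p e \<in> M)"

text \<open>The elements \<open>r c\<close> play the role of \<open>s / (e - c)\<close>. A linear relation between them, cleared of
  denominators, is a polynomial relation for \<open>e\<close>; the polynomial is nonzero because it does not vanish
  at the poles \<open>c\<close>.\<close>

lemma algebraic_mod_partial_fractions:
  assumes M: "primeideal M R" and e: "e \<in> carrier R" and s: "s \<in> carrier R" "s \<notin> M"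
    and C: "infinite C" "C \<subseteq> carrier K" and F: "finite F" "F \<subseteq> carrier R"
    and r: "r ` C \<subseteq> alg.span F" "\<And>c. c \<in> C \<Longrightarrow> (e \<ominus> c \<odot> \<one>) \<otimes> r c \<ominus> s \<in> M"
  shows "algebraic_mod M e"
proof -
  interpret M: primeideal M R by fact
  interpret V: vectorspace K R by (rule vectorspace)
  interpret KK: ring_hom_cring K K id
    by (intro ring_hom_cring.intro ring_hom_cring_axioms.intro K.is_cring) (simp add: ring_hom_def)
  let ?h = "horner R (\<lambda>c. c \<odot> \<one>)" and ?k = "horner K id"
  have rR: "r c \<in> carrier R" if "c \<in> C" for c
    using r(1) that alg.span_is_subset2[OF F(2)] by blast
  \<comment> \<open>Here q is the product of X - i over I, and p/q is the sum of \<alpha> i / (X -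
    i). The roots of q are tracked for the induction alone: adding the pole j changes p to (X - j) p
    + \<alpha> j q, whose value at j is \<alpha> j q(j), nonzero because j is a new pole.\<close>
  have clear: "\<exists>p q. set p \<subseteq> carrier K \<and> set q \<subseteq> carrier K \<and>
      ?h q e \<otimes> (\<Oplus>i\<in>I. \<alpha> i \<odot> r i) \<ominus> s \<otimes> ?h p e \<in> M \<and>
      (\<forall>x\<in>carrier K. ?k q x = \<zero>\<^bsub>K\<^esub> \<longleftrightarrow> x \<in> I) \<and> (\<forall>x\<in>I. ?k p x \<noteq> \<zero>\<^bsub>K\<^esub>)"
    if "finite I" "I \<subseteq> C" "\<alpha> \<in> I \<rightarrow> carrier K - {\<zero>\<^bsub>K\<^esub>}" for I \<alpha>
    using that
  proof (induction I rule: finite_induct)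
    case empty
    show ?case using e s by (intro exI[of _ "[]"] exI[of _ "[\<one>\<^bsub>K\<^esub>]"]) (simp add: minus_eq)
  next
    case (insert j I)
    have "I \<subseteq> C" "\<alpha> \<in> I \<rightarrow> carrier K - {\<zero>\<^bsub>K\<^esub>}" using insert.prems by auto
    from insert.IH[OF this] obtain p q where p: "set p \<subseteq> carrier K" and q: "set q \<subseteq> carrier K"
      and mem: "?h q e \<otimes> (\<Oplus>i\<in>I. \<alpha> i \<odot> r i) \<ominus> s \<otimes> ?h p e \<in> M"
      and root: "\<forall>x\<in>carrier K. ?k q x = \<zero>\<^bsub>K\<^esub> \<longleftrightarrow> x \<in> I"
      and nonroot: "\<forall>x\<in>I. ?k p x \<noteq> \<zero>\<^bsub>K\<^esub>" by (elim exE conjE)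
    define p' where "p' = list_add K (mult_linear K j p) (map (\<lambda>a. \<alpha> j \<otimes>\<^bsub>K\<^esub> a) q)"
    define q' where "q' = mult_linear K j q"
    have j: "j \<in> C" "j \<in> carrier K" "\<alpha> j \<in> carrier K" "\<alpha> j \<noteq> \<zero>\<^bsub>K\<^esub>"
      using insert.prems C(2) by auto
    have \<alpha>q: "set (map (\<lambda>a. \<alpha> j \<otimes>\<^bsub>K\<^esub> a) q) \<subseteq> carrier K" using q j by auto
    have lp: "set (mult_linear K j p) \<subseteq> carrier K" using p j by (intro K.mult_linear_closed)
    have p'c: "set p' \<subseteq> carrier K"
      unfolding p'_def using lp \<alpha>q by (rule K.list_add_closed)
    have q'c: "set q' \<subseteq> carrier K"
      unfolding q'_def using q j by (intro K.mult_linear_closed)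
    have hp': "?h p' e = (e \<ominus> j \<odot> \<one>) \<otimes> ?h p e \<oplus> \<alpha> j \<odot> \<one> \<otimes> ?h q e"
      unfolding p'_def using p q j e
      by (simp add: sc.horner_list_add[OF lp \<alpha>q e] sc.horner_mult_linear sc.horner_scale)
    have hq': "?h q' e = (e \<ominus> j \<odot> \<one>) \<otimes> ?h q e"
      unfolding q'_def using q j e by (simp add: sc.horner_mult_linear)
    have kp': "?k p' x = (x \<ominus>\<^bsub>K\<^esub> j) \<otimes>\<^bsub>K\<^esub> ?k p x \<oplus>\<^bsub>K\<^esub> \<alpha> j \<otimes>\<^bsub>K\<^esub> ?k q x" if "x \<in> carrier K" for x
      unfolding p'_def using p q j that
      by (simp add: KK.horner_list_add[OF lp \<alpha>q that] KK.horner_mult_linear KK.horner_scale)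
    have kq': "?k q' x = (x \<ominus>\<^bsub>K\<^esub> j) \<otimes>\<^bsub>K\<^esub> ?k q x" if "x \<in> carrier K" for x
      unfolding q'_def using q j that by (simp add: KK.horner_mult_linear)
    have \<alpha>r: "\<alpha> i \<odot> r i \<in> carrier R" if "i \<in> insert j I" for i
      using that insert.prems rR by auto
    have sum: "(\<Oplus>i\<in>insert j I. \<alpha> i \<odot> r i) = \<alpha> j \<odot> r j \<oplus> (\<Oplus>i\<in>I. \<alpha> i \<odot> r i)"
      using insert.hyps \<alpha>r by (subst finsum_insert) auto
    have "?h q' e \<otimes> (\<Oplus>i\<in>insert j I. \<alpha> i \<odot> r i) \<ominus> s \<otimes> ?h p' e =
        ((e \<ominus> j \<odot> \<one>) \<otimes> ?h q e) \<otimes> (\<alpha> j \<odot> \<one> \<otimes> r j \<oplus> (\<Oplus>i\<in>I. \<alpha> i \<odot> r i)) \<ominus>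
        s \<otimes> ((e \<ominus> j \<odot> \<one>) \<otimes> ?h p e \<oplus> \<alpha> j \<odot> \<one> \<otimes> ?h q e)"
      by (simp only: hp' hq' sum smult_eq[OF j(3) rR[OF j(1)]])
    also have "\<dots> = (e \<ominus> j \<odot> \<one>) \<otimes> (?h q e \<otimes> (\<Oplus>i\<in>I. \<alpha> i \<odot> r i) \<ominus> s \<otimes> ?h p e) \<oplus>
        (\<alpha> j \<odot> \<one> \<otimes> ?h q e) \<otimes> ((e \<ominus> j \<odot> \<one>) \<otimes> r j \<ominus> s)"
      using e j s(1) p q rR \<alpha>r
      by (intro partial_fraction_identity) (auto simp: sc.horner_closed intro!: finsum_closed)
    also have "\<dots> \<in> M"
      using mem r(2)[OF j(1)] e j q
      by (intro M.a_closed) (simp_all add: M.I_l_closed sc.horner_closed)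
    finally have "?h q' e \<otimes> (\<Oplus>i\<in>insert j I. \<alpha> i \<odot> r i) \<ominus> s \<otimes> ?h p' e \<in> M" .
    moreover have "\<forall>x\<in>carrier K. ?k q' x = \<zero>\<^bsub>K\<^esub> \<longleftrightarrow> x \<in> insert j I"
      using root q j by (auto simp: kq' K.integral_iff KK.horner_closed K.r_right_minus_eq)
    moreover have "?k p' x \<noteq> \<zero>\<^bsub>K\<^esub>" if x: "x \<in> insert j I" for x
    proof -
      have xK: "x \<in> carrier K" using x insert.prems C(2) by blast
      show ?thesis
      proof (cases "x = j")
        case True
        have "?k q j \<noteq> \<zero>\<^bsub>K\<^esub>" using root j insert.hyps by simp
        moreover have "?k p' j = \<alpha> j \<otimes>\<^bsub>K\<^esub> ?k q j"
          using p q j by (simp add: kp' KK.horner_closed K.minus_eq K.r_neg)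
        ultimately show ?thesis
          using True q j by (simp add: K.integral_iff KK.horner_closed)
      next
        case False
        then have "x \<in> I" using x by simp
        then have "?k q x = \<zero>\<^bsub>K\<^esub>" "?k p x \<noteq> \<zero>\<^bsub>K\<^esub>" using root nonroot xK by auto
        then show ?thesis
          using False p q j xK by (simp add: kp' K.r_right_minus_eq K.integral_iff KK.horner_closed)
      qed
    qed
    ultimately show ?case using p'c q'c by blast
  qed
  obtain I \<alpha> where I: "finite I" "I \<noteq> {}" "I \<subseteq> C" "\<alpha> \<in> I \<rightarrow> carrier K - {\<zero>\<^bsub>K\<^esub>}"
    "(\<Oplus>i\<in>I. \<alpha> i \<odot> r i) = \<zero>"
    using linear_dependence[OF C(1) F r(1)] by (elim exE conjE)
  obtain p q where p: "set p \<subseteq> carrier K" and q: "set q \<subseteq> carrier K"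
    and mem: "?h q e \<otimes> (\<Oplus>i\<in>I. \<alpha> i \<odot> r i) \<ominus> s \<otimes> ?h p e \<in> M"
    and nonroot: "\<forall>x\<in>I. ?k p x \<noteq> \<zero>\<^bsub>K\<^esub>"
    using clear[OF I(1,3,4)] by (elim exE conjE)
  have c: "?h p e \<in> carrier R" "?h q e \<in> carrier R" using p q e by (simp_all add: sc.horner_closed)
  have "\<ominus> (s \<otimes> ?h p e) \<in> M" using mem c s I(5) by (simp add: minus_eq)
  then have "\<ominus> (\<ominus> (s \<otimes> ?h p e)) \<in> M" by (rule M.a_inv_closed)
  then have "s \<otimes> ?h p e \<in> M" using c s by simp
  then have "?h p e \<in> M" using M.I_prime[of s] s c by blast
  moreover have "\<exists>c\<in>set p. c \<noteq> \<zero>\<^bsub>K\<^esub>"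
  proof (rule ccontr)
    assume *: "\<not> (\<exists>c\<in>set p. c \<noteq> \<zero>\<^bsub>K\<^esub>)"
    obtain x where "x \<in> I" using I(2) by blast
    moreover from this have "x \<in> carrier K" using I(3) C(2) by blast
    ultimately show False using nonroot KK.horner_zero[of p x] * by auto
  qed
  ultimately show ?thesis using p unfolding algebraic_mod_def by blast
qed

text \<open>The hypothesis on \<open>S\<close> says that \<open>R / M\<close> localized at \<open>S\<close> is a field.\<close>

lemma algebraic_mod_if_small:
  assumes K: "infinite (carrier K)"
    and B: "B \<subseteq> carrier R" "alg.span B = carrier R" "|B| <o |carrier K|"
    and M: "primeideal M R"
    and S: "S \<subseteq> carrier R" "S \<inter> M = {}" "|S| <o |carrier K|"
    and inv: "\<And>x. \<lbrakk>x \<in> carrier R; x \<notin> M\<rbrakk> \<Longrightarrow> \<exists>r\<in>carrier R. \<exists>s\<in>S. x \<otimes> r \<ominus> s \<in> M"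
    and e: "e \<in> carrier R"
  shows "algebraic_mod M e"
proof (cases "\<exists>c\<in>carrier K. e \<ominus> c \<odot> \<one> \<in> M")
  case True
  then obtain c where c: "c \<in> carrier K" "e \<ominus> c \<odot> \<one> \<in> M" by blast
  have "horner R (\<lambda>c. c \<odot> \<one>) [\<ominus>\<^bsub>K\<^esub> c, \<one>\<^bsub>K\<^esub>] e = e \<ominus> c \<odot> \<one>"
    using c(1) e by (simp add: minus_eq a_comm)
  then show ?thesis
    unfolding algebraic_mod_def using c by (intro exI[of _ "[\<ominus>\<^bsub>K\<^esub> c, \<one>\<^bsub>K\<^esub>]"]) auto
next
  case False
  have "\<exists>r s F. r \<in> carrier R \<and> s \<in> S \<and> F \<in> Fpow B \<and> r \<in> alg.span F \<and> (e \<ominus> c \<odot> \<one>) \<otimes> r \<ominus> s \<in> M"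
    if c: "c \<in> carrier K" for c
  proof -
    have "e \<ominus> c \<odot> \<one> \<in> carrier R" "e \<ominus> c \<odot> \<one> \<notin> M" using c e False by auto
    from inv[OF this] obtain r s where rs: "r \<in> carrier R" "s \<in> S" "(e \<ominus> c \<odot> \<one>) \<otimes> r \<ominus> s \<in> M"
      by blast
    have "r \<in> alg.span B" using rs(1) B(2) by simp
    then obtain a F where F: "finite F" "F \<subseteq> B" "a \<in> F \<rightarrow> carrier K" "r = alg.lincomb a F"
      unfolding alg.span_def by blast
    then have "r \<in> alg.span F" unfolding alg.span_def by blast
    then show ?thesis using rs F(1,2) by (auto simp: Fpow_def)
  qed
  then obtain r s F where r: "\<And>c. c \<in> carrier K \<Longrightarrow> r c \<in> carrier R"
    and s: "\<And>c. c \<in> carrier K \<Longrightarrow> s c \<in> S"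
    and F: "\<And>c. c \<in> carrier K \<Longrightarrow> F c \<in> Fpow B"
    and rF: "\<And>c. c \<in> carrier K \<Longrightarrow> r c \<in> alg.span (F c)"
    and mem: "\<And>c. c \<in> carrier K \<Longrightarrow> (e \<ominus> c \<odot> \<one>) \<otimes> r c \<ominus> s c \<in> M"
    by metis
  \<comment> \<open>The pigeonhole runs over pairs of a denominator and a finite support. Infinitely
    many scalars c share both, so their \<open>r c\<close> lie in one finite-dimensional space and
    have one common s.\<close>
  have "|S \<times> Fpow B| <o |carrier K|"
    using K S(3) B(3) by (intro card_of_Times_ordLess_infinite Fpow_ordLess)
  moreover have "(\<lambda>c. (s c, F c)) ` carrier K \<subseteq> S \<times> Fpow B" using s F by auto
  ultimately obtain y where "y \<in> S \<times> Fpow B" and inf: "infinite {c \<in> carrier K. (s c, F c) = y}"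
    using infinite_fibre[OF K, of "S \<times> Fpow B" "\<lambda>c. (s c, F c)"] by blast
  then obtain s' F' where y: "y = (s', F')" "s' \<in> S" "finite F'" "F' \<subseteq> B"
    by (auto simp: Fpow_def)
  show ?thesis
  proof (rule algebraic_mod_partial_fractions[OF M e])
    show "s' \<in> carrier R" "s' \<notin> M" using y S by auto
    show "infinite {c \<in> carrier K. (s c, F c) = y}" by (rule inf)
    show "finite F'" "F' \<subseteq> carrier R" using y B by auto
    show "r ` {c \<in> carrier K. (s c, F c) = y} \<subseteq> alg.span F'" using rF y by auto
    show "(e \<ominus> c \<odot> \<one>) \<otimes> r c \<ominus> s' \<in> M" if "c \<in> {c \<in> carrier K. (s c, F c) = y}" for c
      using that mem y by auto
  qed auto
qed

text \<open>The powers of e are linearly dependent. Factoring out the lowest power e^m of a relation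
  leaves \<alpha> m + e T, which lies in \<open>P\<close> because e^m does not; hence -T / \<alpha>
  m inverts e modulo \<open>P\<close>.\<close>

lemma inverse_mod_if_finite:
  assumes B: "finite B" "B \<subseteq> carrier R" "alg.span B = carrier R"
    and P: "primeideal P R" and e: "e \<in> carrier R" "e \<notin> P"
  shows "\<exists>t\<in>carrier R. \<one> \<ominus> e \<otimes> t \<in> P"
proof -
  interpret P: primeideal P R by fact
  have "range (\<lambda>i::nat. e [^] i) \<subseteq> alg.span B" using e B(3) by auto
  from linear_dependence[OF infinite_UNIV_nat B(1,2) this] obtain I :: "nat set" and \<alpha>
    where I: "finite I" "I \<noteq> {}" "\<alpha> \<in> I \<rightarrow> carrier K - {\<zero>\<^bsub>K\<^esub>}"
    and sum: "(\<Oplus>i\<in>I. \<alpha> i \<odot> e [^] i) = \<zero>"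
    by (elim exE conjE)
  define m where "m = Min I"
  have m: "m \<in> I" "\<And>i. i \<in> I - {m} \<Longrightarrow> m < i"
    using I(1,2) Min_in[OF I(1,2)] Min_le[OF I(1)] by (auto simp: m_def order_less_le)
  have \<alpha>: "\<alpha> i \<in> carrier K" "\<alpha> i \<noteq> \<zero>\<^bsub>K\<^esub>" if "i \<in> I" for i using that I(3) by auto
  define T where "T = (\<Oplus>i\<in>I - {m}. \<alpha> i \<odot> e [^] (i - Suc m))"
  have T: "T \<in> carrier R" unfolding T_def using \<alpha> e by (auto intro!: finsum_closed)
  have "\<zero> = (\<Oplus>i\<in>insert m (I - {m}). \<alpha> i \<odot> e [^] i)" using m(1) sum by (simp add: insert_absorb)
  also have "\<dots> = \<alpha> m \<odot> e [^] m \<oplus> (\<Oplus>i\<in>I - {m}. \<alpha> i \<odot> e [^] i)"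
    using I(1) \<alpha> m(1) e by (subst finsum_insert) auto
  also have "(\<Oplus>i\<in>I - {m}. \<alpha> i \<odot> e [^] i) = (\<Oplus>i\<in>I - {m}. e [^] Suc m \<otimes> (\<alpha> i \<odot> e [^] (i - Suc m)))"
  proof (intro finsum_cong' refl)
    fix i assume i: "i \<in> I - {m}"
    have "e [^] Suc m \<otimes> (\<alpha> i \<odot> e [^] (i - Suc m)) = \<alpha> i \<odot> (e [^] Suc m \<otimes> e [^] (i - Suc m))"
      using \<alpha>[of i] i e
      by (subst (1 2) m_comm) (simp_all add: alg.smult_assoc2 del: nat_pow_Suc)
    also have "e [^] Suc m \<otimes> e [^] (i - Suc m) = e [^] i"
      using m(2)[OF i] e by (subst nat_pow_mult) simp_all
    finally show "\<alpha> i \<odot> e [^] i = e [^] Suc m \<otimes> (\<alpha> i \<odot> e [^] (i - Suc m))" by simp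
  qed (use \<alpha> e in auto)
  also have "\<dots> = e [^] Suc m \<otimes> T"
    unfolding T_def using I(1) \<alpha> e by (subst finsum_rdistr) auto
  also have "\<alpha> m \<odot> e [^] m \<oplus> e [^] Suc m \<otimes> T = e [^] m \<otimes> (\<alpha> m \<odot> \<one> \<oplus> e \<otimes> T)"
    using \<alpha>[OF m(1)] e T by (simp add: smult_eq[of _ "e [^] m"] r_distr m_ac)
  finally have "e [^] m \<otimes> (\<alpha> m \<odot> \<one> \<oplus> e \<otimes> T) \<in> P" using P.zero_closed by simp
  moreover have "e [^] m \<notin> P" using prime_pow_mem[OF P e(1)] e(2) by blast
  ultimately have *: "\<alpha> m \<odot> \<one> \<oplus> e \<otimes> T \<in> P"
    using P.I_prime[of "e [^] m" "\<alpha> m \<odot> \<one> \<oplus> e \<otimes> T"] e T \<alpha>[OF m(1)] by auto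
  let ?i = "inv\<^bsub>K\<^esub> (\<alpha> m)"
  have i: "?i \<in> carrier K" "?i \<otimes>\<^bsub>K\<^esub> \<alpha> m = \<one>\<^bsub>K\<^esub>" using \<alpha>[OF m(1)] by (simp_all add: K.field_Units)
  have "?i \<odot> \<one> \<otimes> (\<alpha> m \<odot> \<one> \<oplus> e \<otimes> T) \<in> P" using i by (intro P.I_l_closed[OF *]) simp
  also have "?i \<odot> \<one> \<otimes> (\<alpha> m \<odot> \<one> \<oplus> e \<otimes> T) = (?i \<odot> \<one> \<otimes> (\<alpha> m \<odot> \<one>)) \<oplus> e \<otimes> (?i \<odot> \<one> \<otimes> T)"
    using i \<alpha>[OF m(1)] e T by (simp add: r_distr m_lcomm del: sc.hom_mult)
  also have "?i \<odot> \<one> \<otimes> (\<alpha> m \<odot> \<one>) = \<one>"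
    using i \<alpha>[OF m(1)] by (simp flip: sc.hom_mult)
  also have "\<one> \<oplus> e \<otimes> (?i \<odot> \<one> \<otimes> T) = \<one> \<ominus> e \<otimes> (\<ominus> (?i \<odot> \<one> \<otimes> T))"
    using i e T by (simp add: minus_eq r_minus)
  finally show ?thesis using i T by (intro bexI[of _ "\<ominus> (?i \<odot> \<one> \<otimes> T)"]) auto
qed

text \<open>\<open>b ^ length cs\<close> times the value at \<open>a / b\<close> of the polynomial with coefficients \<open>cs\<close>.\<close>

primrec hom_eval :: "'a list \<Rightarrow> 'b \<Rightarrow> 'b \<Rightarrow> 'b" where
  "hom_eval [] a b = \<zero>"
| "hom_eval (c # cs) a b = c \<odot> \<one> \<otimes> b [^] Suc (length cs) \<oplus> a \<otimes> hom_eval cs a b"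

lemma hom_eval_closed:
  "\<lbrakk>set cs \<subseteq> carrier K; a \<in> carrier R; b \<in> carrier R\<rbrakk> \<Longrightarrow> hom_eval cs a b \<in> carrier R"
  by (induction cs) auto

text \<open>The hypothesis a = e b modulo \<open>M\<close> lets e play the role of a/b, also when b
  is not invertible. It is applied to the value of a fraction in R/M, and with b = 1 to an element
  of R.\<close>

lemma hom_eval_cong_horner:
  assumes M: "ideal M R" and e: "e \<in> carrier R" "a \<in> carrier R" "b \<in> carrier R" "a \<ominus> e \<otimes> b \<in> M"
    and cs: "set cs \<subseteq> carrier K"
  shows "hom_eval cs a b \<ominus> b [^] length cs \<otimes> horner R (\<lambda>c. c \<odot> \<one>) cs e \<in> M"
  using cs
proof (induction cs)
  case Nil
  interpret M: ideal M R by fact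
  show ?case using e by (simp add: minus_eq)
next
  case (Cons c cs)
  interpret M: ideal M R by fact
  let ?c = "c \<odot> \<one>" and ?B = "b [^] length cs" and ?h = "horner R (\<lambda>c. c \<odot> \<one>) cs e" and ?g = "hom_eval cs a b"
  have cl: "?c \<in> carrier R" "?B \<in> carrier R" "?h \<in> carrier R" "?g \<in> carrier R"
    using Cons.prems e by (simp_all add: hom_eval_closed sc.horner_closed)
  have id: "(x \<otimes> (B \<otimes> b') \<oplus> a' \<otimes> g) \<ominus> (B \<otimes> b') \<otimes> (x \<oplus> e' \<otimes> h) =
      a' \<otimes> (g \<ominus> B \<otimes> h) \<oplus> (B \<otimes> h) \<otimes> (a' \<ominus> e' \<otimes> b')"
    if "x \<in> carrier R" "B \<in> carrier R" "b' \<in> carrier R" "a' \<in> carrier R" "g \<in> carrier R"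
      "e' \<in> carrier R" "h \<in> carrier R" for x B b' a' g e' h
    using that by algebra
  have "a \<otimes> (?g \<ominus> ?B \<otimes> ?h) \<oplus> (?B \<otimes> ?h) \<otimes> (a \<ominus> e \<otimes> b) \<in> M"
    using Cons e cl by (intro M.a_closed) (simp_all add: M.I_l_closed)
  then show ?case using id[OF cl(1,2) e(3,2) cl(4) e(1) cl(3)] by simp
qed

text \<open>Low-order zero coefficients are removed by cancelling a, which is outside
  \<open>P\<close>. The first nonzero one, c, then gives c b^n + a (...) in \<open>P\<close>, and c
  is invertible. For b = 1 this inverts a modulo \<open>P\<close>; for general b it puts b into
  every prime ideal that contains \<open>P\<close> and a.\<close>

lemma hom_eval_mem_prime:
  assumes P: "primeideal P R" and ab: "a \<in> carrier R" "b \<in> carrier R" "a \<notin> P"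
    and cs: "set cs \<subseteq> carrier K" "\<exists>c\<in>set cs. c \<noteq> \<zero>\<^bsub>K\<^esub>" "hom_eval cs a b \<in> P"
  shows "\<exists>n::nat. \<exists>t\<in>carrier R. b [^] n \<ominus> a \<otimes> t \<in> P"
  using cs
proof (induction cs)
  case (Cons c cs)
  interpret P: primeideal P R by fact
  have cl: "hom_eval cs a b \<in> carrier R" "c \<in> carrier K"
    using Cons.prems ab by (simp_all add: hom_eval_closed)
  show ?case
  proof (cases "c = \<zero>\<^bsub>K\<^esub>")
    case True
    then have "a \<otimes> hom_eval cs a b \<in> P" using Cons.prems ab cl by simp
    then have "hom_eval cs a b \<in> P" using P.I_prime ab cl by blast
    then show ?thesis using Cons True by simp
  next
    case False
    let ?i = "inv\<^bsub>K\<^esub> c" and ?n = "Suc (length cs)"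
    have i: "?i \<in> carrier K" "?i \<otimes>\<^bsub>K\<^esub> c = \<one>\<^bsub>K\<^esub>" using cl False by (simp_all add: K.field_Units)
    have "?i \<odot> \<one> \<otimes> hom_eval (c # cs) a b \<in> P"
      using i by (intro P.I_l_closed[OF Cons.prems(3)]) simp
    also have "?i \<odot> \<one> \<otimes> hom_eval (c # cs) a b =
        (?i \<odot> \<one> \<otimes> (c \<odot> \<one>)) \<otimes> b [^] ?n \<oplus> a \<otimes> (?i \<odot> \<one> \<otimes> hom_eval cs a b)"
      using i cl ab by (simp add: r_distr m_ac del: nat_pow_Suc sc.hom_mult)
    also have "?i \<odot> \<one> \<otimes> (c \<odot> \<one>) = \<one>" using i cl by (simp flip: sc.hom_mult)
    also have "\<one> \<otimes> b [^] ?n \<oplus> a \<otimes> (?i \<odot> \<one> \<otimes> hom_eval cs a b) =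
        b [^] ?n \<ominus> a \<otimes> (\<ominus> (?i \<odot> \<one> \<otimes> hom_eval cs a b))"
      using i cl ab by (simp add: minus_eq r_minus del: nat_pow_Suc)
    finally show ?thesis
      using i cl by (intro exI[of _ ?n] bexI[of _ "\<ominus> (?i \<odot> \<one> \<otimes> hom_eval cs a b)"]) auto
  qed
qed simp

end


section \<open>The fraction field of a prime quotient\<close>

lemma (in ring) normalize_eq_Nil: "normalize p = [] \<Longrightarrow> \<forall>a\<in>set p. a = \<zero>"
  by (induction p) (auto split: if_splits)

locale prime_quotient = field_algebra R K + P: primeideal P R
  for R :: "('a, 'b, 'd) module_scheme" (structure) and K :: "('a, 'c) ring_scheme" and P
begin

abbreviation fr :: "'b \<Rightarrow> 'b \<Rightarrow> ('b set \<times> 'b set) set" where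
  "fr a b \<equiv> fraction (R Quot P) (P +> a) (P +> b)"

abbreviation F :: "('b set \<times> 'b set) set ring" where
  "F \<equiv> Frac (R Quot P)"

lemma domain_quotient: "domain (R Quot P)"
  by (rule P.quotient_is_domain)

lemma field_F: "field F"
  using domain_quotient by (rule domain.field_Frac)

lemma coset_eq_iff: "\<lbrakk>a \<in> carrier R; b \<in> carrier R\<rbrakk> \<Longrightarrow> P +> a = P +> b \<longleftrightarrow> a \<ominus> b \<in> P"
  using quotient_eq_iff_same_a_r_cos[OF P.is_ideal] by blast

lemma zero_quotient: "\<zero>\<^bsub>R Quot P\<^esub> = P +> \<zero>"
  using P.a_rcos_const[OF P.zero_closed] by (simp add: FactRing_def)

lemma coset_eq_zero_iff: "a \<in> carrier R \<Longrightarrow> P +> a = \<zero>\<^bsub>R Quot P\<^esub> \<longleftrightarrow> a \<in> P"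
  unfolding zero_quotient by (subst coset_eq_iff) (auto simp: minus_eq)

lemma coset_closed: "a \<in> carrier R \<Longrightarrow> P +> a \<in> carrier (R Quot P)"
  by (auto simp: FactRing_simps)

lemma coset_nonzero: "\<lbrakk>b \<in> carrier R; b \<notin> P\<rbrakk> \<Longrightarrow> P +> b \<in> carrier (R Quot P) - {\<zero>\<^bsub>R Quot P\<^esub>}"
  by (simp add: coset_closed coset_eq_zero_iff)

lemma cosetE:
  assumes "A \<in> carrier (R Quot P)"
  obtains a where "a \<in> carrier R" "A = P +> a"
  using assms by (auto simp: FactRing_simps)

lemma coset_add: "\<lbrakk>a \<in> carrier R; b \<in> carrier R\<rbrakk> \<Longrightarrow> (P +> a) \<oplus>\<^bsub>R Quot P\<^esub> (P +> b) = P +> (a \<oplus> b)"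
  using ring_hom_add[OF P.rcos_ring_hom] by simp

lemma coset_mult: "\<lbrakk>a \<in> carrier R; b \<in> carrier R\<rbrakk> \<Longrightarrow> (P +> a) \<otimes>\<^bsub>R Quot P\<^esub> (P +> b) = P +> (a \<otimes> b)"
  using ring_hom_mult[OF P.rcos_ring_hom] by simp

lemma coset_one: "\<one>\<^bsub>R Quot P\<^esub> = P +> \<one>"
  using ring_hom_one[OF P.rcos_ring_hom] by simp

lemma coset_diff:
  assumes "a \<in> carrier R" "b \<in> carrier R"
  shows "(P +> a) \<ominus>\<^bsub>R Quot P\<^esub> (P +> b) = P +> (a \<ominus> b)"
proof -
  interpret D: "domain" "R Quot P" by (rule domain_quotient)
  have "(P +> (a \<ominus> b)) \<oplus>\<^bsub>R Quot P\<^esub> (P +> b) = P +> a"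
    using assms by (simp add: coset_add minus_eq a_assoc l_neg)
  then show ?thesis
    using assms coset_closed by (metis D.minus_eq D.add.inv_solve_right minus_closed)
qed

lemma one_notin: "\<one> \<notin> P"
  using P.one_imp_carrier P.I_notcarr by blast

lemma fr_eq_iff:
  assumes "a \<in> carrier R" "b \<in> carrier R" "b \<notin> P" "c \<in> carrier R" "e \<in> carrier R" "e \<notin> P"
  shows "fr a b = fr c e \<longleftrightarrow> a \<otimes> e \<ominus> c \<otimes> b \<in> P"
  using assms coset_eq_iff[of "a \<otimes> e" "c \<otimes> b"]
  by (subst domain.fraction_eq_iff[OF domain_quotient])
    (simp_all add: coset_closed coset_eq_zero_iff coset_mult)

lemma fr_eq_zero_iff:
  "\<lbrakk>a \<in> carrier R; b \<in> carrier R; b \<notin> P\<rbrakk> \<Longrightarrow> fr a b = \<zero>\<^bsub>F\<^esub> \<longleftrightarrow> a \<in> P"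
  by (simp add: domain.fraction_eq_zero_iff[OF domain_quotient] coset_nonzero coset_closed
      coset_eq_zero_iff)

lemma frE:
  assumes "x \<in> carrier F"
  obtains a b where "a \<in> carrier R" "b \<in> carrier R" "b \<notin> P" "x = fr a b"
proof -
  obtain A B where AB: "A \<in> carrier (R Quot P)" "B \<in> carrier (R Quot P) - {\<zero>\<^bsub>R Quot P\<^esub>}"
    "x = fraction (R Quot P) A B"
    using domain.FracE[OF domain_quotient assms] .
  then obtain a b where "a \<in> carrier R" "A = P +> a" "b \<in> carrier R" "B = P +> b"
    by (metis cosetE DiffD1)
  then show thesis using that AB by (auto simp: coset_eq_zero_iff)
qed

lemma fr_closed: "\<lbrakk>a \<in> carrier R; b \<in> carrier R; b \<notin> P\<rbrakk> \<Longrightarrow> fr a b \<in> carrier F"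
  by (intro domain.fraction_closed[OF domain_quotient] coset_closed coset_nonzero)

lemma mult_notin: "\<lbrakk>a \<in> carrier R; b \<in> carrier R; a \<notin> P; b \<notin> P\<rbrakk> \<Longrightarrow> a \<otimes> b \<notin> P"
  using P.I_prime by blast

lemma pow_notin: "\<lbrakk>b \<in> carrier R; b \<notin> P\<rbrakk> \<Longrightarrow> b [^] (n::nat) \<notin> P"
  using prime_pow_mem[OF P.primeideal] by blast

lemma fr_mult:
  assumes "a \<in> carrier R" "b \<in> carrier R" "b \<notin> P" "c \<in> carrier R" "e \<in> carrier R" "e \<notin> P"
  shows "fr a b \<otimes>\<^bsub>F\<^esub> fr c e = fr (a \<otimes> c) (b \<otimes> e)"
  using assms
  by (subst domain.fraction_mult[OF domain_quotient])
    (simp_all add: coset_closed coset_eq_zero_iff coset_mult)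

lemma fr_add:
  assumes "a \<in> carrier R" "b \<in> carrier R" "b \<notin> P" "c \<in> carrier R" "e \<in> carrier R" "e \<notin> P"
  shows "fr a b \<oplus>\<^bsub>F\<^esub> fr c e = fr (a \<otimes> e \<oplus> c \<otimes> b) (b \<otimes> e)"
  using assms
  by (subst domain.fraction_add[OF domain_quotient])
    (simp_all add: coset_closed coset_eq_zero_iff coset_mult coset_add)

lemma scalar_eq_fr: "scalar_in_Frac R P c = fr (c \<odot> \<one>) \<one>"
  by (simp add: scalar_in_Frac_def coset_one)

lemma scalar_Frac_hom: "scalar_in_Frac R P \<in> ring_hom K F"
proof (rule ring_hom_memI)
  show "scalar_in_Frac R P c \<in> carrier F" if "c \<in> carrier K" for c
    using that by (simp add: scalar_eq_fr fr_closed one_notin)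
  show "scalar_in_Frac R P (c \<otimes>\<^bsub>K\<^esub> c') = scalar_in_Frac R P c \<otimes>\<^bsub>F\<^esub> scalar_in_Frac R P c'"
    if "c \<in> carrier K" "c' \<in> carrier K" for c c'
    using that sc.hom_mult[of c c'] by (simp add: scalar_eq_fr fr_mult one_notin)
  show "scalar_in_Frac R P (c \<oplus>\<^bsub>K\<^esub> c') = scalar_in_Frac R P c \<oplus>\<^bsub>F\<^esub> scalar_in_Frac R P c'"
    if "c \<in> carrier K" "c' \<in> carrier K" for c c'
    using that sc.hom_add[of c c'] by (simp add: scalar_eq_fr fr_add one_notin)
  show "scalar_in_Frac R P \<one>\<^bsub>K\<^esub> = \<one>\<^bsub>F\<^esub>"
    by (simp add: scalar_eq_fr domain.Frac_one[OF domain_quotient] coset_one)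
qed

sublocale Fsc: ring_hom_cring K F "scalar_in_Frac R P"
  by (intro ring_hom_cring.intro ring_hom_cring_axioms.intro K.is_cring scalar_Frac_hom
      fieldE(1) field_F)

text \<open>The reversal is due to opposite conventions: \<open>eval\<close> reads the leading
  coefficient first, \<open>horner\<close> the constant one.\<close>

lemma eval_eq_horner:
  assumes "set cs \<subseteq> carrier K" "x \<in> carrier F"
  shows "ring.eval F (map (scalar_in_Frac R P) (rev cs)) x = horner F (scalar_in_Frac R P) cs x"
  using assms(1)
proof (induction cs)
  case Nil
  then show ?case by (simp add: ring.eval.simps[OF Fsc.S.ring_axioms])
next
  case (Cons c cs)
  then have c: "scalar_in_Frac R P c \<in> carrier F"
    "set (map (scalar_in_Frac R P) (rev cs)) \<subseteq> carrier F" by auto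
  have "ring.eval F (map (scalar_in_Frac R P) (rev (c # cs))) x =
      ring.eval F (map (scalar_in_Frac R P) (rev cs) @ [scalar_in_Frac R P c]) x" by simp
  also have "\<dots> = ring.eval F (map (scalar_in_Frac R P) (rev cs)) x \<otimes>\<^bsub>F\<^esub> x \<oplus>\<^bsub>F\<^esub> scalar_in_Frac R P c"
    using Fsc.S.eval_append_aux[OF c(2,1) assms(2)] .
  also have "\<dots> = horner F (scalar_in_Frac R P) cs x \<otimes>\<^bsub>F\<^esub> x \<oplus>\<^bsub>F\<^esub> scalar_in_Frac R P c"
    using Cons by simp
  also have "\<dots> = horner F (scalar_in_Frac R P) (c # cs) x"
    using Cons.prems assms(2) by (simp add: Fsc.horner_closed Fsc.S.m_comm Fsc.S.a_comm)
  finally show ?case .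
qed

lemma horner_fr:
  assumes "set cs \<subseteq> carrier K" "a \<in> carrier R" "b \<in> carrier R" "b \<notin> P"
  shows "horner F (scalar_in_Frac R P) cs (fr a b) = fr (hom_eval cs a b) (b [^] length cs)"
  using assms(1)
proof (induction cs)
  case Nil
  then show ?case
    by (simp add: domain.Frac_zero[OF domain_quotient] zero_quotient coset_one)
next
  case (Cons c cs)
  let ?n = "length cs"
  have c: "c \<in> carrier K" "set cs \<subseteq> carrier K" using Cons.prems by auto
  have "horner F (scalar_in_Frac R P) (c # cs) (fr a b) =
      fr (c \<odot> \<one>) \<one> \<oplus>\<^bsub>F\<^esub> fr a b \<otimes>\<^bsub>F\<^esub> fr (hom_eval cs a b) (b [^] ?n)"
    by (simp only: horner.simps Cons.IH[OF c(2)] scalar_eq_fr)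
  also have "\<dots> = fr (c \<odot> \<one> \<otimes> (b \<otimes> b [^] ?n) \<oplus> a \<otimes> hom_eval cs a b) (b \<otimes> b [^] ?n)"
    using c assms by (simp add: fr_mult fr_add one_notin mult_notin pow_notin hom_eval_closed)
  also have "b \<otimes> b [^] ?n = b [^] Suc ?n" using assms by (simp add: m_comm)
  finally show ?case by (simp del: nat_pow_Suc)
qed

text \<open>The value of a polynomial at a/b is \<open>hom_eval cs a b\<close> over a power of b, so
  it vanishes exactly when the numerator is in \<open>P\<close>. Injectivity of the map from K to F
  carries nonzero coefficients both ways; normalisation supplies the nonzero leading coefficient of
  a polynomial.\<close>

lemma algebraic_fr_iff:
  assumes ab: "a \<in> carrier R" "b \<in> carrier R" "b \<notin> P"
  shows "(ring.algebraic F over (scalar_in_Frac R P ` carrier K)) (fr a b) \<longleftrightarrow>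
    (\<exists>cs. set cs \<subseteq> carrier K \<and> (\<exists>c\<in>set cs. c \<noteq> \<zero>\<^bsub>K\<^esub>) \<and> hom_eval cs a b \<in> P)"
    (is "?alg \<longleftrightarrow> ?rel")
proof -
  interpret F: field F by (rule field_F)
  let ?\<phi> = "scalar_in_Frac R P"
  have x: "fr a b \<in> carrier F" using ab by (rule fr_closed)
  have zero_iff: "?\<phi> c = \<zero>\<^bsub>F\<^esub> \<longleftrightarrow> c = \<zero>\<^bsub>K\<^esub>" if "c \<in> carrier K" for c
  proof
    assume *: "?\<phi> c = \<zero>\<^bsub>F\<^esub>"
    show "c = \<zero>\<^bsub>K\<^esub>"
    proof (rule ccontr)
      assume "c \<noteq> \<zero>\<^bsub>K\<^esub>"
      then have i: "inv\<^bsub>K\<^esub> c \<in> carrier K" "inv\<^bsub>K\<^esub> c \<otimes>\<^bsub>K\<^esub> c = \<one>\<^bsub>K\<^esub>"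
        using that by (simp_all add: K.field_Units)
      then have "\<one>\<^bsub>F\<^esub> = ?\<phi> (inv\<^bsub>K\<^esub> c) \<otimes>\<^bsub>F\<^esub> ?\<phi> c" using that Fsc.hom_mult[of "inv\<^bsub>K\<^esub> c" c] by simp
      also have "\<dots> = \<zero>\<^bsub>F\<^esub>" using * i by simp
      finally show False by simp
    qed
  qed simp
  have val: "Fsc.S.eval (map ?\<phi> (rev cs)) (fr a b) = \<zero>\<^bsub>F\<^esub> \<longleftrightarrow> hom_eval cs a b \<in> P"
    if "set cs \<subseteq> carrier K" for cs
    using that ab
    by (simp add: eval_eq_horner x horner_fr fr_eq_zero_iff hom_eval_closed pow_notin)
  show ?thesis
  proof
    assume ?alg
    have "subring (?\<phi> ` carrier K) F"
      by (intro ring_hom_ring.img_is_subring[OF _ K.carrier_is_subring] ring_hom_ringI2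
          K.ring_axioms Fsc.S.ring_axioms scalar_Frac_hom)
    then obtain p where p: "p \<in> carrier (univ_poly F (?\<phi> ` carrier K))" "p \<noteq> []" "Fsc.S.eval p (fr a b) = \<zero>\<^bsub>F\<^esub>"
      by (rule F.algebraicE[OF _ x \<open>?alg\<close>])
    then have "set p \<subseteq> ?\<phi> ` carrier K" "hd p \<noteq> \<zero>\<^bsub>F\<^esub>"
      by (auto simp: univ_poly_def polynomial_def)
    then have "p \<in> map ?\<phi> ` lists (carrier K)" by (auto simp flip: lists_image)
    then obtain cs where cs: "set cs \<subseteq> carrier K" "p = map ?\<phi> cs" by auto
    then have "cs \<noteq> []" "?\<phi> (hd cs) \<noteq> \<zero>\<^bsub>F\<^esub>" using p(2) \<open>hd p \<noteq> _\<close> by (auto simp: hd_map)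
    then have "hd cs \<in> set cs" "hd cs \<noteq> \<zero>\<^bsub>K\<^esub>" by auto
    then show ?rel using cs p(3) val[of "rev cs"] by (intro exI[of _ "rev cs"]) auto
  next
    assume ?rel
    then obtain cs where cs: "set cs \<subseteq> carrier K" "\<exists>c\<in>set cs. c \<noteq> \<zero>\<^bsub>K\<^esub>" "hom_eval cs a b \<in> P" by blast
    let ?p = "map ?\<phi> (rev cs)"
    have p: "set ?p \<subseteq> ?\<phi> ` carrier K" "set ?p \<subseteq> carrier F" using cs(1) by auto
    have "Fsc.S.normalize ?p \<noteq> []"
    proof
      assume "Fsc.S.normalize ?p = []"
      then have "\<forall>y\<in>set ?p. y = \<zero>\<^bsub>F\<^esub>"
        by (rule Fsc.S.normalize_eq_Nil)
      moreover obtain c where "c \<in> set cs" "c \<noteq> \<zero>\<^bsub>K\<^esub>" using cs(2) by blast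
      ultimately show False using zero_iff[of c] cs(1) by auto
    qed
    moreover have "Fsc.S.normalize ?p \<in> carrier (univ_poly F (?\<phi> ` carrier K))"
      using Fsc.S.normalize_gives_polynomial[OF p(1)] by (simp add: univ_poly_def)
    moreover have "Fsc.S.eval (Fsc.S.normalize ?p) (fr a b) = \<zero>\<^bsub>F\<^esub>"
      using Fsc.S.eval_normalize[OF p(2) x] val cs by simp
    ultimately show ?alg by (intro Fsc.S.algebraicI)
  qed
qed

end


section \<open>Constants of the fraction field\<close>

locale delta_prime_quotient = prime_quotient R K P + differential_ring R \<Delta>
  for R :: "('a, 'b, 'd) module_scheme" (structure) and K :: "('a, 'c) ring_scheme"
    and P :: "'b set" and \<Delta> :: "('b \<Rightarrow> 'b) set" +
  assumes d_smult: "\<lbrakk>d \<in> \<Delta>; c \<in> carrier K; x \<in> carrier R\<rbrakk> \<Longrightarrow> d (c \<odot> x) = c \<odot> d x"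
    and delta_P: "delta_ideal R \<Delta> P"
begin

lemma d_scalar: "\<lbrakk>d \<in> \<Delta>; c \<in> carrier K\<rbrakk> \<Longrightarrow> d (c \<odot> \<one>) = \<zero>"
  by (simp add: d_smult d_one)

lemma d_P: "\<lbrakk>d \<in> \<Delta>; x \<in> P\<rbrakk> \<Longrightarrow> d x \<in> P"
  using delta_P by (rule delta_ideal_d)

text \<open>This is the numerator in the quotient rule for a/b, so that being constant can be
  handled inside R.\<close>

definition constant_fraction :: "'b \<Rightarrow> 'b \<Rightarrow> bool" where
  "constant_fraction a b \<longleftrightarrow> (\<forall>d\<in>\<Delta>. d a \<otimes> b \<ominus> a \<otimes> d b \<in> P)"

lemma quotient_derivation_coset:
  assumes "d \<in> \<Delta>" "a \<in> carrier R"
  shows "quotient_derivation R P d (P +> a) = P +> d a"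
proof -
  have "P +> d x = P +> d a" if "x \<in> P +> a" for x
  proof -
    from that obtain p where p: "p \<in> P" "x = p \<oplus> a" by (auto simp: a_r_coset_def')
    then have pR: "p \<in> carrier R" using P.Icarr by simp
    have "d x \<ominus> d a = d p"
      using p(2) pR assms by (simp add: d_add minus_eq a_assoc r_neg)
    then have "d x \<ominus> d a \<in> P" using d_P[OF assms(1) p(1)] by simp
    then show ?thesis using assms p(2) pR by (subst coset_eq_iff) auto
  qed
  then have "\<forall>x\<in>P +> a. P +> d x = P +> d a" by blast
  with P.a_rcos_self[OF assms(2)] show ?thesis
    unfolding quotient_derivation_def by (rule UN_constant_eq)
qed

text \<open>Differentiating a b' = a' b modulo \<open>P\<close> relates the two numerators. In the
  identity \<open>id\<close>, where u, v, u', v' stand for the derivatives of a, b, a', b', the new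
  numerator appears multiplied by b^2, which is cancelled because b is outside the prime
  \<open>P\<close>.\<close>

lemma constant_fraction_cong:
  assumes "a \<in> carrier R" "b \<in> carrier R" "b \<notin> P" "a' \<in> carrier R" "b' \<in> carrier R"
    and eq: "a \<otimes> b' \<ominus> a' \<otimes> b \<in> P" and const: "constant_fraction a b"
  shows "constant_fraction a' b'"
  unfolding constant_fraction_def
proof
  fix d assume d: "d \<in> \<Delta>"
  have id: "(u' \<otimes> b' \<ominus> a' \<otimes> v') \<otimes> (b \<otimes> b) = (u \<otimes> b \<ominus> a \<otimes> v) \<otimes> (b' \<otimes> b') \<ominus>
      ((u \<otimes> b' \<oplus> a \<otimes> v') \<ominus> (u' \<otimes> b \<oplus> a' \<otimes> v)) \<otimes> (b \<otimes> b') \<oplus>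
      (v \<otimes> b' \<oplus> v' \<otimes> b) \<otimes> (a \<otimes> b' \<ominus> a' \<otimes> b)"
    if "u \<in> carrier R" "v \<in> carrier R" "u' \<in> carrier R" "v' \<in> carrier R" for u v u' v'
    using that assms(1,2,4,5) by algebra
  have R: "d a \<in> carrier R" "d b \<in> carrier R" "d a' \<in> carrier R" "d b' \<in> carrier R"
    using d assms by simp_all
  have "d (a \<otimes> b' \<ominus> a' \<otimes> b) \<in> P" using d_P[OF d eq] .
  then have "(d a \<otimes> b' \<oplus> a \<otimes> d b') \<ominus> (d a' \<otimes> b \<oplus> a' \<otimes> d b) \<in> P"
    using d assms by (simp add: d_diff d_mult)
  then have 1: "((d a \<otimes> b' \<oplus> a \<otimes> d b') \<ominus> (d a' \<otimes> b \<oplus> a' \<otimes> d b)) \<otimes> (b \<otimes> b') \<in> P"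
    using assms by (intro P.I_r_closed) auto
  have "d a \<otimes> b \<ominus> a \<otimes> d b \<in> P" using const d by (simp add: constant_fraction_def)
  then have 2: "(d a \<otimes> b \<ominus> a \<otimes> d b) \<otimes> (b' \<otimes> b') \<in> P" using assms by (intro P.I_r_closed) auto
  have 3: "(d b \<otimes> b' \<oplus> d b' \<otimes> b) \<otimes> (a \<otimes> b' \<ominus> a' \<otimes> b) \<in> P"
    using assms R by (intro P.I_l_closed[OF eq]) auto
  have "(d a' \<otimes> b' \<ominus> a' \<otimes> d b') \<otimes> (b \<otimes> b) \<in> P"
    unfolding id[OF R] using 1 2 3 by (simp add: minus_eq)
  then show "d a' \<otimes> b' \<ominus> a' \<otimes> d b' \<in> P"
    using P.I_prime[of "d a' \<otimes> b' \<ominus> a' \<otimes> d b'" "b \<otimes> b"] mult_notin[of b b] assms R by auto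
qed

lemma Frac_constants_fr_iff:
  assumes ab: "a \<in> carrier R" "b \<in> carrier R" "b \<notin> P"
  shows "fr a b \<in> Frac_constants R \<Delta> P \<longleftrightarrow> constant_fraction a b"
proof -
  interpret D: "domain" "R Quot P" by (rule domain_quotient)
  let ?q = "quotient_derivation R P"
  let ?G = "\<lambda>d A B. fraction (R Quot P) (?q d A \<otimes>\<^bsub>R Quot P\<^esub> B \<ominus>\<^bsub>R Quot P\<^esub> A \<otimes>\<^bsub>R Quot P\<^esub> ?q d B)
    (B \<otimes>\<^bsub>R Quot P\<^esub> B)"
  have G: "?G d (P +> x) (P +> y) = fr (d x \<otimes> y \<ominus> x \<otimes> d y) (y \<otimes> y)"
    if "d \<in> \<Delta>" "x \<in> carrier R" "y \<in> carrier R" for d x y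
    using that by (simp add: quotient_derivation_coset coset_mult coset_diff)
  \<comment> \<open>The disjunction supplies what is needed to evaluate the union over
    representatives. If a/b is constant, every representative contributes the zero class. If the
    union is the zero class, the contribution of the pair (a, b) is contained in it, and one common
    member already puts the numerator into \<open>P\<close>.\<close>
  have "fraction_derivation (R Quot P) (?q d) (fr a b) = \<zero>\<^bsub>F\<^esub> \<longleftrightarrow> d a \<otimes> b \<ominus> a \<otimes> d b \<in> P"
    if d: "d \<in> \<Delta>" "constant_fraction a b \<or> fraction_derivation (R Quot P) (?q d) (fr a b) = \<zero>\<^bsub>F\<^esub>" for d
    using d(2)
  proof
    assume const: "constant_fraction a b"
    have "(\<Union>(A, B)\<in>fr a b. ?G d A B) = \<zero>\<^bsub>F\<^esub>"
    proof (rule D.UN_fraction)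
      show "P +> a \<in> carrier (R Quot P)" using ab by (rule_tac coset_closed)
      show "P +> b \<in> carrier (R Quot P) - {\<zero>\<^bsub>R Quot P\<^esub>}" using ab by (rule_tac coset_nonzero)
      fix A B assume AB: "A \<in> carrier (R Quot P)" "B \<in> carrier (R Quot P) - {\<zero>\<^bsub>R Quot P\<^esub>}"
        "(P +> a) \<otimes>\<^bsub>R Quot P\<^esub> B = A \<otimes>\<^bsub>R Quot P\<^esub> (P +> b)"
      obtain x where x: "x \<in> carrier R" "A = P +> x" using AB(1) by (rule cosetE)
      obtain y where y: "y \<in> carrier R" "B = P +> y" using AB(2) by (auto elim: cosetE)
      have yP: "y \<notin> P" using AB(2) y by (simp add: coset_eq_zero_iff)
      have "a \<otimes> y \<ominus> x \<otimes> b \<in> P"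
        using AB(3) x y ab by (simp add: coset_mult coset_eq_iff)
      then have "d x \<otimes> y \<ominus> x \<otimes> d y \<in> P"
        using constant_fraction_cong[OF ab x(1) y(1) _ const] d(1) by (simp add: constant_fraction_def)
      then show "?G d A B = \<zero>\<^bsub>F\<^esub>"
        unfolding x(2) y(2) G[OF d(1) x(1) y(1)] using x(1) y(1) yP d(1)
        by (subst fr_eq_zero_iff) (auto simp: mult_notin)
    qed
    then show ?thesis using const d(1) by (simp add: fraction_derivation_def constant_fraction_def)
  next
    assume *: "fraction_derivation (R Quot P) (?q d) (fr a b) = \<zero>\<^bsub>F\<^esub>"
    let ?N = "d a \<otimes> b \<ominus> a \<otimes> d b"
    have N: "?N \<in> carrier R" using ab d(1) by simp
    have bb: "P +> (b \<otimes> b) \<in> carrier (R Quot P) - {\<zero>\<^bsub>R Quot P\<^esub>}"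
      using ab by (intro coset_nonzero mult_notin) auto
    have "(P +> a, P +> b) \<in> fr a b"
      unfolding D.mem_fraction_iff using coset_closed coset_nonzero ab by auto
    then have "?G d (P +> a) (P +> b) \<subseteq> \<zero>\<^bsub>F\<^esub>"
      using * unfolding fraction_derivation_def by blast
    then have "fr ?N (b \<otimes> b) \<subseteq> \<zero>\<^bsub>F\<^esub>" using G d(1) ab by simp
    moreover have "(P +> ?N, P +> (b \<otimes> b)) \<in> fr ?N (b \<otimes> b)"
      unfolding D.mem_fraction_iff using coset_closed[OF N] bb by auto
    ultimately have "(P +> ?N, P +> (b \<otimes> b)) \<in> fraction (R Quot P) \<zero>\<^bsub>R Quot P\<^esub> \<one>\<^bsub>R Quot P\<^esub>"
      unfolding D.Frac_zero by blast
    then have "\<zero>\<^bsub>R Quot P\<^esub> = P +> ?N"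
      unfolding D.mem_fraction_iff by auto
    then have "?N \<in> P" using coset_eq_zero_iff[OF N] by simp
    then show ?thesis using * by simp
  qed
  then show ?thesis
    using fr_closed[OF ab] unfolding Frac_constants_def constant_fraction_def by blast
qed

lemma constant_fraction_inverse:
  assumes "a \<in> carrier R" "b \<in> carrier R" "constant_fraction a b"
  shows "constant_fraction b a"
  unfolding constant_fraction_def
proof
  fix d assume d: "d \<in> \<Delta>"
  have "\<ominus> (d a \<otimes> b \<ominus> a \<otimes> d b) \<in> P"
    using assms(3) d by (simp add: constant_fraction_def)
  also have "\<ominus> (d a \<otimes> b \<ominus> a \<otimes> d b) = d b \<otimes> a \<ominus> b \<otimes> d a"
    using assms(1,2) d by (simp add: minus_eq minus_add m_comm a_comm)
  finally show "d b \<otimes> a \<ominus> b \<otimes> d a \<in> P" .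
qed

text \<open>Derivations kill the scalars, so a polynomial over K takes constants to constants. This
  makes the value of a polynomial, and by \<open>constant_fraction_inverse\<close> also its
  reciprocal, accessible to \<open>constant_fraction_denominator\<close>.\<close>

lemma constant_fraction_hom_eval:
  assumes ab: "a \<in> carrier R" "b \<in> carrier R" "constant_fraction a b"
    and cs: "set cs \<subseteq> carrier K"
  shows "constant_fraction (hom_eval cs a b) (b [^] length cs)"
  using cs
proof (induction cs)
  case Nil
  then show ?case by (simp add: constant_fraction_def d_zero d_one minus_eq)
next
  case (Cons c cs)
  show ?case
    unfolding constant_fraction_def
  proof
    fix d assume d: "d \<in> \<Delta>"
    let ?B = "b [^] length cs" and ?h = "hom_eval cs a b" and ?c = "c \<odot> \<one>"
    have c: "?c \<in> carrier R" "?B \<in> carrier R" "?h \<in> carrier R" "d ?h \<in> carrier R" "d ?B \<in> carrier R"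
      "d a \<in> carrier R" "d b \<in> carrier R"
      using ab Cons.prems d by (simp_all add: hom_eval_closed)
    have id: "(C \<otimes> (y \<otimes> b \<oplus> B \<otimes> v) \<oplus> (u \<otimes> h \<oplus> a \<otimes> w)) \<otimes> (B \<otimes> b) \<ominus>
        (C \<otimes> (B \<otimes> b) \<oplus> a \<otimes> h) \<otimes> (y \<otimes> b \<oplus> B \<otimes> v) =
        (h \<otimes> B) \<otimes> (u \<otimes> b \<ominus> a \<otimes> v) \<oplus> (a \<otimes> b) \<otimes> (w \<otimes> B \<ominus> h \<otimes> y)"
      if "C \<in> carrier R" "B \<in> carrier R" "h \<in> carrier R" "w \<in> carrier R" "y \<in> carrier R"
        "u \<in> carrier R" "v \<in> carrier R" for C B h w y u v
      using that ab(1,2) by algebra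
    have "d a \<otimes> b \<ominus> a \<otimes> d b \<in> P" "d ?h \<otimes> ?B \<ominus> ?h \<otimes> d ?B \<in> P"
      using ab(3) Cons d by (simp_all add: constant_fraction_def)
    then have "(?h \<otimes> ?B) \<otimes> (d a \<otimes> b \<ominus> a \<otimes> d b) \<oplus> (a \<otimes> b) \<otimes> (d ?h \<otimes> ?B \<ominus> ?h \<otimes> d ?B) \<in> P"
      using c ab by (simp add: P.I_l_closed)
    then have "(?c \<otimes> (d ?B \<otimes> b \<oplus> ?B \<otimes> d b) \<oplus> (d a \<otimes> ?h \<oplus> a \<otimes> d ?h)) \<otimes> (?B \<otimes> b) \<ominus>
        (?c \<otimes> (?B \<otimes> b) \<oplus> a \<otimes> ?h) \<otimes> (d ?B \<otimes> b \<oplus> ?B \<otimes> d b) \<in> P"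
      using id[OF c] by simp
    moreover have "d (?c \<otimes> (?B \<otimes> b) \<oplus> a \<otimes> ?h) =
        ?c \<otimes> (d ?B \<otimes> b \<oplus> ?B \<otimes> d b) \<oplus> (d a \<otimes> ?h \<oplus> a \<otimes> d ?h)"
      using c ab Cons.prems d by (simp add: d_add d_mult d_scalar)
    ultimately show "d (hom_eval (c # cs) a b) \<otimes> b [^] length (c # cs) \<ominus>
        hom_eval (c # cs) a b \<otimes> d (b [^] length (c # cs)) \<in> P"
      using c ab d by (simp add: d_mult)
  qed
qed

text \<open>The denominators of a constant form a differential ideal.\<close>

lemma constant_fraction_denominator:
  assumes M: "ideal M R" and core: "P = delta_core R \<Delta> M"
    and ab: "a \<in> carrier R" "b \<in> carrier R" "b \<notin> P" "constant_fraction a b"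
  shows "\<exists>s\<in>carrier R - M. \<exists>r\<in>carrier R. s \<otimes> a \<ominus> r \<otimes> b \<in> P"
proof (rule ccontr)
  assume none: "\<not> ?thesis"
  define I where "I = {s \<in> carrier R. \<exists>r\<in>carrier R. s \<otimes> a \<ominus> r \<otimes> b \<in> P}"
  have I_I: "s \<in> I" if "s \<in> carrier R" "r \<in> carrier R" "s \<otimes> a \<ominus> r \<otimes> b \<in> P" for s r
    using that unfolding I_def by blast
  have "b \<otimes> a \<ominus> a \<otimes> b = \<zero>" using ab(1,2) by algebra
  then have "b \<otimes> a \<ominus> a \<otimes> b \<in> P" using P.zero_closed by (simp only:)
  then have "b \<in> I" by (rule I_I[OF ab(2,1)])
  have "delta_ideal R \<Delta> I"
    unfolding delta_ideal_def
  proof (intro conjI ballI image_subsetI)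
    show "ideal I R"
    proof (rule idealI[OF ring_axioms])
      have mult: "x \<otimes> s \<in> I" if s: "s \<in> I" and x: "x \<in> carrier R" for s x
      proof -
        obtain r where r: "s \<in> carrier R" "r \<in> carrier R" "s \<otimes> a \<ominus> r \<otimes> b \<in> P"
          using s by (auto simp: I_def)
        have "x \<otimes> (s \<otimes> a \<ominus> r \<otimes> b) \<in> P" using r(3) x by (rule P.I_l_closed)
        also have "x \<otimes> (s \<otimes> a \<ominus> r \<otimes> b) = (x \<otimes> s) \<otimes> a \<ominus> (x \<otimes> r) \<otimes> b"
          using r(1,2) x ab(1,2) by algebra
        finally show ?thesis using r(1,2) x by (intro I_I) simp_all
      qed
      have sub: "s \<in> carrier R" if "s \<in> I" for s using that by (simp add: I_def)
      show "x \<otimes> s \<in> I" "s \<otimes> x \<in> I" if "s \<in> I" "x \<in> carrier R" for s x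
        using mult[OF that] m_comm[OF that(2) sub[OF that(1)]] by simp_all
      show "subgroup I (add_monoid R)"
      proof (rule add.subgroupI)
        show "I \<subseteq> carrier R" using sub by blast
        show "I \<noteq> {}" using \<open>b \<in> I\<close> by blast
        show "\<ominus> s \<in> I" if "s \<in> I" for s
          using mult[OF that, of "\<ominus> \<one>"] sub[OF that] by (simp add: l_minus)
        fix s t assume st: "s \<in> I" "t \<in> I"
        then obtain p q where pq: "p \<in> carrier R" "s \<otimes> a \<ominus> p \<otimes> b \<in> P"
          "q \<in> carrier R" "t \<otimes> a \<ominus> q \<otimes> b \<in> P" by (auto simp: I_def)
        have "(s \<otimes> a \<ominus> p \<otimes> b) \<oplus> (t \<otimes> a \<ominus> q \<otimes> b) \<in> P" using pq by simp
        also have "(s \<otimes> a \<ominus> p \<otimes> b) \<oplus> (t \<otimes> a \<ominus> q \<otimes> b) = (s \<oplus> t) \<otimes> a \<ominus> (p \<oplus> q) \<otimes> b"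
          using pq(1,3) sub[OF st(1)] sub[OF st(2)] ab(1,2) by algebra
        finally show "s \<oplus> t \<in> I"
          using pq(1,3) sub[OF st(1)] sub[OF st(2)] by (intro I_I[of "s \<oplus> t" "p \<oplus> q"]) simp_all
      qed
    qed
    fix d s assume d: "d \<in> \<Delta>" and "s \<in> I"
    then obtain r where r: "s \<in> carrier R" "r \<in> carrier R" "s \<otimes> a \<ominus> r \<otimes> b \<in> P"
      by (auto simp: I_def)
    \<comment> \<open>Differentiating s (a/b) = r with a/b constant gives (d s)(a/b) = d r, so
      \<open>d r\<close> is the numerator that shows \<open>d s\<close> to be a denominator. The
      identity is this computation multiplied by b.\<close>
    have id: "(s' \<otimes> a \<ominus> r' \<otimes> b) \<otimes> b = ((s' \<otimes> a \<oplus> s \<otimes> u) \<ominus> (r' \<otimes> b \<oplus> r \<otimes> v)) \<otimes> b \<ominus>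
        s \<otimes> (u \<otimes> b \<ominus> a \<otimes> v) \<ominus> v \<otimes> (s \<otimes> a \<ominus> r \<otimes> b)"
      if "s' \<in> carrier R" "r' \<in> carrier R" "u \<in> carrier R" "v \<in> carrier R" for s' r' u v
      using that r(1,2) ab(1,2) by algebra
    have c: "d s \<in> carrier R" "d r \<in> carrier R" "d a \<in> carrier R" "d b \<in> carrier R"
      using d r ab by simp_all
    have "d (s \<otimes> a \<ominus> r \<otimes> b) \<in> P" using d_P[OF d r(3)] .
    then have "(d s \<otimes> a \<oplus> s \<otimes> d a) \<ominus> (d r \<otimes> b \<oplus> r \<otimes> d b) \<in> P"
      using d r(1,2) ab by (simp add: d_diff d_mult)
    then have 1: "((d s \<otimes> a \<oplus> s \<otimes> d a) \<ominus> (d r \<otimes> b \<oplus> r \<otimes> d b)) \<otimes> b \<in> P"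
      using ab(2) by (rule P.I_r_closed)
    have "d a \<otimes> b \<ominus> a \<otimes> d b \<in> P" using ab(4) d by (simp add: constant_fraction_def)
    then have 2: "s \<otimes> (d a \<otimes> b \<ominus> a \<otimes> d b) \<in> P" using r(1) by (rule P.I_l_closed)
    have 3: "d b \<otimes> (s \<otimes> a \<ominus> r \<otimes> b) \<in> P" using r(3) c(4) by (rule P.I_l_closed)
    have "(d s \<otimes> a \<ominus> d r \<otimes> b) \<otimes> b \<in> P"
      unfolding id[OF c] using 1 2 3 by (simp add: minus_eq)
    then have "d s \<otimes> a \<ominus> d r \<otimes> b \<in> P"
      using P.I_prime[of "d s \<otimes> a \<ominus> d r \<otimes> b" b] c ab by auto
    then show "d s \<in> I" by (rule I_I[OF c(1,2)])
  qed
  moreover have "I \<subseteq> M" using none by (auto simp: I_def)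
  ultimately have "I \<subseteq> P" unfolding core by (rule delta_core_greatest(3)[OF M])
  then show False using ab(3) \<open>b \<in> I\<close> by blast
qed

end


section \<open>Prime ideals avoiding a multiplicative set\<close>

context cring
begin

lemma in_ideal_or_generates:
  fixes x s :: 'a
  assumes M: "ideal M R" and x: "x \<in> carrier R" and s: "s \<in> M <+> PIdl x"
  shows "\<exists>r\<in>carrier R. x \<otimes> r \<ominus> s \<in> M"
proof -
  interpret M: ideal M R by fact
  from s obtain m r where m: "m \<in> M" and r: "r \<in> carrier R" and "s = m \<oplus> r \<otimes> x"
    by (auto simp: set_add_def' cgenideal_def)
  then have "x \<otimes> r \<ominus> s = \<ominus> m"
    using x M.Icarr[OF m] by (simp add: minus_eq minus_add a_ac m_comm[of r x] r_neg1 r_neg)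
  then show ?thesis using r m by (intro bexI[of _ r]) simp_all
qed

lemma diff_add_cancel: "\<lbrakk>x \<in> carrier R; y \<in> carrier R\<rbrakk> \<Longrightarrow> (x \<ominus> y) \<oplus> y = x"
  by (simp add: minus_eq a_assoc l_neg)

lemma maximalideal_inverse:
  fixes x :: 'a
  assumes "maximalideal M R" "x \<in> carrier R" "x \<notin> M"
  shows "\<exists>t\<in>carrier R. x \<otimes> t \<ominus> \<one> \<in> M"
proof -
  interpret M: maximalideal M R by fact
  let ?L = "(M <+> PIdl x) :: 'a set"
  have pI: "ideal (PIdl x) R" using assms(2) by (rule cgenideal_ideal)
  have L: "ideal ?L R" using M.is_ideal pI by (rule add_ideals)
  have sub: "M \<subseteq> ?L" "PIdl x \<subseteq> ?L" using subset_set_add[OF M.is_ideal pI] by auto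
  have "x \<in> ?L" using sub(2) cgenideal_self[OF assms(2)] by blast
  moreover have "?L \<subseteq> carrier R" using ideal.Icarr[OF L] by blast
  ultimately have "?L = carrier R" using M.I_maximal[OF L sub(1)] assms(3) by blast
  then show ?thesis by (intro in_ideal_or_generates M.is_ideal assms(2)) simp
qed

text \<open>If \<open>M\<close> is maximal among the ideals containing \<open>P\<close> and avoiding
  \<open>S\<close>, then M + (x) meets \<open>S\<close> for each x outside \<open>M\<close>. This
  yields the last conclusion, the form in which \<open>algebraic_mod_if_small\<close> takes
  denominators, and also primeness: a p = s and b q = t modulo \<open>M\<close> with ab in
  \<open>M\<close> would put s t into \<open>M\<close>.\<close>

lemma ex_prime_avoiding:
  assumes noeth: "noetherian_ring R" and P: "ideal P R"
    and S: "S \<subseteq> carrier R" "\<one> \<in> S" "\<And>s t. \<lbrakk>s \<in> S; t \<in> S\<rbrakk> \<Longrightarrow> s \<otimes> t \<in> S" "S \<inter> P = {}"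
  shows "\<exists>M. primeideal M R \<and> P \<subseteq> M \<and> S \<inter> M = {} \<and>
    (\<forall>x\<in>carrier R - M. \<exists>r\<in>carrier R. \<exists>s\<in>S. x \<otimes> r \<ominus> s \<in> M)"
proof -
  define \<B> where "\<B> = {I. ideal I R \<and> P \<subseteq> I \<and> S \<inter> I = {}}"
  have "P \<in> \<B>" using P S(4) by (simp add: \<B>_def)
  have "\<exists>M\<in>\<B>. \<forall>J\<in>\<B>. M \<subseteq> J \<longrightarrow> J = M"
  proof (rule subset_Zorn)
    fix C assume C: "subset.chain \<B> C"
    show "\<exists>U\<in>\<B>. \<forall>J\<in>C. J \<subseteq> U"
    proof (cases "C = {}")
      case False
      have "subset.chain {I. ideal I R} C"
        using C by (auto simp: subset_chain_def \<B>_def)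
      then have "\<Union>C \<in> C" using noetherian_ring.ideal_chain_is_trivial[OF noeth False] by blast
      then show ?thesis using C by (intro bexI[of _ "\<Union>C"]) (auto simp: subset_chain_def)
    qed (use \<open>P \<in> \<B>\<close> in blast)
  qed
  then obtain M where M: "M \<in> \<B>" and max: "\<And>J. \<lbrakk>J \<in> \<B>; M \<subseteq> J\<rbrakk> \<Longrightarrow> J = M" by blast
  interpret M: ideal M R using M by (simp add: \<B>_def)
  have PM: "P \<subseteq> M" and SM: "S \<inter> M = {}" using M by (auto simp: \<B>_def)
  have inv: "\<exists>r\<in>carrier R. \<exists>s\<in>S. x \<otimes> r \<ominus> s \<in> M" if x: "x \<in> carrier R" "x \<notin> M" for x
  proof -
    let ?L = "(M <+> PIdl x) :: 'a set"
    have pI: "ideal (PIdl x) R" using x(1) by (rule cgenideal_ideal)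
    have L: "ideal ?L R" using M.is_ideal pI by (rule add_ideals)
    have sub: "M \<subseteq> ?L" "PIdl x \<subseteq> ?L" using subset_set_add[OF M.is_ideal pI] by auto
    have "x \<in> ?L" using sub(2) cgenideal_self[OF x(1)] by blast
    then have "?L \<notin> \<B>" using max[of ?L] sub(1) x(2) by blast
    then obtain s where "s \<in> S" "s \<in> ?L" using L PM sub(1) by (auto simp: \<B>_def)
    then show ?thesis using in_ideal_or_generates[OF M.is_ideal x(1)] by blast
  qed
  have "primeideal M R"
  proof (rule primeidealI[OF M.is_ideal is_cring])
    show "carrier R \<noteq> M" using S(2) SM by auto
    fix a b assume ab: "a \<in> carrier R" "b \<in> carrier R" "a \<otimes> b \<in> M"
    show "a \<in> M \<or> b \<in> M"
    proof (rule ccontr)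
      assume "\<not> (a \<in> M \<or> b \<in> M)"
      then obtain p s q t where p: "p \<in> carrier R" "s \<in> S" "a \<otimes> p \<ominus> s \<in> M"
        and q: "q \<in> carrier R" "t \<in> S" "b \<otimes> q \<ominus> t \<in> M"
        using inv[OF ab(1)] inv[OF ab(2)] by blast
      have sc: "s \<in> carrier R" "t \<in> carrier R" using p(2) q(2) S(1) by auto
      have "(a \<otimes> b) \<otimes> (p \<otimes> q) \<in> M" "(a \<otimes> p) \<otimes> (b \<otimes> q \<ominus> t) \<in> M" "(a \<otimes> p \<ominus> s) \<otimes> t \<in> M"
        using M.I_r_closed[OF ab(3), of "p \<otimes> q"] M.I_l_closed[OF q(3), of "a \<otimes> p"]
          M.I_r_closed[OF p(3) sc(2)] p(1) q(1) ab(1) by simp_all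
      then have "(a \<otimes> b) \<otimes> (p \<otimes> q) \<ominus> (a \<otimes> p) \<otimes> (b \<otimes> q \<ominus> t) \<ominus> (a \<otimes> p \<ominus> s) \<otimes> t \<in> M"
        by (simp add: minus_eq)
      also have "(a \<otimes> b) \<otimes> (p \<otimes> q) \<ominus> (a \<otimes> p) \<otimes> (b \<otimes> q \<ominus> t) \<ominus> (a \<otimes> p \<ominus> s) \<otimes> t = s \<otimes> t"
        using p(1) q(1) ab(1,2) sc by algebra
      finally show False using S(3)[OF p(2) q(2)] SM by blast
    qed
  qed
  then show ?thesis using PM SM inv by blast
qed

end


section \<open>Proof of the equivalence\<close>

context field_algebra
begin

text \<open>A domain algebraic over a field is a field: a polynomial relation with nonzero constant
  coefficient, read as \<open>hom_eval\<close> with denominator 1, gives the inverse.\<close>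

lemma maximalideal_if_algebraic:
  assumes P: "primeideal P R" and alg: "\<And>e. e \<in> carrier R \<Longrightarrow> algebraic_mod P e"
  shows "maximalideal P R"
proof (rule maximalideal_if_inverses[OF P])
  interpret P: primeideal P R by fact
  fix e assume e: "e \<in> carrier R" "e \<notin> P"
  obtain p where p: "set p \<subseteq> carrier K" "\<exists>c\<in>set p. c \<noteq> \<zero>\<^bsub>K\<^esub>" "horner R (\<lambda>c. c \<odot> \<one>) p e \<in> P"
    using alg[OF e(1)] by (auto simp: algebraic_mod_def)
  have 0: "e \<ominus> e \<otimes> \<one> \<in> P" using e by (simp add: minus_eq r_neg)
  have "hom_eval p e \<one> \<ominus> \<one> [^] length p \<otimes> horner R (\<lambda>c. c \<odot> \<one>) p e \<in> P"
    using hom_eval_cong_horner[OF P.is_ideal e(1) e(1) one_closed 0 p(1)] .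
  moreover have "\<one> [^] length p \<otimes> horner R (\<lambda>c. c \<odot> \<one>) p e \<in> P"
    using p(3) by (intro P.I_l_closed) simp_all
  ultimately have "(hom_eval p e \<one> \<ominus> \<one> [^] length p \<otimes> horner R (\<lambda>c. c \<odot> \<one>) p e) \<oplus>
      \<one> [^] length p \<otimes> horner R (\<lambda>c. c \<odot> \<one>) p e \<in> P" by (rule P.a_closed)
  then have "hom_eval p e \<one> \<in> P"
    using e(1) p(1) by (simp add: hom_eval_closed sc.horner_closed diff_add_cancel)
  from hom_eval_mem_prime[OF P e(1) one_closed e(2) p(1,2) this]
  show "\<exists>t\<in>carrier R. \<one> \<ominus> e \<otimes> t \<in> P" by simp
qed

text \<open>Lists of terms instead of sets of vectors, since the Wronskians that replace the vectors
  may coincide or vanish.\<close>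

primrec lin_comb :: "('a \<times> 'b) list \<Rightarrow> 'b" where
  "lin_comb [] = \<zero>"
| "lin_comb (x # xs) = fst x \<odot> snd x \<oplus> lin_comb xs"

lemma lin_comb_closed: "set xs \<subseteq> carrier K \<times> carrier R \<Longrightarrow> lin_comb xs \<in> carrier R"
  by (induction xs) auto

lemma lin_comb_map:
  assumes "\<And>x. x \<in> carrier R \<Longrightarrow> g x \<in> carrier R" "g \<zero> = \<zero>"
    and "\<And>x y. \<lbrakk>x \<in> carrier R; y \<in> carrier R\<rbrakk> \<Longrightarrow> g (x \<oplus> y) = g x \<oplus> g y"
    and "\<And>c x. \<lbrakk>c \<in> carrier K; x \<in> carrier R\<rbrakk> \<Longrightarrow> g (c \<odot> x) = c \<odot> g x"
    and "set xs \<subseteq> carrier K \<times> carrier R"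
  shows "lin_comb (map (\<lambda>x. (fst x, g (snd x))) xs) = g (lin_comb xs)"
  using assms(5)
proof (induction xs)
  case (Cons x xs)
  then show ?case using assms by (cases x) (simp add: lin_comb_closed)
qed (simp add: assms(2))

lemma lincomb_eq_lin_comb:
  assumes "distinct vs" "set vs \<subseteq> carrier R" "a \<in> set vs \<rightarrow> carrier K"
  shows "alg.lincomb a (set vs) = lin_comb (map (\<lambda>v. (a v, v)) vs)"
  using assms
proof (induction vs)
  case Nil
  then show ?case by (simp add: alg.lincomb_def)
next
  case (Cons v vs)
  then have "alg.lincomb a (set (v # vs)) = a v \<odot> v \<oplus> (\<Oplus>u\<in>set vs. a u \<odot> u)"
    unfolding alg.lincomb_def by (simp only: list.set) (subst finsum_insert, auto)
  then show ?case using Cons by (simp add: alg.lincomb_def)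
qed

end

text \<open>Repeated elimination: \<open>None\<close> drops the first vector \<open>v\<close>; \<open>Some d\<close> eliminates it by taking the
  Wronskians of \<open>v\<close> with the remaining vectors.\<close>

primrec elim_word :: "('b, 'm) ring_scheme \<Rightarrow> ('b \<Rightarrow> 'b) option list \<Rightarrow> 'b list \<Rightarrow> 'b" where
  "elim_word R [] vs = hd vs"
| "elim_word R (x # xs) vs = (case x of
     None \<Rightarrow> elim_word R xs (tl vs)
   | Some d \<Rightarrow> elim_word R xs (map (\<lambda>u. hd vs \<otimes>\<^bsub>R\<^esub> d u \<ominus>\<^bsub>R\<^esub> d (hd vs) \<otimes>\<^bsub>R\<^esub> u) (tl vs)))"

context delta_prime_quotient
begin

lemma delta_rational_if_core:
  assumes K: "infinite (carrier K)"
    and B: "B \<subseteq> carrier R" "alg.span B = carrier R" "|B| <o |carrier K|"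
    and M: "maximalideal M R" and core: "P = delta_core R \<Delta> M"
  shows "delta_rational K R \<Delta> P"
  unfolding delta_rational_def
proof
  interpret M: maximalideal M R by fact
  have Mp: "primeideal M R" using M by (rule maximalideal_prime)
  interpret Mp: primeideal M R by fact
  have PM: "P \<subseteq> M" unfolding core by (rule delta_core_greatest(2)[OF M.is_ideal])
  fix x assume x: "x \<in> Frac_constants R \<Delta> P"
  then have "x \<in> carrier F" by (simp add: Frac_constants_def)
  then obtain a' b' where a'b': "a' \<in> carrier R" "b' \<in> carrier R" "b' \<notin> P" "x = fr a' b'" by (rule frE)
  then have "constant_fraction a' b'" using x by (simp add: Frac_constants_fr_iff)
  \<comment> \<open>The fraction is rewritten with a denominator outside \<open>M\<close>, so that
    it has a value in R/M.\<close>
  then obtain b a where ba: "b \<in> carrier R" "b \<notin> M" "a \<in> carrier R" "b \<otimes> a' \<ominus> a \<otimes> b' \<in> P"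
    using constant_fraction_denominator[OF M.is_ideal core a'b'(1-3)] by blast
  have bP: "b \<notin> P" using ba(2) PM by blast
  have "a' \<otimes> b \<ominus> a \<otimes> b' \<in> P" using ba a'b' by (simp add: m_comm)
  then have xab: "x = fr a b" using a'b' ba bP by (simp add: fr_eq_iff)
  then have const: "constant_fraction a b" using x ba bP by (simp add: Frac_constants_fr_iff)
  obtain u where u: "u \<in> carrier R" "b \<otimes> u \<ominus> \<one> \<in> M"
    using maximalideal_inverse[OF M ba(1,2)] by blast
  \<comment> \<open>As u inverts b modulo \<open>M\<close>, this e represents the value of a/b in
    R/M.\<close>
  define e where "e = a \<otimes> u"
  have e: "e \<in> carrier R" using ba u by (simp add: e_def)
  have "\<ominus> (a \<otimes> (b \<otimes> u \<ominus> \<one>)) \<in> M" using M.I_l_closed[OF u(2) ba(3)] by simp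
  also have "\<ominus> (a \<otimes> (b \<otimes> u \<ominus> \<one>)) = a \<ominus> e \<otimes> b"
    unfolding e_def using u(1) ba(1,3) by (simp add: minus_eq r_distr r_minus minus_add m_ac a_comm)
  finally have aeb: "a \<ominus> e \<otimes> b \<in> M" .
  have "algebraic_mod M e"
  proof (rule algebraic_mod_if_small[OF K B Mp _ _ _ _ e])
    show "{\<one>} \<subseteq> carrier R" "{\<one>} \<inter> M = {}" using M.one_imp_carrier M.I_notcarr by auto
    show "|{\<one>}| <o |carrier K|" using K by (intro finite_ordLess_infinite2) simp_all
    show "\<exists>r\<in>carrier R. \<exists>s\<in>{\<one>}. y \<otimes> r \<ominus> s \<in> M" if "y \<in> carrier R" "y \<notin> M" for y
      using maximalideal_inverse[OF M that] by simp
  qed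
  then obtain p where p: "set p \<subseteq> carrier K" "\<exists>c\<in>set p. c \<noteq> \<zero>\<^bsub>K\<^esub>" "horner R (\<lambda>c. c \<odot> \<one>) p e \<in> M"
    by (auto simp: algebraic_mod_def)
  let ?g = "hom_eval p a b" and ?B = "b [^] length p" and ?h = "horner R (\<lambda>c. c \<odot> \<one>) p e"
  have cl: "?g \<in> carrier R" "?B \<in> carrier R" "?h \<in> carrier R"
    using ba p(1) e by (simp_all add: hom_eval_closed sc.horner_closed)
  have "(?g \<ominus> ?B \<otimes> ?h) \<oplus> ?B \<otimes> ?h \<in> M"
    using hom_eval_cong_horner[OF M.is_ideal e ba(3,1) aeb p(1)] M.I_l_closed[OF p(3) cl(2)]
    by (rule M.a_closed)
  also have "(?g \<ominus> ?B \<otimes> ?h) \<oplus> ?B \<otimes> ?h = ?g" using cl by (simp add: diff_add_cancel)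
  finally have gM: "?g \<in> M" .
  \<comment> \<open>The polynomial vanishes at a/b in R/M; it must vanish in the fraction field.
    Otherwise the reciprocal of its value is a constant and has a denominator s outside
    \<open>M\<close>, so s b^n is a multiple of \<open>?g\<close> modulo \<open>P\<close> and lies
    in \<open>M\<close>, although s and b do not.\<close>
  have "?g \<in> P"
  proof (rule ccontr)
    assume gP: "?g \<notin> P"
    have "constant_fraction ?B ?g"
      by (rule constant_fraction_inverse[OF cl(1,2) constant_fraction_hom_eval[OF ba(3,1) const p(1)]])
    then obtain s r where sr: "s \<in> carrier R" "s \<notin> M" "r \<in> carrier R" "s \<otimes> ?B \<ominus> r \<otimes> ?g \<in> P"
      using constant_fraction_denominator[OF M.is_ideal core cl(2,1) gP] by blast
    have "(s \<otimes> ?B \<ominus> r \<otimes> ?g) \<oplus> r \<otimes> ?g \<in> M"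
      using sr(4) PM M.I_l_closed[OF gM sr(3)] by (intro M.a_closed) auto
    also have "(s \<otimes> ?B \<ominus> r \<otimes> ?g) \<oplus> r \<otimes> ?g = s \<otimes> ?B" using cl sr(1,3) by (simp add: diff_add_cancel)
    finally have "s \<in> M \<or> ?B \<in> M" using Mp.I_prime sr(1) cl(2) by blast
    then show False using sr(2) prime_pow_mem[OF Mp ba(1)] ba(2) by blast
  qed
  then show "(ring.algebraic F over (scalar_in_Frac R P ` carrier K)) x"
    unfolding xab using algebraic_fr_iff[OF ba(3,1) bP] p by blast
qed

text \<open>Each letter of the word shortens the combination by one term and keeps its value in
  \<open>Q\<close> and outside \<open>P\<close>. This must stop before the empty sum, which lies in
  \<open>P\<close>, and it stops at a first vector that itself lies in \<open>Q\<close> and outside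
  \<open>P\<close>.\<close>

lemma ex_elim_word:
  assumes rational: "delta_rational K R \<Delta> P"
    and Q: "primeideal Q R" "delta_ideal R \<Delta> Q" "P \<subseteq> Q"
  shows "\<lbrakk>set xs \<subseteq> carrier K \<times> carrier R; lin_comb xs \<in> Q; lin_comb xs \<notin> P\<rbrakk> \<Longrightarrow>
    \<exists>w\<in>lists (insert None (Some ` \<Delta>)). elim_word R w (map snd xs) \<in> Q - P"
proof (induction "length xs" arbitrary: xs)
  case 0
  then show ?case by simp
next
  case (Suc n)
  interpret Q: primeideal Q R by fact
  obtain c v ys where xs: "xs = (c, v) # ys" using Suc.hyps(2) by (metis length_Suc_conv surj_pair)
  have c: "c \<in> carrier K" "v \<in> carrier R" "set ys \<subseteq> carrier K \<times> carrier R" using Suc.prems(1) xs by auto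
  let ?f = "lin_comb xs" and ?g = "lin_comb ys"
  have g: "?g \<in> carrier R" using c by (simp add: lin_comb_closed)
  have f: "?f \<in> carrier R" "?f = c \<odot> v \<oplus> ?g" using c g xs by simp_all
  show ?case
  proof (cases "v \<in> P")
    case True
    \<comment> \<open>A vector in \<open>P\<close> cannot be the denominator of f/v. Dropping it
      changes f by an element of \<open>P\<close>, hence of \<open>Q\<close>.\<close>
    have cv: "c \<odot> v \<in> P" using P.I_l_closed[OF True, of "c \<odot> \<one>"] c by (simp add: alg.smult_assoc2)
    have "?g = ?f \<ominus> c \<odot> v" using f(2) c(1,2) g by (simp add: minus_eq a_ac r_neg r_neg1)
    then have "?g \<in> Q" using Suc.prems(2) cv Q(3) by (auto simp: minus_eq)
    moreover have "?g \<notin> P" using f(2) cv Suc.prems(3) by auto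
    ultimately obtain w where "w \<in> lists (insert None (Some ` \<Delta>))" "elim_word R w (map snd ys) \<in> Q - P"
      using Suc.hyps(1)[of ys] Suc.hyps(2) c(3) xs by auto
    then show ?thesis by (intro bexI[of _ "None # w"]) (simp_all add: xs)
  next
    case vP: False
    show ?thesis
    proof (cases "\<exists>d\<in>\<Delta>. v \<otimes> d ?f \<ominus> d v \<otimes> ?f \<notin> P")
      case True
      then obtain d where d: "d \<in> \<Delta>" "v \<otimes> d ?f \<ominus> d v \<otimes> ?f \<notin> P" by blast
      \<comment> \<open>Linearity over K and W v = 0 make \<open>W ?f\<close> the combination of the
        images of the remaining vectors with unchanged coefficients. It is in \<open>Q\<close>
        because \<open>Q\<close> is differential, and outside \<open>P\<close> by the choice of
        d.\<close>
      define W where "W = (\<lambda>u. v \<otimes> d u \<ominus> d v \<otimes> u)"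
      define zs where "zs = map (\<lambda>x. (fst x, W (snd x))) ys"
      have W: "W u \<in> carrier R" if "u \<in> carrier R" for u using that c(2) d(1) by (simp add: W_def)
      have dv: "d v \<in> carrier R" using c(2) d(1) by simp
      have W_add: "W (x \<oplus> y) = W x \<oplus> W y" if "x \<in> carrier R" "y \<in> carrier R" for x y
      proof -
        have "v \<otimes> (x' \<oplus> y') \<ominus> d v \<otimes> (x \<oplus> y) = (v \<otimes> x' \<ominus> d v \<otimes> x) \<oplus> (v \<otimes> y' \<ominus> d v \<otimes> y)"
          if "x' \<in> carrier R" "y' \<in> carrier R" for x' y'
          using that \<open>x \<in> carrier R\<close> \<open>y \<in> carrier R\<close> c(2) dv by algebra
        then show ?thesis using that d(1) by (simp add: W_def d_add)
      qed
      have W_smult: "W (a \<odot> x) = a \<odot> W x" if "a \<in> carrier K" "x \<in> carrier R" for a x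
      proof -
        have "v \<otimes> (a \<odot> d x) = a \<odot> (v \<otimes> d x)" "d v \<otimes> (a \<odot> x) = a \<odot> (d v \<otimes> x)"
          using that c(2) d(1) dv m_comm[of v] m_comm[of "d v"] by (simp_all add: alg.smult_assoc2)
        then show ?thesis
          using that c(2) d(1) dv
          by (simp add: W_def d_smult minus_eq alg.smult_r_distr alg.smult_r_minus)
      qed
      have "W v = \<zero>" using c(2) d(1) by (simp add: W_def minus_eq m_comm r_neg)
      then have "W ?f = W ?g"
        using f(2) g c by (simp add: W_add W_smult W)
      moreover have "W \<zero> = \<zero>" using d(1) c(2) by (simp add: W_def d_zero minus_eq)
      then have "lin_comb zs = W ?g"
        unfolding zs_def using W W_add W_smult c(3) by (intro lin_comb_map) auto
      ultimately have zs: "lin_comb zs = W ?f" by simp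
      have "d ?f \<in> Q" using delta_ideal_d[OF Q(2) d(1) Suc.prems(2)] .
      then have "W ?f \<in> Q"
        using Suc.prems(2) c(2) dv by (simp add: W_def minus_eq Q.I_l_closed)
      moreover have "W ?f \<notin> P" using d(2) by (simp add: W_def)
      moreover have "set zs \<subseteq> carrier K \<times> carrier R" using c(3) W by (auto simp: zs_def)
      ultimately obtain w where "w \<in> lists (insert None (Some ` \<Delta>))" "elim_word R w (map snd zs) \<in> Q - P"
        using Suc.hyps(1)[of zs] Suc.hyps(2) zs xs by (auto simp: zs_def)
      moreover have "map snd zs = map (\<lambda>u. v \<otimes> d u \<ominus> d v \<otimes> u) (map snd ys)"
        by (simp add: zs_def W_def)
      ultimately show ?thesis using d(1)
        by (intro bexI[of _ "Some d # w"]) (simp_all add: xs del: map_map)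
    next
      case False
      have "constant_fraction ?f v"
        unfolding constant_fraction_def
      proof
        fix d assume d: "d \<in> \<Delta>"
        have "v \<otimes> d ?f \<ominus> d v \<otimes> ?f \<in> P" using False d by blast
        then show "d ?f \<otimes> v \<ominus> ?f \<otimes> d v \<in> P" using c(2) f(1) d by (simp add: m_comm)
      qed
      then have "fr ?f v \<in> Frac_constants R \<Delta> P" using f(1) c(2) vP by (simp add: Frac_constants_fr_iff)
      then have "(ring.algebraic F over (scalar_in_Frac R P ` carrier K)) (fr ?f v)"
        using rational by (simp add: delta_rational_def)
      then obtain cs where "set cs \<subseteq> carrier K" "\<exists>c\<in>set cs. c \<noteq> \<zero>\<^bsub>K\<^esub>" "hom_eval cs ?f v \<in> P"
        using algebraic_fr_iff[OF f(1) c(2) vP] by blast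
      \<comment> \<open>The relation satisfied by f/v makes a power of v a multiple of f modulo
        \<open>P\<close>. As f is in \<open>Q\<close>, so is v, and the empty word already returns
        v.\<close>
      then obtain n t where t: "t \<in> carrier R" "v [^] (n::nat) \<ominus> ?f \<otimes> t \<in> P"
        using hom_eval_mem_prime[OF P.primeideal f(1) c(2) Suc.prems(3)] by blast
      have "(v [^] n \<ominus> ?f \<otimes> t) \<oplus> ?f \<otimes> t \<in> Q"
        using t Q(3) Q.I_r_closed[OF Suc.prems(2) t(1)] by (intro Q.a_closed) auto
      also have "(v [^] n \<ominus> ?f \<otimes> t) \<oplus> ?f \<otimes> t = v [^] n"
        using t(1) f(1) c(2) by (simp add: diff_add_cancel)
      finally have "v \<in> Q" using prime_pow_mem[OF Q(1) c(2)] by blast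
      then show ?thesis using vP by (intro bexI[of _ "[]"]) (simp_all add: xs)
    qed
  qed
qed

lemma small_separating_family:
  assumes noeth: "noetherian_ring R" and K: "infinite (carrier K)"
    and primes: "\<And>Q. delta_prime R \<Delta> Q \<Longrightarrow> primeideal Q R"
    and B: "infinite B" "B \<subseteq> carrier R" "alg.span B = carrier R" "|B| <o |carrier K|"
    and \<Delta>: "|\<Delta>| <o |carrier K|"
    and rational: "delta_rational K R \<Delta> P"
  shows "\<exists>\<Lambda>. |\<Lambda>| <o |carrier K| \<and> (\<forall>Q\<in>\<Lambda>. delta_prime R \<Delta> Q \<and> P \<subset> Q) \<and>
    (\<forall>Q. delta_prime R \<Delta> Q \<longrightarrow> P \<subset> Q \<longrightarrow> (\<exists>L\<in>\<Lambda>. L \<subseteq> Q))"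
proof -
  define W where "W = (\<lambda>(w, vs). elim_word R w vs) ` (lists (insert None (Some ` \<Delta>)) \<times> lists B)"
  have "|insert None (Some ` \<Delta>)| <o |carrier K|"
  proof -
    have "|Some ` \<Delta>| <o |carrier K|" using card_of_image \<Delta> by (rule ordLeq_ordLess_trans)
    moreover have "|{None}| <o |carrier K|" using K by (intro finite_ordLess_infinite2) simp_all
    ultimately have "|{None} \<union> Some ` \<Delta>| <o |carrier K|"
      using K by (intro card_of_Un_ordLess_infinite)
    then show ?thesis by simp
  qed
  then have "|lists (insert None (Some ` \<Delta>)) \<times> lists B| <o |carrier K|"
    using K B by (intro card_of_Times_ordLess_infinite lists_ordLess[OF B(1,4)])
  then have W: "|W| <o |carrier K|"
    unfolding W_def using card_of_image ordLeq_ordLess_trans by blast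
  \<comment> \<open>The differential ideal generated by \<open>P\<close> and w; the \<Delta>-primes
    above it are those above \<open>P\<close> that contain w.\<close>
  define I where "I = (\<lambda>w. \<Inter>{I. delta_ideal R \<Delta> I \<and> P \<subseteq> I \<and> w \<in> I})"
  have I: "delta_ideal R \<Delta> (I w)" if w: "w \<in> carrier R" for w
  proof -
    have top: "delta_ideal R \<Delta> (carrier R)" by (auto simp: delta_ideal_def oneideal)
    have "ideal (I w) R"
      unfolding I_def using top w P.a_subset
      by (intro i_Intersect) (auto simp: delta_ideal_def)
    moreover have "d x \<in> I w" if "d \<in> \<Delta>" "x \<in> I w" for d x
      using that by (auto simp: I_def delta_ideal_def)
    ultimately show ?thesis by (auto simp: delta_ideal_def)
  qed
  define \<F> where "\<F> = (\<lambda>w. SOME \<F>. finite \<F> \<and> (\<forall>Q\<in>\<F>. delta_prime R \<Delta> Q \<and> I w \<subseteq> Q) \<and>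
    (\<forall>Q. delta_prime R \<Delta> Q \<longrightarrow> I w \<subseteq> Q \<longrightarrow> (\<exists>L\<in>\<F>. L \<subseteq> Q)))"
  have good: "finite (\<F> w) \<and> (\<forall>Q\<in>\<F> w. delta_prime R \<Delta> Q \<and> I w \<subseteq> Q) \<and>
      (\<forall>Q. delta_prime R \<Delta> Q \<longrightarrow> I w \<subseteq> Q \<longrightarrow> (\<exists>L\<in>\<F> w. L \<subseteq> Q))" if "w \<in> carrier R" for w
    unfolding \<F>_def by (rule someI_ex[OF finite_minimal_delta_primes[OF noeth I[OF that]]])
  have F1: "finite (\<F> w)" if "w \<in> carrier R" for w using good[OF that] by simp
  have F2: "delta_prime R \<Delta> Q \<and> I w \<subseteq> Q" if "w \<in> carrier R" "Q \<in> \<F> w" for w Q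
    using good[OF that(1)] that(2) by simp
  have F3: "\<exists>L\<in>\<F> w. L \<subseteq> Q" if "w \<in> carrier R" "delta_prime R \<Delta> Q" "I w \<subseteq> Q" for w Q
    using good[OF that(1)] that(2,3) by simp
  \<comment> \<open>A word too long for its list ends in the unspecified value \<open>hd []\<close>,
    so values outside R have to be filtered out. Removing \<open>P\<close> makes each
    \<open>I w\<close> strictly larger than \<open>P\<close>.\<close>
  define W' where "W' = W \<inter> (carrier R - P)"
  define \<Lambda> where "\<Lambda> = (\<Union>w\<in>W'. \<F> w)"
  have "|\<Lambda>| <o |carrier K|"
    unfolding \<Lambda>_def
  proof (rule UNION_finite_ordLess[OF K])
    show "|W'| <o |carrier K|"
      unfolding W'_def using card_of_mono1[OF Int_lower1] W by (rule ordLeq_ordLess_trans)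
  qed (simp add: F1 W'_def)
  moreover have "delta_prime R \<Delta> Q \<and> P \<subset> Q" if Q\<Lambda>: "Q \<in> \<Lambda>" for Q
  proof -
    obtain w where w: "w \<in> W'" "Q \<in> \<F> w" using Q\<Lambda> unfolding \<Lambda>_def by (elim UN_E)
    then have wR: "w \<in> carrier R" "w \<notin> P" by (auto simp: W'_def)
    have "P \<subseteq> I w" "w \<in> I w" by (auto simp: I_def)
    then show ?thesis using F2[OF wR(1) w(2)] wR(2) by blast
  qed
  moreover have "\<exists>L\<in>\<Lambda>. L \<subseteq> Q" if Q: "delta_prime R \<Delta> Q" "P \<subset> Q" for Q
  proof -
    have Qp: "primeideal Q R" using primes Q(1) .
    have Qd: "delta_ideal R \<Delta> Q" using Q(1) by (simp add: delta_prime_def)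
    interpret Q: primeideal Q R by fact
    obtain f where f: "f \<in> Q" "f \<notin> P" using Q(2) by blast
    then have "f \<in> alg.span B" using B(3) Q.Icarr by simp
    then obtain a A where A: "finite A" "A \<subseteq> B" "a \<in> A \<rightarrow> carrier K" "f = alg.lincomb a A"
      unfolding alg.span_def by blast
    obtain vs where vs: "distinct vs" "set vs = A" using finite_distinct_list[OF A(1)] by blast
    let ?xs = "map (\<lambda>v. (a v, v)) vs"
    have fxs: "f = lin_comb ?xs"
      using A(2-4) B(2) vs lincomb_eq_lin_comb[of vs a] by simp
    have "set ?xs \<subseteq> carrier K \<times> carrier R" using A(2,3) B(2) vs by auto
    then obtain w where w: "w \<in> lists (insert None (Some ` \<Delta>))" "elim_word R w (map snd ?xs) \<in> Q - P"
      using ex_elim_word[OF rational Qp Qd] Q(2) f fxs by blast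
    moreover have "map snd ?xs = vs" by (simp add: comp_def)
    ultimately have e: "elim_word R w vs \<in> Q - P" by simp
    let ?w = "elim_word R w vs"
    have wR: "?w \<in> carrier R" using e Q.Icarr by simp
    have "vs \<in> lists B" using vs A(2) by auto
    then have "?w \<in> W" unfolding W_def using w(1) by (intro image_eqI[of _ _ "(w, vs)"]) simp_all
    then have "?w \<in> W'" using e wR by (simp add: W'_def)
    moreover have "I ?w \<subseteq> Q" unfolding I_def using Qd Q(2) e by (intro Inter_lower) auto
    then have "\<exists>L\<in>\<F> ?w. L \<subseteq> Q" by (rule F3[OF wR Q(1)])
    ultimately show ?thesis unfolding \<Lambda>_def by blast
  qed
  ultimately show ?thesis by blast
qed

lemma ex_maximal_core:
  assumes noeth: "noetherian_ring R" and K: "infinite (carrier K)"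
    and primes: "\<And>Q. delta_prime R \<Delta> Q \<Longrightarrow> primeideal Q R"
    and B: "infinite B" "B \<subseteq> carrier R" "alg.span B = carrier R" "|B| <o |carrier K|"
    and \<Lambda>: "|\<Lambda>| <o |carrier K|" "\<And>Q. Q \<in> \<Lambda> \<Longrightarrow> P \<subset> Q \<and> Q \<subseteq> carrier R"
    and sep: "\<And>Q. \<lbrakk>delta_prime R \<Delta> Q; P \<subset> Q\<rbrakk> \<Longrightarrow> \<exists>L\<in>\<Lambda>. L \<subseteq> Q"
  shows "\<exists>M. maximalideal M R \<and> P = delta_core R \<Delta> M"
proof -
  have "\<forall>Q\<in>\<Lambda>. \<exists>f. f \<in> carrier R \<and> f \<in> Q \<and> f \<notin> P" using \<Lambda>(2) by blast
  then obtain f where f: "\<And>Q. Q \<in> \<Lambda> \<Longrightarrow> f Q \<in> carrier R \<and> f Q \<in> Q \<and> f Q \<notin> P" by metis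
  \<comment> \<open>The multiplicative set generated by the chosen elements. Being indexed by lists
    it has fewer than |K| members, and it avoids \<open>P\<close> because \<open>P\<close> is
    prime.\<close>
  define S where "S = (\<lambda>fs. foldr (\<otimes>) fs \<one>) ` lists (f ` \<Lambda>)"
  have closed: "foldr (\<otimes>) fs \<one> \<in> carrier R - P" if "fs \<in> lists (f ` \<Lambda>)" for fs
    using that
  proof (induction fs)
    case Nil
    then show ?case using one_notin by simp
  next
    case (Cons x fs)
    then show ?case using f mult_notin[of x "foldr (\<otimes>) fs \<one>"] by auto
  qed
  have append: "foldr (\<otimes>) (fs @ gs) \<one> = foldr (\<otimes>) fs \<one> \<otimes> foldr (\<otimes>) gs \<one>"
    if "fs \<in> lists (f ` \<Lambda>)" "gs \<in> lists (f ` \<Lambda>)" for fs gs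
    using that(1)
  proof (induction fs)
    case Nil
    then show ?case using closed[OF that(2)] by simp
  next
    case (Cons x fs)
    then have "x \<in> carrier R" "fs \<in> lists (f ` \<Lambda>)" using f by auto
    then show ?case using Cons closed[of fs] closed[OF that(2)] by (simp add: m_assoc)
  qed
  have S: "S \<subseteq> carrier R" "S \<inter> P = {}" using closed by (auto simp: S_def)
  have S1: "\<one> \<in> S" unfolding S_def by (rule image_eqI[of _ _ "[]"]) simp_all
  have Sm: "s \<otimes> t \<in> S" if st: "s \<in> S" "t \<in> S" for s t
  proof -
    obtain fs where fs: "s = foldr (\<otimes>) fs \<one>" "fs \<in> lists (f ` \<Lambda>)"
      using st(1) unfolding S_def by (elim imageE)
    moreover obtain gs where gs: "t = foldr (\<otimes>) gs \<one>" "gs \<in> lists (f ` \<Lambda>)"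
      using st(2) unfolding S_def by (elim imageE)
    ultimately show ?thesis unfolding S_def using append[of fs gs] by (intro image_eqI[of _ _ "fs @ gs"]) auto
  qed
  have fS: "f Q \<in> S" if "Q \<in> \<Lambda>" for Q
    unfolding S_def using that f by (intro image_eqI[of _ _ "[f Q]"]) auto
  have "|f ` \<Lambda>| <o |carrier K|" using card_of_image \<Lambda>(1) by (rule ordLeq_ordLess_trans)
  then have "|lists (f ` \<Lambda>)| <o |carrier K|" by (rule lists_ordLess[OF B(1,4)])
  then have Sc: "|S| <o |carrier K|"
    unfolding S_def using card_of_image ordLeq_ordLess_trans by blast
  obtain M where M: "primeideal M R" "P \<subseteq> M" "S \<inter> M = {}"
    and inv: "\<And>x. \<lbrakk>x \<in> carrier R; x \<notin> M\<rbrakk> \<Longrightarrow> \<exists>r\<in>carrier R. \<exists>s\<in>S. x \<otimes> r \<ominus> s \<in> M"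
    using ex_prime_avoiding[OF noeth P.is_ideal S(1) S1 Sm S(2)] by blast
  interpret M: primeideal M R by (rule M(1))
  \<comment> \<open>So far \<open>M\<close> is maximal only among ideals avoiding \<open>S\<close>.
    Counting with denominators from \<open>S\<close> makes every element algebraic modulo
    \<open>M\<close>, so R/M is a field even before localisation.\<close>
  have "maximalideal M R"
    by (rule maximalideal_if_algebraic[OF M(1)])
      (rule algebraic_mod_if_small[OF K B(2-4) M(1) S(1) M(3) Sc inv])
  moreover have "P = delta_core R \<Delta> M"
  proof (rule ccontr)
    \<comment> \<open>The core is a \<Delta>-prime ideal above \<open>P\<close>. If it were larger,
      it would contain some L in \<Lambda>, and \<open>f L\<close> would be a common element of
      \<open>S\<close> and \<open>M\<close>.\<close>
    assume ne: "P \<noteq> delta_core R \<Delta> M"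
    have "P \<subseteq> delta_core R \<Delta> M" using delta_core_greatest(3)[OF M.is_ideal delta_P M(2)] .
    then obtain L where L: "L \<in> \<Lambda>" "L \<subseteq> delta_core R \<Delta> M"
      using sep[OF delta_prime_core[OF M(1)]] ne by blast
    then have "f L \<in> M" using f[OF L(1)] delta_core_greatest(2)[OF M.is_ideal] by blast
    then show False using fS[OF L(1)] M(3) by blast
  qed
  ultimately show ?thesis by blast
qed

end

section \<open>Closures of points in the differential spectrum\<close>

lemma openin_zariski_iff:
  "openin (zariski R) U \<longleftrightarrow> (\<exists>A\<subseteq>carrier R. U = {Q. primeideal Q R \<and> \<not> A \<subseteq> Q})"
  unfolding zariski_def by (simp add: topology_inverse'[OF istopology_zariski])

lemma (in cring) topspace_zariski: "topspace (zariski R) = {Q. primeideal Q R}"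
proof
  show "topspace (zariski R) \<subseteq> {Q. primeideal Q R}"
    by (auto simp: topspace_def openin_zariski_iff)
  have "{Q. primeideal Q R} = {Q. primeideal Q R \<and> \<not> {\<one>} \<subseteq> Q}"
  proof -
    have "\<one> \<notin> Q" if "primeideal Q R" for Q
      using that primeideal.I_notcarr ideal.one_imp_carrier[of Q R] by (auto simp: primeideal_def)
    then show ?thesis by auto
  qed
  then have "openin (zariski R) {Q. primeideal Q R}"
    unfolding openin_zariski_iff by (intro exI[of _ "{\<one>}"]) simp
  then show "{Q. primeideal Q R} \<subseteq> topspace (zariski R)" by (rule openin_subset)
qed

lemma (in cring) topspace_delta_spec:
  "topspace (delta_spec R \<Delta>) = {Q. primeideal Q R \<and> delta_prime R \<Delta> Q}"
  by (auto simp: delta_spec_def topspace_zariski)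

lemma (in cring) closure_of_delta_spec:
  assumes "P \<in> topspace (delta_spec R \<Delta>)"
  shows "delta_spec R \<Delta> closure_of {P} = {Q \<in> topspace (delta_spec R \<Delta>). P \<subseteq> Q}"
proof -
  have P: "primeideal P R" "delta_prime R \<Delta> P" using assms by (auto simp: topspace_delta_spec)
  have "Q \<in> delta_spec R \<Delta> closure_of {P} \<longleftrightarrow> P \<subseteq> Q" if Q: "Q \<in> topspace (delta_spec R \<Delta>)" for Q
  proof
    have Q': "primeideal Q R" "delta_prime R \<Delta> Q" using Q by (auto simp: topspace_delta_spec)
    assume cl: "Q \<in> delta_spec R \<Delta> closure_of {P}"
    show "P \<subseteq> Q"
    proof (rule ccontr)
      assume "\<not> P \<subseteq> Q"
      let ?U = "{Q. primeideal Q R \<and> \<not> P \<subseteq> Q}"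
      have "P \<subseteq> carrier R" using P(1) ideal.Icarr[of P R] by (auto simp: primeideal_def)
      then have "openin (zariski R) ?U" unfolding openin_zariski_iff by blast
      then have "openin (delta_spec R \<Delta>) (?U \<inter> {P. delta_prime R \<Delta> P})"
        unfolding delta_spec_def openin_subtopology by blast
      moreover have "Q \<in> ?U \<inter> {P. delta_prime R \<Delta> P}" using Q' \<open>\<not> P \<subseteq> Q\<close> by simp
      moreover have "\<forall>T. Q \<in> T \<and> openin (delta_spec R \<Delta>) T \<longrightarrow> P \<in> T"
        using cl by (simp add: in_closure_of)
      ultimately have "P \<in> ?U \<inter> {P. delta_prime R \<Delta> P}" by metis
      then show False by simp
    qed
  next
    assume PQ: "P \<subseteq> Q"
    have "P \<in> T" if T: "Q \<in> T" "openin (delta_spec R \<Delta>) T" for T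
    proof -
      obtain A where "T = {Q. primeideal Q R \<and> \<not> A \<subseteq> Q} \<inter> {P. delta_prime R \<Delta> P}"
        using T(2) by (auto simp: delta_spec_def openin_subtopology openin_zariski_iff)
      then show ?thesis using T(1) P PQ by auto
    qed
    then show "Q \<in> delta_spec R \<Delta> closure_of {P}" using Q by (simp add: in_closure_of)
  qed
  then show ?thesis using closure_of_subset_topspace[of "delta_spec R \<Delta>" "{P}"] by auto
qed

text \<open>The closure of a point consists of the \<Delta>-primes above it, so a covering of the
  punctured closure by closures of points is a family below every \<Delta>-prime strictly above
  \<open>P\<close>. The assumption \<open>primes\<close> makes every \<Delta>-prime a point of the
  subspace of the prime spectrum.\<close>

lemma (in cring) separable_point_delta_spec_iff:
  assumes primes: "\<And>Q. delta_prime R \<Delta> Q \<Longrightarrow> primeideal Q R" and P: "delta_prime R \<Delta> P"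
  shows "separable_point \<kappa> (delta_spec R \<Delta>) P \<longleftrightarrow>
    (\<exists>\<Lambda>. |\<Lambda>| <o \<kappa> \<and> (\<forall>Q\<in>\<Lambda>. delta_prime R \<Delta> Q \<and> P \<subset> Q) \<and>
      (\<forall>Q. delta_prime R \<Delta> Q \<longrightarrow> P \<subset> Q \<longrightarrow> (\<exists>L\<in>\<Lambda>. L \<subseteq> Q)))"
proof -
  let ?T = "delta_spec R \<Delta>"
  have top: "Q \<in> topspace ?T \<longleftrightarrow> delta_prime R \<Delta> Q" for Q
    using primes by (auto simp: topspace_delta_spec)
  have cl: "?T closure_of {Q} = {L. delta_prime R \<Delta> L \<and> Q \<subseteq> L}" if "delta_prime R \<Delta> Q" for Q
    using closure_of_delta_spec[of Q \<Delta>] that by (auto simp: top)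
  have "\<Lambda> \<subseteq> (?T closure_of {P}) - {P} \<and>
        (?T closure_of {P}) - {P} = (\<Union>q\<in>\<Lambda>. ?T closure_of {q}) \<longleftrightarrow>
      (\<forall>Q\<in>\<Lambda>. delta_prime R \<Delta> Q \<and> P \<subset> Q) \<and>
      (\<forall>Q. delta_prime R \<Delta> Q \<longrightarrow> P \<subset> Q \<longrightarrow> (\<exists>L\<in>\<Lambda>. L \<subseteq> Q))" (is "?l \<longleftrightarrow> ?r") for \<Lambda>
  proof -
    have *: "\<Lambda> \<subseteq> (?T closure_of {P}) - {P} \<longleftrightarrow> (\<forall>Q\<in>\<Lambda>. delta_prime R \<Delta> Q \<and> P \<subset> Q)"
      using cl[OF P] by auto
    show ?thesis
    proof (cases "\<forall>Q\<in>\<Lambda>. delta_prime R \<Delta> Q \<and> P \<subset> Q")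
      case True
      then have e1: "(\<Union>q\<in>\<Lambda>. ?T closure_of {q}) = (\<Union>q\<in>\<Lambda>. {L. delta_prime R \<Delta> L \<and> q \<subseteq> L})"
        using cl by simp
      have e2: "(?T closure_of {P}) - {P} = {L. delta_prime R \<Delta> L \<and> P \<subset> L}"
        using cl[OF P] by auto
      have sub: "(\<Union>q\<in>\<Lambda>. {L. delta_prime R \<Delta> L \<and> q \<subseteq> L}) \<subseteq> {L. delta_prime R \<Delta> L \<and> P \<subset> L}"
        using True by auto
      have "(?T closure_of {P}) - {P} = (\<Union>q\<in>\<Lambda>. ?T closure_of {q}) \<longleftrightarrow>
          {L. delta_prime R \<Delta> L \<and> P \<subset> L} \<subseteq> (\<Union>q\<in>\<Lambda>. {L. delta_prime R \<Delta> L \<and> q \<subseteq> L})"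
        unfolding e1 e2 set_eq_subset by (simp only: sub simp_thms)
      also have "\<dots> \<longleftrightarrow> (\<forall>Q. delta_prime R \<Delta> Q \<longrightarrow> P \<subset> Q \<longrightarrow> (\<exists>L\<in>\<Lambda>. L \<subseteq> Q))"
      proof (intro iffI allI impI subsetI)
        fix Q
        assume XY: "{L. delta_prime R \<Delta> L \<and> P \<subset> L} \<subseteq> (\<Union>q\<in>\<Lambda>. {L. delta_prime R \<Delta> L \<and> q \<subseteq> L})"
          and "delta_prime R \<Delta> Q" "P \<subset> Q"
        then have "Q \<in> {L. delta_prime R \<Delta> L \<and> P \<subset> L}" by simp
        from subsetD[OF XY this] show "\<exists>L\<in>\<Lambda>. L \<subseteq> Q" by simp
      qed simp
      finally show ?thesis using True by (simp only: *)
    qed (use * in blast)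
  qed
  note equivalence = this
  have "separable_point \<kappa> ?T P \<longleftrightarrow> (\<exists>\<Lambda>. |\<Lambda>| <o \<kappa> \<and> (\<Lambda> \<subseteq> (?T closure_of {P}) - {P} \<and>
      (?T closure_of {P}) - {P} = (\<Union>q\<in>\<Lambda>. ?T closure_of {q})))"
    using P by (simp only: separable_point_def top simp_thms conj_left_commute[of "_ \<subseteq> _"])
  then show ?thesis by (simp only: equivalence)
qed

section \<open>Characteristic zero and the final assembly\<close>

lemma (in ring) infinite_carrier_if_char_zero:
  assumes char_zero: "\<And>n::nat. n > 0 \<Longrightarrow> add_pow R n \<one> \<noteq> \<zero>"
  shows "infinite (carrier R)"
proof -
  have "inj (\<lambda>n::nat. add_pow R n \<one>)"
  proof (rule linorder_injI)
    fix m n :: nat assume "m < n"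
    then obtain k where k: "n = m + k" "k > 0" by (metis less_imp_add_positive)
    show "add_pow R m \<one> \<noteq> add_pow R n \<one>"
    proof
      assume eq: "add_pow R m \<one> = add_pow R n \<one>"
      have "add_pow R m \<one> \<oplus> add_pow R k \<one> = add_pow R n \<one>"
        unfolding k(1) by (rule add.nat_pow_mult[OF one_closed])
      then have "add_pow R m \<one> \<oplus> add_pow R k \<one> = add_pow R m \<one>" by (simp only: eq)
      then have "add_pow R k \<one> = \<zero>" by simp
      then show False using char_zero k(2) by blast
    qed
  qed
  then have "infinite (range (\<lambda>n::nat. add_pow R n \<one>))" by (rule range_inj_infinite)
  then show ?thesis by (rule infinite_super[rotated]) auto
qed

text \<open>The locale \<open>differential_ring\<close> has no base field; characteristic zero
  reaches its lemmas as invertibility of the positive integers, which R inherits from K.\<close>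

lemma (in field_algebra) char_zero_Units:
  assumes char_zero: "\<And>n::nat. n > 0 \<Longrightarrow> add_pow K n \<one>\<^bsub>K\<^esub> \<noteq> \<zero>\<^bsub>K\<^esub>" and "n > 0"
  shows "add_pow R (n::nat) \<one> \<in> Units R"
proof -
  let ?c = "add_pow K n \<one>\<^bsub>K\<^esub>"
  have "add_pow R m \<one> = add_pow K m \<one>\<^bsub>K\<^esub> \<odot> \<one>" for m :: nat
    by (induction m) (simp_all add: alg.smult_l_distr)
  moreover have c: "?c \<in> carrier K" "?c \<noteq> \<zero>\<^bsub>K\<^esub>" using assms by simp_all
  have i: "inv\<^bsub>K\<^esub> ?c \<in> carrier K" "inv\<^bsub>K\<^esub> ?c \<otimes>\<^bsub>K\<^esub> ?c = \<one>\<^bsub>K\<^esub>"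
    using c by (simp_all add: K.field_Units)
  have "(inv\<^bsub>K\<^esub> ?c \<odot> \<one>) \<otimes> (?c \<odot> \<one>) = \<one>"
    using i c(1) by (simp flip: sc.hom_mult)
  then have "?c \<odot> \<one> \<in> Units R"
    using i c(1) m_comm[of "inv\<^bsub>K\<^esub> ?c \<odot> \<one>" "?c \<odot> \<one>"]
    unfolding Units_def by (intro CollectI conjI bexI[of _ "inv\<^bsub>K\<^esub> ?c \<odot> \<one>"]) simp_all
  ultimately show ?thesis by simp
qed

lemma (in differential_algebra) differential_ring: "differential_ring R \<Delta>"
proof (intro differential_ring.intro differential_ring_axioms.intro)
  show "cring R" by (rule R.is_cring)
  fix d x assume d: "d \<in> \<Delta>" and x: "x \<in> carrier R"
  have D: "d \<in> Der K R" using d derivations by blast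
  then show "d x \<in> carrier R" using x by (auto simp: Der_def)
  fix y assume y: "y \<in> carrier R"
  show "d (x \<oplus>\<^bsub>R\<^esub> y) = d x \<oplus>\<^bsub>R\<^esub> d y" "d (x \<otimes>\<^bsub>R\<^esub> y) = d x \<otimes>\<^bsub>R\<^esub> y \<oplus>\<^bsub>R\<^esub> x \<otimes>\<^bsub>R\<^esub> d y"
    using D x y by (simp_all add: Der_def)
qed

theorem theorem4p5:
  fixes K :: "('a, 'c) ring_scheme" and R :: "('a, 'b, 'd) module_scheme"
    and \<Delta> :: "('b \<Rightarrow> 'b) set" and P :: "'b set"
  assumes "differential_algebra K R \<Delta>"
    and char_zero: "\<And>n::nat. n > 0 \<Longrightarrow> [n] \<cdot>\<^bsub>K\<^esub> \<one>\<^bsub>K\<^esub> \<noteq> \<zero>\<^bsub>K\<^esub>"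
    and "noetherian_ring R"
    and dim: "\<exists>B. vectorspace.basis K R B \<and> |B| <o |carrier K|"
    and "|\<Delta>| <o |carrier K|"
    and "delta_prime R \<Delta> P"
  shows "(delta_primitive R \<Delta> P \<longleftrightarrow> delta_rational K R \<Delta> P) \<and>
         (delta_rational K R \<Delta> P \<longleftrightarrow> separable_point |carrier K| (delta_spec R \<Delta>) P)"
proof -
  note noeth = assms(3) and P = assms(6)
  interpret DA: differential_algebra K R \<Delta> by fact
  have FA: "field_algebra R K"
    by (intro field_algebra.intro DA.R.is_cring DA.K.field_axioms DA.R.algebra_axioms)
  have DR: "differential_ring R \<Delta>" by (rule DA.differential_ring)
  have primes: "primeideal Q R" if "delta_prime R \<Delta> Q" for Q
    using differential_ring.delta_prime_imp_primeideal[OF DR noeth _ that]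
      field_algebra.char_zero_Units[OF FA char_zero] by blast
  have K: "infinite (carrier K)"
    using ring.infinite_carrier_if_char_zero[OF DA.K.ring_axioms] char_zero by blast
  have Pd: "delta_ideal R \<Delta> P" using P by (simp add: delta_prime_def)
  have "delta_prime_quotient R K P \<Delta>"
  proof (intro delta_prime_quotient.intro delta_prime_quotient_axioms.intro prime_quotient.intro)
    show "d (c \<odot>\<^bsub>R\<^esub> x) = c \<odot>\<^bsub>R\<^esub> d x" if "d \<in> \<Delta>" "c \<in> carrier K" "x \<in> carrier R" for d c x
      using that DA.derivations by (auto simp: Der_def)
  qed (use FA DR primes[OF P] Pd in simp_all)
  then interpret delta_prime_quotient R K P \<Delta> .
  obtain B where B: "B \<subseteq> carrier R" "module.span K R B = carrier R" "|B| <o |carrier K|"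
    using dim by (auto simp: vectorspace.basis_def[OF vectorspace])
  have prim_rat: "delta_rational K R \<Delta> P" if "delta_primitive R \<Delta> P"
  proof -
    from that obtain M where "maximalideal M R" "P = delta_core R \<Delta> M"
      unfolding delta_primitive_def by blast
    then show ?thesis by (rule delta_rational_if_core[OF K B])
  qed
  let ?sep = "\<lambda>\<Lambda>. |\<Lambda>| <o |carrier K| \<and> (\<forall>Q\<in>\<Lambda>. delta_prime R \<Delta> Q \<and> P \<subset> Q) \<and>
    (\<forall>Q. delta_prime R \<Delta> Q \<longrightarrow> P \<subset> Q \<longrightarrow> (\<exists>L\<in>\<Lambda>. L \<subseteq> Q))"
  have sep_iff: "separable_point |carrier K| (delta_spec R \<Delta>) P \<longleftrightarrow> (\<exists>\<Lambda>. ?sep \<Lambda>)"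
    using primes P by (rule cring.separable_point_delta_spec_iff[OF DA.R.is_cring])
  show ?thesis
  proof (cases "finite B")
    case True
    \<comment> \<open>In finite dimension R/P is a field. Then \<open>P\<close> is its own core, and
      no \<Delta>-prime lies strictly above it, so the empty family witnesses separability and all
      three conditions hold.\<close>
    have max: "maximalideal P R"
      using P.primeideal inverse_mod_if_finite[OF True B(1,2) P.primeideal]
      by (rule cring.maximalideal_if_inverses[OF DA.R.is_cring])
    have "P = delta_core R \<Delta> P"
      using delta_core_greatest(2,3)[OF P.is_ideal] Pd by blast
    then have "delta_primitive R \<Delta> P" unfolding delta_primitive_def using max by blast
    moreover have "\<not> P \<subset> Q" if Q: "delta_prime R \<Delta> Q" for Q
    proof
      assume PQ: "P \<subset> Q"
      interpret Q: primeideal Q R using primes Q .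
      have "Q = P \<or> Q = carrier R"
        using maximalideal.I_maximal[OF max Q.is_ideal] PQ Q.a_subset by blast
      then show False using PQ Q.I_notcarr by blast
    qed
    then have "?sep {}" using K by (simp add: finite_ordLess_infinite2)
    ultimately show ?thesis using prim_rat sep_iff by blast
  next
    case False
    have rat_sep: "\<exists>\<Lambda>. ?sep \<Lambda>" if "delta_rational K R \<Delta> P"
      using noeth K primes False B \<open>|\<Delta>| <o |carrier K|\<close> that by (rule small_separating_family)
    have sep_prim: "delta_primitive R \<Delta> P" if "?sep \<Lambda>" for \<Lambda>
    proof -
      have "\<exists>M. maximalideal M R \<and> P = delta_core R \<Delta> M"
      proof (rule ex_maximal_core[OF noeth K primes False B])
        show "|\<Lambda>| <o |carrier K|" using that by simp
        show "P \<subset> Q \<and> Q \<subseteq> carrier R" if "Q \<in> \<Lambda>" for Q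
        proof -
          have Q: "delta_prime R \<Delta> Q" "P \<subset> Q" using \<open>?sep \<Lambda>\<close> that by auto
          then show ?thesis using ideal.Icarr[of Q R] by (auto simp: delta_prime_def delta_ideal_def)
        qed
        show "\<exists>L\<in>\<Lambda>. L \<subseteq> Q" if "delta_prime R \<Delta> Q" "P \<subset> Q" for Q
          using \<open>?sep \<Lambda>\<close> that by simp
      qed
      then show ?thesis by (simp add: delta_primitive_def)
    qed
    have "delta_rational K R \<Delta> P \<Longrightarrow> separable_point |carrier K| (delta_spec R \<Delta>) P"
      unfolding sep_iff by (rule rat_sep)
    moreover have "separable_point |carrier K| (delta_spec R \<Delta>) P \<Longrightarrow> delta_primitive R \<Delta> P"
      unfolding sep_iff by (erule exE) (rule sep_prim)
    ultimately show ?thesis using prim_rat by blast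
  qed
qed

end
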